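(* Let $K$ be a field, let $S$ be either the formal power series ring $K[[x_1,\ldots,x_n]]$ or the polynomial ring $K[x_1,\ldots,x_n]$, and let $I\subset S$ be a proper ideal, graded if $S$ is the polynomial ring. Let $(\mathbb{F},\delta)$ be a minimal free $S$-resolution of $S/I$ (graded if $S$ is the polynomial ring), with $F_0=S$, $b_i=\operatorname{rank}F_i$, chosen bases $e_{i1},\ldots,e_{ib_i}$ of the $F_i$, and $\delta_i(e_{ij})=\sum_{k=1}^{b_{i-1}}\alpha^{(i)}_{kj}e_{i-1,k}$. For $i=1,\ldots,n$ and $j=1,\ldots,b_i$ let $$z_{ij}=\sum_{1\le r_1<\cdots<r_i\le n}\ \sum_{j_1=1}^{b_1}\cdots\sum_{j_{i-1}=1}^{b_{i-1}} d^{r_1}(\alpha^{(1)}_{j_0j_1})\,d^{r_2}(\alpha^{(2)}_{j_1j_2})\cdots d^{r_i}(\alpha^{(i)}_{j_{i-1}j})\,dx_{r_1}\cdots dx_{r_i}\in\Omega_i ,$$ where $j_0=1$ (recall $b_0=1$), and let $\bar z_{ij}$ be the image of $z_{ij}$ in $\Omega_i\otimes_S S/I$. Then for all $i$ and $j$ the element $\bar z_{ij}$ is a cycle of $\Omega\otimes_S S/I$, and for each $i$ the homology classes $[\bar z_{ij}]$, $j=1,\ldots,b_i$, form a $K$-basis of $H_i(\Omega\otimes_S S/I)$.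
   Context: $\mathfrak{n}=(x_1,\ldots,x_n)\subset S$. For $f\in\mathfrak{n}$ and $1\le r\le n$ define $$d^r(f)=\frac{f(0,\ldots,0,x_r,\ldots,x_n)-f(0,\ldots,0,x_{r+1},\ldots,x_n)}{x_r},$$ an element of $K[[x_r,\ldots,x_n]]$ (resp. $K[x_r,\ldots,x_n]$), viewed as an element of $S$. By minimality of $\mathbb{F}$ all $\alpha^{(i)}_{kj}$ lie in $\mathfrak{n}$; in the graded case the bases consist of homogeneous elements. $\Omega$ is the Koszul complex of $x_1,\ldots,x_n$ over $S$: $\Omega_1$ is the free $S$-module with basis $dx_1,\ldots,dx_n$, $\Omega_i=\bigwedge^i\Omega_1$, one writes $dx_{r_1}\cdots dx_{r_i}$ for $dx_{r_1}\wedge\cdots\wedge dx_{r_i}$, and the differential $\partial_i:\Omega_i\to\Omega_{i-1}$ is the $S$-linear map $$\partial_i(dx_{r_1}\cdots dx_{r_i})=\sum_{k=1}^i(-1)^{k+1}x_{r_k}\,dx_{r_1}\cdots dx_{r_{k-1}}dx_{r_{k+1}}\cdots dx_{r_i}.$$ *)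

theory Defs
  imports "HOL-Algebra.Algebra" "HOL-Algebra.Algebraic_Closure_Type"
begin

section \<open>Power series and polynomials in $x_1,\dots,x_n$\<close>

text \<open>As in \<^theory>\<open>HOL-Algebra.Indexed_Polynomials\<close>, a monomial is a multiset of indices of variables
  and a series is its coefficient function.\<close>

definition power_series_ring :: "nat \<Rightarrow> (nat multiset \<Rightarrow> 'k::field) ring" where
  "power_series_ring n =
    \<lparr>carrier = {f. \<forall>m. f m \<noteq> 0 \<longrightarrow> set_mset m \<subseteq> {1..n}},
     monoid.mult = (\<lambda>f g m. \<Sum>p | p \<subseteq># m. f p * g (m - p)),
     one = (\<lambda>m. if m = {#} then 1 else 0),
     ring.zero = (\<lambda>m. 0),
     add = (\<lambda>f g m. f m + g m)\<rparr>"

definition polynomial_ring :: "nat \<Rightarrow> (nat multiset \<Rightarrow> 'k::field) ring" where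
  "polynomial_ring n =
    (power_series_ring n)\<lparr>carrier := {f \<in> carrier (power_series_ring n). finite {m. f m \<noteq> 0}}\<rparr>"

definition const :: "'k::field \<Rightarrow> nat multiset \<Rightarrow> 'k" where
  "const c = (\<lambda>m. if m = {#} then c else 0)"

definition indet :: "nat \<Rightarrow> nat multiset \<Rightarrow> 'k::field" where
  "indet r = (\<lambda>m. if m = {#r#} then 1 else 0)"

definition indet_ideal :: "(nat multiset \<Rightarrow> 'k::field) ring \<Rightarrow> nat \<Rightarrow> (nat multiset \<Rightarrow> 'k) set" where
  "indet_ideal S n = Idl\<^bsub>S\<^esub> (indet ` {1..n})"

text \<open>\<open>tail_from r f\<close> is $f(0,\dots,0,x_r,\dots,x_n)$.\<close>

definition tail_from :: "nat \<Rightarrow> (nat multiset \<Rightarrow> 'k::field) \<Rightarrow> nat multiset \<Rightarrow> 'k" where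
  "tail_from r f = (\<lambda>m. if set_mset m \<subseteq> {r..} then f m else 0)"

text \<open>\<open>diff_quot r f\<close> is $d^r(f)$. The coefficient of \<open>m\<close> in a quotient by $x_r$ is the
  coefficient of $x_r m$ in the numerator; that the numerator is divisible by $x_r$
  is \<open>indet_mult_diff_quot\<close> below.\<close>

definition diff_quot :: "nat \<Rightarrow> (nat multiset \<Rightarrow> 'k::field) \<Rightarrow> nat multiset \<Rightarrow> 'k" where
  "diff_quot r f = (\<lambda>m. tail_from r f (add_mset r m) - tail_from (Suc r) f (add_mset r m))"

lemma indet_mult_diff_quot:
  assumes "S = power_series_ring n \<or> S = polynomial_ring n"
  shows "indet r \<otimes>\<^bsub>S\<^esub> diff_quot r f = (\<lambda>m. tail_from r f m - tail_from (Suc r) f m)"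
proof
  fix m :: "nat multiset"
  have fin: "finite {p. p \<subseteq># m}"
    by (rule finite_subset[of _ "\<Union>k\<le>size m. multisets_of_size (set_mset m) k"])
      (auto simp: multisets_of_size_def dest: mset_subset_eqD size_mset_mono intro!: finite_multisets_of_size[unfolded multisets_of_size_def])
  have "(indet r \<otimes>\<^bsub>S\<^esub> diff_quot r f) m = (\<Sum>p | p \<subseteq># m. indet r p * diff_quot r f (m - p))"
    using assms by (auto simp: power_series_ring_def polynomial_ring_def)
  also have "\<dots> = (\<Sum>p | p \<subseteq># m. if p = {#r#} then diff_quot r f (m - {#r#}) else 0)"
    by (rule sum.cong) (auto simp: indet_def)
  also have "\<dots> = (if r \<in># m then diff_quot r f (m - {#r#}) else 0)"
    using fin by (subst sum.delta) auto
  also have "\<dots> = tail_from r f m - tail_from (Suc r) f m"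
  proof (cases "r \<in># m")
    case False
    then have "set_mset m \<subseteq> {r..} \<longleftrightarrow> set_mset m \<subseteq> {Suc r..}"
      by (auto simp: subset_iff Suc_le_eq order.strict_iff_order)
    with False show ?thesis
      by (simp add: tail_from_def)
  qed (simp add: diff_quot_def)
  finally show "(indet r \<otimes>\<^bsub>S\<^esub> diff_quot r f) m = tail_from r f m - tail_from (Suc r) f m" .
qed

definition homogeneous_part :: "nat \<Rightarrow> (nat multiset \<Rightarrow> 'k::field) \<Rightarrow> nat multiset \<Rightarrow> 'k" where
  "homogeneous_part d f = (\<lambda>m. if size m = d then f m else 0)"

definition homogeneous_polys :: "nat \<Rightarrow> nat \<Rightarrow> (nat multiset \<Rightarrow> 'k::field) set" where
  "homogeneous_polys n d = {f \<in> carrier (polynomial_ring n). \<forall>m. f m \<noteq> 0 \<longrightarrow> size m = d}"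

definition graded_ideal :: "(nat multiset \<Rightarrow> 'k::field) set \<Rightarrow> bool" where
  "graded_ideal I \<longleftrightarrow> (\<forall>f\<in>I. \<forall>d. homogeneous_part d f \<in> I)"


section \<open>Modules\<close>

text \<open>The record type of modules extends that of rings; the fields \<open>mult\<close> and \<open>one\<close>
  play no role for a module.\<close>

definition mod_hom ::
    "('a, 'r) ring_scheme \<Rightarrow> ('a, 'b, 'm) module_scheme \<Rightarrow> ('a, 'c, 'l) module_scheme \<Rightarrow> ('b \<Rightarrow> 'c) set" where
  "mod_hom R M N = {f \<in> carrier M \<rightarrow> carrier N.
     (\<forall>x\<in>carrier M. \<forall>y\<in>carrier M. f (x \<oplus>\<^bsub>M\<^esub> y) = f x \<oplus>\<^bsub>N\<^esub> f y) \<and>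
     (\<forall>a\<in>carrier R. \<forall>x\<in>carrier M. f (a \<odot>\<^bsub>M\<^esub> x) = a \<odot>\<^bsub>N\<^esub> f x)}"

definition is_basis ::
    "('a, 'r) ring_scheme \<Rightarrow> ('a, 'b, 'm) module_scheme \<Rightarrow> 'i set \<Rightarrow> ('i \<Rightarrow> 'b) \<Rightarrow> bool" where
  "is_basis R M J v \<longleftrightarrow> finite J \<and> v \<in> J \<rightarrow> carrier M \<and>
     (\<forall>x\<in>carrier M. \<exists>!c. c \<in> J \<rightarrow>\<^sub>E carrier R \<and> x = (\<Oplus>\<^bsub>M\<^esub>j\<in>J. c j \<odot>\<^bsub>M\<^esub> v j))"

definition ring_module :: "('a, 'r) ring_scheme \<Rightarrow> ('a, 'a) module" where
  "ring_module R = \<lparr>carrier = carrier R, monoid.mult = monoid.mult R, one = one R,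
     ring.zero = ring.zero R, add = add R, module.smult = monoid.mult R\<rparr>"

definition free_module :: "('a, 'r) ring_scheme \<Rightarrow> 'i set \<Rightarrow> ('a, 'i \<Rightarrow> 'a) module" where
  "free_module R B =
    \<lparr>carrier = {w. (\<forall>x\<in>B. w x \<in> carrier R) \<and> (\<forall>x. x \<notin> B \<longrightarrow> w x = \<zero>\<^bsub>R\<^esub>) \<and> finite {x. w x \<noteq> \<zero>\<^bsub>R\<^esub>}},
     monoid.mult = undefined, one = undefined,
     ring.zero = (\<lambda>x. \<zero>\<^bsub>R\<^esub>),
     add = (\<lambda>v w x. v x \<oplus>\<^bsub>R\<^esub> w x),
     module.smult = (\<lambda>a w x. a \<otimes>\<^bsub>R\<^esub> w x)\<rparr>"

definition unit_vec :: "('a, 'r) ring_scheme \<Rightarrow> 'i \<Rightarrow> 'i \<Rightarrow> 'a" where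
  "unit_vec R y = (\<lambda>x. if x = y then \<one>\<^bsub>R\<^esub> else \<zero>\<^bsub>R\<^esub>)"

text \<open>Addition and zero of a quotient are those of \<^const>\<open>FactRing\<close>.\<close>

definition quotient_module :: "('a, 'b, 'm) module_scheme \<Rightarrow> 'b set \<Rightarrow> ('a, 'b set) module" where
  "quotient_module M N =
    \<lparr>carrier = a_rcosets\<^bsub>M\<^esub> N, monoid.mult = undefined, one = undefined,
     ring.zero = N, add = set_add M,
     module.smult = (\<lambda>a Y. \<Union>x\<in>Y. N +>\<^bsub>M\<^esub> (a \<odot>\<^bsub>M\<^esub> x))\<rparr>"

lemma quotient_module_module:
  assumes "module R M" and "submodule N R M"
  shows "module R (quotient_module M N)"
    and "\<And>a x. \<lbrakk>a \<in> carrier R; x \<in> carrier M\<rbrakk> \<Longrightarrow>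
      a \<odot>\<^bsub>quotient_module M N\<^esub> (N +>\<^bsub>M\<^esub> x) = N +>\<^bsub>M\<^esub> (a \<odot>\<^bsub>M\<^esub> x)"
proof -
  interpret M: module R M by fact
  interpret N: submodule N R M by fact
  interpret N: abelian_subgroup N M
    by (intro abelian_subgroupI3 additive_subgroup.intro N.subgroup_axioms M.abelian_group_axioms)
  show smult: "a \<odot>\<^bsub>quotient_module M N\<^esub> (N +>\<^bsub>M\<^esub> x) = N +>\<^bsub>M\<^esub> (a \<odot>\<^bsub>M\<^esub> x)"
    if a: "a \<in> carrier R" and x: "x \<in> carrier M" for a x
  proof -
    have "N +>\<^bsub>M\<^esub> (a \<odot>\<^bsub>M\<^esub> y) = N +>\<^bsub>M\<^esub> (a \<odot>\<^bsub>M\<^esub> x)" if y: "y \<in> N +>\<^bsub>M\<^esub> x" for y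
    proof -
      from y obtain h where h: "h \<in> N" "y = h \<oplus>\<^bsub>M\<^esub> x"
        by (auto simp: a_r_coset_def')
      then have "a \<odot>\<^bsub>M\<^esub> y = a \<odot>\<^bsub>M\<^esub> h \<oplus>\<^bsub>M\<^esub> a \<odot>\<^bsub>M\<^esub> x"
        using a x N.a_Hcarr by (simp add: M.smult_r_distr)
      then have "a \<odot>\<^bsub>M\<^esub> y \<in> N +>\<^bsub>M\<^esub> (a \<odot>\<^bsub>M\<^esub> x)"
        using N.smult_closed[OF a h(1)] by (auto simp: a_r_coset_def')
      then show ?thesis
        by (rule N.a_repr_independence'[symmetric]) (rule M.smult_closed[OF a x])
    qed
    moreover have "x \<in> N +>\<^bsub>M\<^esub> x"
      using x by (rule N.a_rcos_self)
    ultimately have "(\<Union>y\<in>N +>\<^bsub>M\<^esub> x. N +>\<^bsub>M\<^esub> (a \<odot>\<^bsub>M\<^esub> y)) = N +>\<^bsub>M\<^esub> (a \<odot>\<^bsub>M\<^esub> x)"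
      by blast
    then show ?thesis
      by (simp add: quotient_module_def)
  qed
  have carr: "carrier (quotient_module M N) = (\<lambda>x. N +>\<^bsub>M\<^esub> x) ` carrier M"
    by (auto simp: quotient_module_def A_RCOSETS_def')
  have add: "(N +>\<^bsub>M\<^esub> x) \<oplus>\<^bsub>quotient_module M N\<^esub> (N +>\<^bsub>M\<^esub> y) = N +>\<^bsub>M\<^esub> (x \<oplus>\<^bsub>M\<^esub> y)"
    if "x \<in> carrier M" "y \<in> carrier M" for x y
    using N.a_rcos_sum[OF that] by (simp add: quotient_module_def)
  have zero: "\<zero>\<^bsub>quotient_module M N\<^esub> = N +>\<^bsub>M\<^esub> \<zero>\<^bsub>M\<^esub>"
    using M.a_coset_add_zero[OF N.a_subset] by (simp add: quotient_module_def)
  have "abelian_group (quotient_module M N)"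
  proof (rule abelian_groupI)
    fix Y assume "Y \<in> carrier (quotient_module M N)"
    then obtain y where y: "y \<in> carrier M" "Y = N +>\<^bsub>M\<^esub> y"
      by (auto simp: carr)
    then have "(N +>\<^bsub>M\<^esub> (\<ominus>\<^bsub>M\<^esub> y)) \<oplus>\<^bsub>quotient_module M N\<^esub> Y = \<zero>\<^bsub>quotient_module M N\<^esub>"
      by (simp add: add zero M.l_neg)
    with y show "\<exists>Z\<in>carrier (quotient_module M N).
        Z \<oplus>\<^bsub>quotient_module M N\<^esub> Y = \<zero>\<^bsub>quotient_module M N\<^esub>"
      by (auto simp: carr)
  qed (auto simp: carr add zero M.a_ac)
  then show "module R (quotient_module M N)"
  proof (intro moduleI)
    show "cring R" by (rule M.R.cring_axioms)
  next
    fix a Y assume "a \<in> carrier R" "Y \<in> carrier (quotient_module M N)"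
    then show "a \<odot>\<^bsub>quotient_module M N\<^esub> Y \<in> carrier (quotient_module M N)"
      by (auto simp: carr smult)
  next
    fix a c Y assume "a \<in> carrier R" "c \<in> carrier R" "Y \<in> carrier (quotient_module M N)"
    then show "(a \<oplus>\<^bsub>R\<^esub> c) \<odot>\<^bsub>quotient_module M N\<^esub> Y =
        a \<odot>\<^bsub>quotient_module M N\<^esub> Y \<oplus>\<^bsub>quotient_module M N\<^esub> c \<odot>\<^bsub>quotient_module M N\<^esub> Y"
      by (auto simp: carr smult add M.smult_l_distr)
  next
    fix a Y Y' assume "a \<in> carrier R" "Y \<in> carrier (quotient_module M N)" "Y' \<in> carrier (quotient_module M N)"
    then show "a \<odot>\<^bsub>quotient_module M N\<^esub> (Y \<oplus>\<^bsub>quotient_module M N\<^esub> Y') =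
        a \<odot>\<^bsub>quotient_module M N\<^esub> Y \<oplus>\<^bsub>quotient_module M N\<^esub> a \<odot>\<^bsub>quotient_module M N\<^esub> Y'"
      by (auto simp: carr smult add M.smult_r_distr)
  next
    fix a c Y assume "a \<in> carrier R" "c \<in> carrier R" "Y \<in> carrier (quotient_module M N)"
    then show "(a \<otimes>\<^bsub>R\<^esub> c) \<odot>\<^bsub>quotient_module M N\<^esub> Y =
        a \<odot>\<^bsub>quotient_module M N\<^esub> (c \<odot>\<^bsub>quotient_module M N\<^esub> Y)"
      by (auto simp: carr smult M.smult_assoc1)
  next
    fix Y assume "Y \<in> carrier (quotient_module M N)"
    then show "\<one>\<^bsub>R\<^esub> \<odot>\<^bsub>quotient_module M N\<^esub> Y = Y"
      by (auto simp: carr smult)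
  qed
qed

definition induced_map :: "('a, 'b, 'm) module_scheme \<Rightarrow> 'b set \<Rightarrow> ('c \<Rightarrow> 'b) \<Rightarrow> 'c set \<Rightarrow> 'b set" where
  "induced_map M N f Y = (\<Union>x\<in>Y. N +>\<^bsub>M\<^esub> f x)"

definition ideal_smult ::
    "('a, 'r) ring_scheme \<Rightarrow> 'a set \<Rightarrow> ('a, 'b, 'm) module_scheme \<Rightarrow> 'b set" where
  "ideal_smult R I M = \<Inter>{N. submodule N R M \<and> (\<forall>a\<in>I. \<forall>x\<in>carrier M. a \<odot>\<^bsub>M\<^esub> x \<in> N)}"

lemma submodule_ideal_smult:
  assumes "module R M" and "I \<subseteq> carrier R"
  shows "submodule (ideal_smult R I M) R M"
    and "\<And>a x. \<lbrakk>a \<in> I; x \<in> carrier M\<rbrakk> \<Longrightarrow> a \<odot>\<^bsub>M\<^esub> x \<in> ideal_smult R I M"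
    and "\<And>N. \<lbrakk>submodule N R M; \<And>a x. \<lbrakk>a \<in> I; x \<in> carrier M\<rbrakk> \<Longrightarrow> a \<odot>\<^bsub>M\<^esub> x \<in> N\<rbrakk> \<Longrightarrow>
      ideal_smult R I M \<subseteq> N"
proof -
  interpret M: module R M by fact
  have "submodule (carrier M) R M \<and> (\<forall>a\<in>I. \<forall>x\<in>carrier M. a \<odot>\<^bsub>M\<^esub> x \<in> carrier M)"
    using assms(2) M.carrier_is_submodule by auto
  then have sub: "ideal_smult R I M \<subseteq> carrier M"
    unfolding ideal_smult_def by blast
  have zero: "\<zero>\<^bsub>M\<^esub> \<in> N" if "submodule N R M" for N
    using subgroup.one_closed[OF submodule.axioms(1)[OF that]] by simp
  show "submodule (ideal_smult R I M) R M"
  proof (rule M.submoduleI[OF sub])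
    show "\<zero>\<^bsub>M\<^esub> \<in> ideal_smult R I M"
      unfolding ideal_smult_def using zero by blast
  next
    fix x assume "x \<in> ideal_smult R I M"
    then show "\<ominus>\<^bsub>M\<^esub> x \<in> ideal_smult R I M"
      unfolding ideal_smult_def using M.submoduleE(3) by blast
  next
    fix x y assume "x \<in> ideal_smult R I M" "y \<in> ideal_smult R I M"
    then show "x \<oplus>\<^bsub>M\<^esub> y \<in> ideal_smult R I M"
      unfolding ideal_smult_def using M.submoduleE(5) by blast
  next
    fix a x assume "a \<in> carrier R" "x \<in> ideal_smult R I M"
    then show "a \<odot>\<^bsub>M\<^esub> x \<in> ideal_smult R I M"
      unfolding ideal_smult_def using M.submoduleE(4) by blast
  qed
qed (auto simp: ideal_smult_def)

lemma module_ring_module: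
  assumes "cring R"
  shows "module R (ring_module R)" and "\<And>I. ideal I R \<Longrightarrow> submodule I R (ring_module R)"
proof -
  interpret R: cring R by fact
  have "abelian_group (ring_module R)"
    by (rule abelian_groupI)
       (use R.a_assoc R.a_comm R.l_neg R.a_inv_closed in \<open>auto simp: ring_module_def\<close>)
  then show mod: "module R (ring_module R)"
    by (intro moduleI) (auto simp: ring_module_def R.cring_axioms R.l_distr R.r_distr R.m_assoc)
  show "submodule I R (ring_module R)" if "ideal I R" for I
  proof -
    interpret I: ideal I R by fact
    have "\<ominus>\<^bsub>ring_module R\<^esub> x = \<ominus>\<^bsub>R\<^esub> x" for x
      by (simp add: ring_module_def a_inv_def m_inv_def)
    then show ?thesis
      by (intro module.submoduleI[OF mod])
         (auto simp: ring_module_def I.I_l_closed intro: I.a_Hcarr)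
  qed
qed

text \<open>\<open>M/IM\<close> with the pairing $(x,a+I)\mapsto ax+IM$ is the tensor product of \<open>M\<close> and \<open>R/I\<close>:
  the pairing is well defined, and every bilinear map factors uniquely through it.\<close>

lemma base_change_pairing:
  assumes "module R M" and "ideal I R" and "x \<in> carrier M"
    and a: "a \<in> carrier R" and a': "a' \<in> carrier R" and eq: "I +>\<^bsub>R\<^esub> a = I +>\<^bsub>R\<^esub> a'"
  shows "ideal_smult R I M +>\<^bsub>M\<^esub> (a \<odot>\<^bsub>M\<^esub> x) = ideal_smult R I M +>\<^bsub>M\<^esub> (a' \<odot>\<^bsub>M\<^esub> x)"
proof -
  interpret M: module R M by fact
  interpret I: ideal I R by fact
  note N = submodule_ideal_smult[OF assms(1) I.a_subset]
  interpret N: submodule "ideal_smult R I M" R M by (rule N)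
  interpret N: abelian_subgroup "ideal_smult R I M" M
    by (intro abelian_subgroupI3 additive_subgroup.intro N.subgroup_axioms M.abelian_group_axioms)
  have "a \<in> I +>\<^bsub>R\<^esub> a'"
    using I.a_rcos_self[OF a] eq by simp
  then obtain c where c: "c \<in> I" "a = c \<oplus>\<^bsub>R\<^esub> a'"
    by (auto simp: a_r_coset_def')
  then have "a \<odot>\<^bsub>M\<^esub> x = c \<odot>\<^bsub>M\<^esub> x \<oplus>\<^bsub>M\<^esub> a' \<odot>\<^bsub>M\<^esub> x"
    using assms I.a_Hcarr by (simp add: M.smult_l_distr)
  then have "a \<odot>\<^bsub>M\<^esub> x \<in> ideal_smult R I M +>\<^bsub>M\<^esub> (a' \<odot>\<^bsub>M\<^esub> x)"
    using N(2)[OF c(1) assms(3)] by (auto simp: a_r_coset_def')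
  then show ?thesis
    by (rule N.a_repr_independence'[symmetric]) (rule M.smult_closed[OF a' assms(3)])
qed

lemma base_change_universal:
  fixes R :: "('a, 'r) ring_scheme" and M :: "('a, 'b, 'm) module_scheme"
    and P :: "('a, 'c, 'p) module_scheme"
  assumes M: "module R M" and I: "ideal I R" and P: "module R P"
    and h1: "\<And>x. x \<in> carrier M \<Longrightarrow> h x \<in> mod_hom R (quotient_module (ring_module R) I) P"
    and h2: "\<And>c. c \<in> carrier (quotient_module (ring_module R) I) \<Longrightarrow> (\<lambda>x. h x c) \<in> mod_hom R M P"
  defines "T \<equiv> quotient_module M (ideal_smult R I M)"
  shows "\<exists>!\<phi>. \<phi> \<in> mod_hom R T P \<inter> extensional (carrier T) \<and>
    (\<forall>x\<in>carrier M. \<forall>a\<in>carrier R. \<phi> (ideal_smult R I M +>\<^bsub>M\<^esub> (a \<odot>\<^bsub>M\<^esub> x)) = h x (I +>\<^bsub>R\<^esub> a))"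
proof -
  interpret M: module R M by fact
  interpret P: module R P by fact
  interpret I: ideal I R by fact
  define N where "N = ideal_smult R I M"
  note Ns = submodule_ideal_smult[OF M I.a_subset, folded N_def]
  interpret N: submodule N R M by (rule Ns)
  interpret N: abelian_subgroup N M
    by (intro abelian_subgroupI3 additive_subgroup.intro N.subgroup_axioms M.abelian_group_axioms)
  note q = quotient_module_module[OF M Ns(1)]
  note RM = module_ring_module[OF M.R.cring_axioms]
  note qR = quotient_module_module[OF RM(1) RM(2)[OF I]]
  have rm: "carrier (ring_module R) = carrier R" "(\<odot>\<^bsub>ring_module R\<^esub>) = (\<otimes>\<^bsub>R\<^esub>)"
    "\<And>I a. I +>\<^bsub>ring_module R\<^esub> a = I +>\<^bsub>R\<^esub> a"
    by (auto simp: ring_module_def a_r_coset_def')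
  note qR2 = qR(2)[unfolded rm]
  have carrR: "carrier (quotient_module (ring_module R) I) = (\<lambda>x. I +>\<^bsub>R\<^esub> x) ` carrier R"
    by (auto simp: quotient_module_def A_RCOSETS_def' rm)
  have carrT: "carrier T = (\<lambda>x. N +>\<^bsub>M\<^esub> x) ` carrier M"
    by (auto simp: T_def N_def[symmetric] quotient_module_def A_RCOSETS_def')
  have addT: "(N +>\<^bsub>M\<^esub> x) \<oplus>\<^bsub>T\<^esub> (N +>\<^bsub>M\<^esub> y) = N +>\<^bsub>M\<^esub> (x \<oplus>\<^bsub>M\<^esub> y)"
    if "x \<in> carrier M" "y \<in> carrier M" for x y
    using N.a_rcos_sum[OF that] by (simp add: T_def N_def[symmetric] quotient_module_def)
  have smT: "a \<odot>\<^bsub>T\<^esub> (N +>\<^bsub>M\<^esub> x) = N +>\<^bsub>M\<^esub> (a \<odot>\<^bsub>M\<^esub> x)" if "a \<in> carrier R" "x \<in> carrier M" for a x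
    using q(2)[OF that] by (simp add: T_def N_def)
  define u where "u = I +>\<^bsub>R\<^esub> \<one>\<^bsub>R\<^esub>"
  have u: "u \<in> carrier (quotient_module (ring_module R) I)"
    by (auto simp: carrR u_def)
  define g where "g = (\<lambda>x. h x u)"
  have g: "g \<in> mod_hom R M P"
    using h2[OF u] by (simp add: g_def)
  then have g_carr: "g x \<in> carrier P" if "x \<in> carrier M" for x
    using that by (auto simp: mod_hom_def)
  have g_add: "g (x \<oplus>\<^bsub>M\<^esub> y) = g x \<oplus>\<^bsub>P\<^esub> g y" if "x \<in> carrier M" "y \<in> carrier M" for x y
    using g that by (auto simp: mod_hom_def)
  have g_sm: "g (a \<odot>\<^bsub>M\<^esub> x) = a \<odot>\<^bsub>P\<^esub> g x" if "a \<in> carrier R" "x \<in> carrier M" for a x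
    using g that by (auto simp: mod_hom_def)
  have hg: "h x (I +>\<^bsub>R\<^esub> a) = g (a \<odot>\<^bsub>M\<^esub> x)" if x: "x \<in> carrier M" and a: "a \<in> carrier R" for x a
  proof -
    have "I +>\<^bsub>R\<^esub> a = a \<odot>\<^bsub>quotient_module (ring_module R) I\<^esub> u"
      using qR2[OF a] a by (simp add: u_def)
    then have "h x (I +>\<^bsub>R\<^esub> a) = a \<odot>\<^bsub>P\<^esub> h x u"
      using h1[OF x] a u by (simp add: mod_hom_def)
    then show ?thesis
      using g_sm[OF a x] by (simp add: g_def)
  qed
  have g_zero: "g \<zero>\<^bsub>M\<^esub> = \<zero>\<^bsub>P\<^esub>"
    using g_sm[OF M.R.zero_closed M.zero_closed] g_carr[OF M.zero_closed] by simp
  define Z where "Z = {x \<in> carrier M. g x = \<zero>\<^bsub>P\<^esub>}"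
  have "submodule Z R M"
  proof (rule M.submoduleI)
    fix x assume "x \<in> Z"
    then have x: "x \<in> carrier M" "g x = \<zero>\<^bsub>P\<^esub>" by (auto simp: Z_def)
    have "\<ominus>\<^bsub>M\<^esub> x = (\<ominus>\<^bsub>R\<^esub> \<one>\<^bsub>R\<^esub>) \<odot>\<^bsub>M\<^esub> x"
      using x by (simp add: M.smult_l_minus)
    then have "g (\<ominus>\<^bsub>M\<^esub> x) = \<zero>\<^bsub>P\<^esub>"
      using x g_sm[of "\<ominus>\<^bsub>R\<^esub> \<one>\<^bsub>R\<^esub>" x] by simp
    with x show "\<ominus>\<^bsub>M\<^esub> x \<in> Z" by (simp add: Z_def)
  qed (auto simp: Z_def g_zero g_add g_sm)
  moreover have "a \<odot>\<^bsub>M\<^esub> x \<in> Z" if a: "a \<in> I" and x: "x \<in> carrier M" for a x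
  proof -
    have aR: "a \<in> carrier R" using a I.a_Hcarr by blast
    have "I +>\<^bsub>R\<^esub> a = I +>\<^bsub>R\<^esub> \<zero>\<^bsub>R\<^esub>"
      using a I.a_rcos_const I.zero_closed by metis
    then have "g (a \<odot>\<^bsub>M\<^esub> x) = g (\<zero>\<^bsub>R\<^esub> \<odot>\<^bsub>M\<^esub> x)"
      using hg[OF x aR] hg[OF x M.R.zero_closed] by simp
    then show ?thesis
      using x aR by (simp add: Z_def g_zero)
  qed
  ultimately have NZ: "N \<subseteq> Z"
    by (rule Ns(3))
  have g_cong: "g y = g x" if y: "y \<in> N +>\<^bsub>M\<^esub> x" and x: "x \<in> carrier M" for x y
  proof -
    from y obtain c where c: "c \<in> N" "y = c \<oplus>\<^bsub>M\<^esub> x"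
      by (auto simp: a_r_coset_def')
    then have "c \<in> Z" using NZ by auto
    then show ?thesis
      using c x g_carr g_add[of c x] by (auto simp: Z_def)
  qed
  define \<phi> where "\<phi> = restrict (\<lambda>C. g (SOME x. x \<in> C)) (carrier T)"
  have phi: "\<phi> (N +>\<^bsub>M\<^esub> x) = g x" if x: "x \<in> carrier M" for x
  proof -
    have "(SOME y. y \<in> N +>\<^bsub>M\<^esub> x) \<in> N +>\<^bsub>M\<^esub> x"
      by (rule someI[of _ x]) (rule N.a_rcos_self[OF x])
    then show ?thesis
      using g_cong[OF _ x] x by (simp add: \<phi>_def carrT)
  qed
  have one: "\<phi> \<in> mod_hom R T P \<inter> extensional (carrier T)"
  proof
    show "\<phi> \<in> extensional (carrier T)"
      by (simp add: \<phi>_def)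
    show "\<phi> \<in> mod_hom R T P"
      unfolding mod_hom_def carrT
      by (auto simp: addT smT phi g_add g_sm g_carr)
  qed
  show ?thesis
    unfolding N_def[symmetric]
  proof (rule ex1I[of _ \<phi>], intro conjI ballI)
    show "\<phi> (N +>\<^bsub>M\<^esub> (a \<odot>\<^bsub>M\<^esub> x)) = h x (I +>\<^bsub>R\<^esub> a)" if "x \<in> carrier M" "a \<in> carrier R" for x a
      using that by (simp add: phi hg)
  next
    fix \<psi> assume \<psi>: "\<psi> \<in> mod_hom R T P \<inter> extensional (carrier T) \<and>
      (\<forall>x\<in>carrier M. \<forall>a\<in>carrier R. \<psi> (N +>\<^bsub>M\<^esub> (a \<odot>\<^bsub>M\<^esub> x)) = h x (I +>\<^bsub>R\<^esub> a))"
    show "\<psi> = \<phi>"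
    proof (rule extensionalityI[of _ "carrier T"])
      fix C assume "C \<in> carrier T"
      then obtain x where x: "x \<in> carrier M" "C = N +>\<^bsub>M\<^esub> x"
        by (auto simp: carrT)
      have "\<psi> (N +>\<^bsub>M\<^esub> (\<one>\<^bsub>R\<^esub> \<odot>\<^bsub>M\<^esub> x)) = h x (I +>\<^bsub>R\<^esub> \<one>\<^bsub>R\<^esub>)"
        using \<psi> x M.R.one_closed by blast
      then show "\<psi> C = \<phi> C"
        using x by (simp add: phi hg)
    qed (use \<psi> one in auto)
  qed (use one in auto)
qed

definition restrict_scalars :: "('c \<Rightarrow> 'a) \<Rightarrow> ('a, 'b) module \<Rightarrow> ('c, 'b) module" where
  "restrict_scalars h M = \<lparr>carrier = carrier M, monoid.mult = monoid.mult M, one = one M,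
     ring.zero = ring.zero M, add = add M, module.smult = (\<lambda>c x. h c \<odot>\<^bsub>M\<^esub> x)\<rparr>"


section \<open>Homology\<close>

text \<open>In a complex \<open>C\<close> with differential \<open>d\<close>, \<open>d i\<close> maps \<open>C i\<close> to \<open>C (i - 1)\<close>.\<close>

definition cycles :: "(nat \<Rightarrow> ('a, 'b) module) \<Rightarrow> (nat \<Rightarrow> 'b \<Rightarrow> 'b) \<Rightarrow> nat \<Rightarrow> 'b set" where
  "cycles C d i = a_kernel (C i) (C (i - 1)) (d i)"

definition boundaries :: "(nat \<Rightarrow> ('a, 'b) module) \<Rightarrow> (nat \<Rightarrow> 'b \<Rightarrow> 'b) \<Rightarrow> nat \<Rightarrow> 'b set" where
  "boundaries C d i = d (Suc i) ` carrier (C (Suc i))"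

definition homology :: "(nat \<Rightarrow> ('a, 'b) module) \<Rightarrow> (nat \<Rightarrow> 'b \<Rightarrow> 'b) \<Rightarrow> nat \<Rightarrow> ('a, 'b set) module" where
  "homology C d i = quotient_module ((C i)\<lparr>carrier := cycles C d i\<rparr>) (boundaries C d i)"

definition homology_class ::
    "(nat \<Rightarrow> ('a, 'b) module) \<Rightarrow> (nat \<Rightarrow> 'b \<Rightarrow> 'b) \<Rightarrow> nat \<Rightarrow> 'b \<Rightarrow> 'b set" where
  "homology_class C d i z = boundaries C d i +>\<^bsub>C i\<^esub> z"


section \<open>Free resolutions\<close>

text \<open>\<open>F\<close> with differential \<open>\<delta>\<close> and augmentation \<open>\<epsilon>\<close> is a resolution of \<open>N\<close> by free
  modules of finite rank; \<open>F i\<close> has the basis \<open>e i 1, \<dots>, e i (b i)\<close>.\<close>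

definition free_resolution ::
    "('a, 'r) ring_scheme \<Rightarrow> ('a, 'c) module \<Rightarrow> (nat \<Rightarrow> ('a, 'b) module) \<Rightarrow> (nat \<Rightarrow> 'b \<Rightarrow> 'b) \<Rightarrow>
     ('b \<Rightarrow> 'c) \<Rightarrow> (nat \<Rightarrow> nat) \<Rightarrow> (nat \<Rightarrow> nat \<Rightarrow> 'b) \<Rightarrow> bool" where
  "free_resolution R N F \<delta> \<epsilon> b e \<longleftrightarrow>
     (\<forall>i. module R (F i) \<and> is_basis R (F i) {1..b i} (e i)) \<and>
     (\<forall>i. \<delta> (Suc i) \<in> mod_hom R (F (Suc i)) (F i)) \<and>
     \<epsilon> \<in> mod_hom R (F 0) N \<and>
     \<epsilon> ` carrier (F 0) = carrier N \<and>
     \<delta> 1 ` carrier (F 1) = a_kernel (F 0) N \<epsilon> \<and>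
     (\<forall>i. \<delta> (Suc (Suc i)) ` carrier (F (Suc (Suc i))) = a_kernel (F (Suc i)) (F i) (\<delta> (Suc i)))"

definition minimal_complex ::
    "(nat multiset \<Rightarrow> 'k::field) ring \<Rightarrow> nat \<Rightarrow> (nat \<Rightarrow> (nat multiset \<Rightarrow> 'k, 'b) module) \<Rightarrow>
     (nat \<Rightarrow> 'b \<Rightarrow> 'b) \<Rightarrow> bool" where
  "minimal_complex S n F \<delta> \<longleftrightarrow>
     (\<forall>i. \<delta> (Suc i) ` carrier (F (Suc i)) \<subseteq> ideal_smult S (indet_ideal S n) (F i))"

text \<open>\<open>G d\<close> is the component of degree \<open>d\<close> of a graded module \<open>M\<close> over the polynomial ring.\<close>

definition graded_module ::
    "nat \<Rightarrow> (nat multiset \<Rightarrow> 'k::field, 'b) module \<Rightarrow> (int \<Rightarrow> 'b set) \<Rightarrow> bool" where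
  "graded_module n M G \<longleftrightarrow>
     (\<forall>d. additive_subgroup (G d) M) \<and>
     (\<forall>a d. \<forall>f\<in>homogeneous_polys n a. \<forall>x\<in>G d. f \<odot>\<^bsub>M\<^esub> x \<in> G (int a + d)) \<and>
     (\<forall>x\<in>carrier M. \<exists>!c. (\<forall>d. c d \<in> G d) \<and> finite {d. c d \<noteq> \<zero>\<^bsub>M\<^esub>} \<and>
        x = (\<Oplus>\<^bsub>M\<^esub>d\<in>{d. c d \<noteq> \<zero>\<^bsub>M\<^esub>}. c d))"

text \<open>Gradings of the modules in a resolution of $S/I$ by which it is a graded resolution
  (all maps being of degree 0) and the given bases are homogeneous.\<close>

definition resolution_grading ::
    "nat \<Rightarrow> (nat multiset \<Rightarrow> 'k::field) set \<Rightarrow> (nat \<Rightarrow> (nat multiset \<Rightarrow> 'k, 'b) module) \<Rightarrow>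
     (nat \<Rightarrow> 'b \<Rightarrow> 'b) \<Rightarrow> ('b \<Rightarrow> (nat multiset \<Rightarrow> 'k) set) \<Rightarrow> (nat \<Rightarrow> nat) \<Rightarrow> (nat \<Rightarrow> nat \<Rightarrow> 'b) \<Rightarrow>
     (nat \<Rightarrow> int \<Rightarrow> 'b set) \<Rightarrow> bool" where
  "resolution_grading n I F \<delta> \<epsilon> b e G \<longleftrightarrow>
     (\<forall>i. graded_module n (F i) (G i)) \<and>
     (\<forall>i d. \<delta> (Suc i) ` G (Suc i) d \<subseteq> G i d) \<and>
     (\<forall>d. \<epsilon> ` G 0 d \<subseteq>
        (if d < 0 then {I} else (\<lambda>f. I +>\<^bsub>polynomial_ring n\<^esub> f) ` homogeneous_polys n (nat d))) \<and>
     (\<forall>i. \<forall>j\<in>{1..b i}. \<exists>d. e i j \<in> G i d)"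


section \<open>The Koszul complex\<close>

text \<open>The basis element $dx_{r_1}\cdots dx_{r_i}$ with $r_1<\dots<r_i$ is indexed by the
  set $A=\{r_1,\dots,r_i\}$, and $r_k$ is \<open>elem A k\<close>.\<close>

definition subsets_of_size :: "nat \<Rightarrow> nat \<Rightarrow> nat set set" where
  "subsets_of_size n i = {A. A \<subseteq> {1..n} \<and> card A = i}"

definition elem :: "nat set \<Rightarrow> nat \<Rightarrow> nat" where
  "elem A k = sorted_list_of_set A ! (k - 1)"

definition koszul :: "('a, 'r) ring_scheme \<Rightarrow> nat \<Rightarrow> nat \<Rightarrow> ('a, nat set \<Rightarrow> 'a) module" where
  "koszul R n i = free_module R (subsets_of_size n i)"

definition koszul_diff ::
    "('a, 'r) ring_scheme \<Rightarrow> (nat \<Rightarrow> 'a) \<Rightarrow> nat \<Rightarrow> nat \<Rightarrow> (nat set \<Rightarrow> 'a) \<Rightarrow> nat set \<Rightarrow> 'a" where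
  "koszul_diff R x n i w =
     (\<Oplus>\<^bsub>koszul R n (i - 1)\<^esub>A\<in>subsets_of_size n i. w A \<odot>\<^bsub>koszul R n (i - 1)\<^esub>
        (\<Oplus>\<^bsub>koszul R n (i - 1)\<^esub>k\<in>{1..i}. ((\<ominus>\<^bsub>R\<^esub> \<one>\<^bsub>R\<^esub>) [^]\<^bsub>R\<^esub> (k + 1) \<otimes>\<^bsub>R\<^esub> x (elem A k))
           \<odot>\<^bsub>koszul R n (i - 1)\<^esub> unit_vec R (A - {elem A k})))"

text \<open>For an $S$-module $M$, the base change $M\otimes_S S/I$ is taken in the form $M/IM$;
  see \<open>base_change_universal\<close>.\<close>

definition koszul_mod ::
    "(nat multiset \<Rightarrow> 'k::field) ring \<Rightarrow> (nat multiset \<Rightarrow> 'k) set \<Rightarrow> nat \<Rightarrow> nat \<Rightarrow>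
     (nat multiset \<Rightarrow> 'k, (nat set \<Rightarrow> nat multiset \<Rightarrow> 'k) set) module" where
  "koszul_mod S I n i = quotient_module (koszul S n i) (ideal_smult S I (koszul S n i))"

definition koszul_mod_diff ::
    "(nat multiset \<Rightarrow> 'k::field) ring \<Rightarrow> (nat multiset \<Rightarrow> 'k) set \<Rightarrow> nat \<Rightarrow> nat \<Rightarrow>
     (nat set \<Rightarrow> nat multiset \<Rightarrow> 'k) set \<Rightarrow> (nat set \<Rightarrow> nat multiset \<Rightarrow> 'k) set" where
  "koszul_mod_diff S I n i =
     induced_map (koszul S n (i - 1)) (ideal_smult S I (koszul S n (i - 1))) (koszul_diff S indet n i)"

definition koszul_mod_proj ::
    "(nat multiset \<Rightarrow> 'k::field) ring \<Rightarrow> (nat multiset \<Rightarrow> 'k) set \<Rightarrow> nat \<Rightarrow> nat \<Rightarrow>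
     (nat set \<Rightarrow> nat multiset \<Rightarrow> 'k) \<Rightarrow> (nat set \<Rightarrow> nat multiset \<Rightarrow> 'k) set" where
  "koszul_mod_proj S I n i w = ideal_smult S I (koszul S n i) +>\<^bsub>koszul S n i\<^esub> w"


section \<open>Koszul cycles of a resolution\<close>

text \<open>The tuples $(j_0,j_1,\dots,j_i)$ with $j_0=1$, $1\le j_l\le b_l$ for $0<l<i$ and $j_i=j$.\<close>

definition index_paths :: "(nat \<Rightarrow> nat) \<Rightarrow> nat \<Rightarrow> nat \<Rightarrow> (nat \<Rightarrow> nat) set" where
  "index_paths b i j =
     (\<Pi>\<^sub>E l\<in>{0..i}. if l = 0 then {1} else if l = i then {j} else {1..b l})"

text \<open>\<open>\<alpha> i k j\<close> stands for $\alpha^{(i)}_{kj}$.\<close>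

definition koszul_cycle ::
    "(nat multiset \<Rightarrow> 'k::field) ring \<Rightarrow> nat \<Rightarrow> (nat \<Rightarrow> nat) \<Rightarrow>
     (nat \<Rightarrow> nat \<Rightarrow> nat \<Rightarrow> nat multiset \<Rightarrow> 'k) \<Rightarrow> nat \<Rightarrow> nat \<Rightarrow> nat set \<Rightarrow> nat multiset \<Rightarrow> 'k" where
  "koszul_cycle S n b \<alpha> i j =
     (\<Oplus>\<^bsub>koszul S n i\<^esub>A\<in>subsets_of_size n i.
        (\<Oplus>\<^bsub>S\<^esub>J\<in>index_paths b i j. \<Otimes>\<^bsub>S\<^esub>l\<in>{1..i}. diff_quot (elem A l) (\<alpha> l (J (l - 1)) (J l)))
          \<odot>\<^bsub>koszul S n i\<^esub> unit_vec S A)"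

end

theory Submission
  imports Defs "HOL-Library.Function_Algebras"
begin

text \<open>The \<open>K\<close>-linear map $h(f\,dx_A)=\sum_{r<\min A}d^r(f)\,dx_r\,dx_A$ is a contracting homotopy of
  $\Omega$: $\partial h+h\partial$ is the identity in positive degrees, and $\partial h(f)=f-f(0)$ in
  degree 0. Starting from a basis element $e_{ij}=1\otimes e_{ij}$ of $\Omega_0\otimes F_i$ one lifts
  through the double complex $\Omega\otimes F$ by alternately applying $\delta$ and $h$. Since
  $\delta\delta=0$, the homotopy identity gives $\partial h(\delta z)=\delta z$ at each step, so this is a
  zigzag, and since $d^r(fg)=d^r(f)\,g$ when $g$ only involves $x_{r+1},\dots,x_n$, its last term
  in $\Omega_i\otimes F_0$ is $z_{ij}$. Hence $\partial z_{ij}\in I\Omega$, and a diagram chase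
  through the exact rows and columns identifies $H_i(\Omega\otimes S/I)$ with
  $F_i/\mathfrak{n}F_i$, with $[\bar z_{ij}]$ corresponding to $e_{ij}$.\<close>

section \<open>The Koszul differential and its contracting homotopy\<close>

text \<open>The formula for h comes from setting the variables to 0 one at a time: x_r d^r(f) is the
  loss in f(0,...,0,x_r,...,x_n) when x_r is set to 0 too, so these terms telescope. The price of
  this explicit homotopy is that h is only K-linear. It need not respect I\<Omega>, and on \<Omega>
  \<otimes> F it acts on coefficients with respect to the chosen bases of the F_l. Hence the chase
  is done with coordinate vectors over S, and I is met only at the end, as the image of \<delta>_1.
  In degree 0 the homotopy misses the constant terms. Minimality says that the matrices of \<delta>
  have none, and this is used twice: to start the zigzag and to finish the independence argument.
  The chase is an induction on the Koszul degree k for all l at once, since each step passes from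
  \<Omega>_k \<otimes> F_l to \<Omega>_{k-1} \<otimes> F_{l+1}; only l = 0 is wanted in the end. F_0
  is given as a free module of rank 1 mapping onto S/I, so its generator may go to any unit of
  S/I.\<close>

lemma sum_fun_apply: "sum f A x = (\<Sum>a\<in>A. f a x)"
  by (induction A rule: infinite_finite_induct) auto

text \<open>Scalars from K are kept apart from multiplication in S because \<open>koszul_h\<close>
  is linear over K only; \<open>const_mult\<close> identifies \<open>scale c\<close> with
  multiplication by a constant series.\<close>

definition scale :: "'k::field \<Rightarrow> ('m \<Rightarrow> 'k) \<Rightarrow> 'm \<Rightarrow> 'k" where
  "scale c f = (\<lambda>m. c * f m)"

lemma scale_simps [simp]:
  "scale 0 f = 0" "scale 1 f = f" "scale c 0 = 0" "scale c (scale a f) = scale (c * a) f"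
  by (auto simp: scale_def fun_eq_iff)

lemma scale_distribs:
  "scale c (f + g) = scale c f + scale c g" "scale c (f - g) = scale c f - scale c g"
  "scale (a + c) f = scale a f + scale c f" "scale (a - c) f = scale a f - scale c f"
  "scale (- c) f = - scale c f"
  by (auto simp: scale_def fun_eq_iff algebra_simps)

lemma scale_sum: "scale c (sum f A) = (\<Sum>a\<in>A. scale c (f a))"
  using sum_comp_morphism[of "scale c" f A] by (simp add: o_def scale_distribs)

text \<open>\<open>shift r f\<close> is $x_r f$.\<close>

definition shift :: "nat \<Rightarrow> (nat multiset \<Rightarrow> 'k::field) \<Rightarrow> nat multiset \<Rightarrow> 'k" where
  "shift r f = (\<lambda>m. if r \<in># m then f (m - {#r#}) else 0)"

lemma shift_simps [simp]:
  "shift r 0 = 0" "shift r (f + g) = shift r f + shift r g" "shift r (f - g) = shift r f - shift r g"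
  "shift r (scale c f) = scale c (shift r f)"
  by (auto simp: shift_def scale_def fun_eq_iff)

lemma shift_sum: "shift r (sum f A) = (\<Sum>a\<in>A. shift r (f a))"
  using sum_comp_morphism[of "shift r" f A] by (simp add: o_def )

lemma shift_commute: "shift r (shift s f) = shift s (shift r f)"
  by (auto simp: shift_def fun_eq_iff in_diff_count add_mset_commute)

text \<open>The subtracted tail never contributes, since x_r m contains x_r. So d^r only moves
  coefficients around, which makes K-linearity and the support statements immediate.\<close>

lemma diff_quot_eq: "diff_quot r f m = (if set_mset m \<subseteq> {r..} then f (add_mset r m) else 0)"
  by (auto simp: diff_quot_def tail_from_def)

lemma diff_quot_0 [simp]: "diff_quot r 0 = 0"
  by (auto simp: diff_quot_eq fun_eq_iff)

lemma diff_quot_add: "diff_quot r (f + g) = diff_quot r f + diff_quot r g"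
  by (auto simp: diff_quot_eq fun_eq_iff)

lemma diff_quot_sum: "diff_quot r (sum f A) = (\<Sum>a\<in>A. diff_quot r (f a))"
  using sum_comp_morphism[of "diff_quot r" f A] by (simp add: o_def diff_quot_add)

lemma diff_quot_scale: "diff_quot r (scale c f) = scale c (diff_quot r f)"
  by (auto simp: diff_quot_eq scale_def fun_eq_iff)

text \<open>For r < a no monomial of x_r f lies in x_a,...,x_n; for r = a the division undoes the
  multiplication on the part of f in these variables; for r > a the factor x_r passes through. With
  a = Min A these are the three cases of the homotopy identity.\<close>

lemma diff_quot_shift:
  "diff_quot a (shift r f) =
    (if r < a then 0 else if r = a then tail_from a f else shift r (diff_quot a f))"
proof
  fix m
  consider "r < a" | "r = a" | "a < r" by linarith
  then show "diff_quot a (shift r f) m =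
    (if r < a then 0 else if r = a then tail_from a f else shift r (diff_quot a f)) m"
  proof cases
    case 3
    have "set_mset (m - {#r#}) \<subseteq> {a..} \<longleftrightarrow> set_mset m \<subseteq> {a..}"
      using 3 by (auto simp: subset_iff in_diff_count split: if_splits)
         (metis in_diff_count insert_DiffM insert_noteq_member less_imp_le_nat)
    with 3 show ?thesis
      by (auto simp: diff_quot_eq shift_def)
  qed (auto simp: diff_quot_eq shift_def tail_from_def subset_iff)
qed

lemma shift_diff_quot: "shift r (diff_quot r f) = tail_from r f - tail_from (Suc r) f"
proof
  fix m
  show "shift r (diff_quot r f) m = (tail_from r f - tail_from (Suc r) f) m"
  proof (cases "r \<in># m")
    case False
    then have "set_mset m \<subseteq> {r..} \<longleftrightarrow> set_mset m \<subseteq> {Suc r..}"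
      by (auto simp: subset_iff Suc_le_eq order.strict_iff_order)
    with False show ?thesis
      by (simp add: tail_from_def shift_def)
  qed (simp add: diff_quot_def shift_def)
qed

text \<open>Telescoping: x_r d^r(f) is the difference of two successive truncations of f.\<close>

lemma sum_shift_diff_quot:
  assumes "1 \<le> a"
  shows "(\<Sum>r\<in>{1..<a}. shift r (diff_quot r f)) = tail_from 1 f - tail_from a f"
  using assms by (induction a rule: dec_induct) (auto simp: shift_diff_quot)

text \<open>The sign of dx_B in \<partial>(dx_A) for A = B \<union> {r}: if r is the k-th element of
  A, then k - 1 elements of B lie below it, and (-1)^{k+1} = (-1)^{k-1}.\<close>

definition koszul_sign :: "nat \<Rightarrow> nat set \<Rightarrow> 'k::field" where
  "koszul_sign r B = (- 1) ^ card {s\<in>B. s < r}"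

lemma koszul_sign_insert:
  assumes "finite B" "s \<notin> B"
  shows "(koszul_sign r (insert s B) :: 'k::field) = (if s < r then - koszul_sign r B else koszul_sign r B)"
proof -
  have "{t\<in>insert s B. t < r} = (if s < r then insert s {t\<in>B. t < r} else {t\<in>B. t < r})"
    by auto
  with assms show ?thesis
    by (auto simp: koszul_sign_def)
qed

lemma koszul_sign_below: "(\<And>s. s \<in> B \<Longrightarrow> r \<le> s) \<Longrightarrow> koszul_sign r B = 1"
proof -
  assume "\<And>s. s \<in> B \<Longrightarrow> r \<le> s"
  then have "{s\<in>B. s < r} = {}" by force
  then show ?thesis by (simp only: koszul_sign_def card.empty power_0)
qed

text \<open>\<partial> read by coefficients: dx_B receives one term from every A = B \<union> {r}.
  The formula does not mention the degree, so one operator serves all degrees;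
  \<open>koszul_diff_eq\<close> matches it with the defining formula on basis elements.\<close>

definition koszul_d :: "nat \<Rightarrow> (nat set \<Rightarrow> nat multiset \<Rightarrow> 'k::field) \<Rightarrow> nat set \<Rightarrow> nat multiset \<Rightarrow> 'k" where
  "koszul_d n u B = (\<Sum>r\<in>{1..n} - B. scale (koszul_sign r B) (shift r (u (insert r B))))"

text \<open>\<open>koszul_h\<close> is the \<open>K\<close>-linear map $f\,dx_A\mapsto\sum_{r<\min A}d^r(f)\,dx_r\,dx_A$, written
  coefficientwise; at the empty set \<open>Min\<close> is unspecified and the value irrelevant.\<close>

definition koszul_h :: "(nat set \<Rightarrow> nat multiset \<Rightarrow> 'k::field) \<Rightarrow> nat set \<Rightarrow> nat multiset \<Rightarrow> 'k" where
  "koszul_h u A = diff_quot (Min A) (u (A - {Min A}))"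

lemma koszul_d_0 [simp]: "koszul_d n 0 B = 0"
  by (simp add: koszul_d_def)

lemma koszul_d_add: "koszul_d n (\<lambda>A. u A + v A) B = koszul_d n u B + koszul_d n v B"
  by (simp add: koszul_d_def scale_distribs sum.distrib)

lemma koszul_d_diff: "koszul_d n (\<lambda>A. u A - v A) B = koszul_d n u B - koszul_d n v B"
  by (simp add: koszul_d_def scale_distribs sum_subtractf)

lemma koszul_d_scale: "koszul_d n (\<lambda>A. scale c (u A)) B = scale c (koszul_d n u B)"
  by (simp add: koszul_d_def scale_sum mult.commute)

lemma koszul_d_sum: "koszul_d n (\<lambda>A. \<Sum>j\<in>J. u j A) B = (\<Sum>j\<in>J. koszul_d n (u j) B)"
  by (simp add: koszul_d_def shift_sum scale_sum sum.swap[of _ J])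

lemma insert_subsets_of_size:
  "B \<in> subsets_of_size n k \<Longrightarrow> r \<in> {1..n} - B \<Longrightarrow> insert r B \<in> subsets_of_size n (Suc k)"
  by (auto simp: subsets_of_size_def card_insert_if finite_subset[of _ "{1..n}"])

lemma koszul_d_cong:
  assumes "B \<in> subsets_of_size n k" "\<And>A. A \<in> subsets_of_size n (Suc k) \<Longrightarrow> u A = v A"
  shows "koszul_d n u B = koszul_d n v B"
  unfolding koszul_d_def using assms insert_subsets_of_size by (intro sum.cong) auto

text \<open>The terms of $\partial\partial$ with $r<s$ cancel those with $s<r$.\<close>

lemma koszul_d_koszul_d:
  assumes "finite B"
  shows "koszul_d n (koszul_d n u) B = 0"
proof -
  \<comment> \<open>Both signs are taken relative to B, which makes t symmetric. The sign of s that
    really occurs is relative to \<open>insert r B\<close> and differs exactly when r < s.\<close>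
  define t where "t r s = scale (koszul_sign r B * koszul_sign s B)
    (shift r (shift s (u (insert r (insert s B)))))" for r s
  let ?X = "{1..n} - B"
  have t_sym: "t s r = t r s" for r s
    by (simp add: t_def mult.commute shift_commute insert_commute)
  have *: "scale (koszul_sign r B) (shift r (koszul_d n u (insert r B))) =
    (\<Sum>s\<in>?X. if s < r then t r s else 0) - (\<Sum>s\<in>?X. if r < s then t r s else 0)" if r: "r \<in> ?X" for r
  proof -
    have "scale (koszul_sign r B) (shift r (koszul_d n u (insert r B))) =
      (\<Sum>s\<in>?X - {r}. if s < r then t r s else - t r s)"
      unfolding koszul_d_def shift_sum scale_sum
      using assms r by (intro sum.cong)
        (auto simp: koszul_sign_insert t_def insert_commute scale_distribs)
    also have "\<dots> = (\<Sum>s\<in>?X - {r}. (if s < r then t r s else 0) - (if r < s then t r s else 0))"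
      by (intro sum.cong) auto
    also have "\<dots> = (\<Sum>s\<in>?X. (if s < r then t r s else 0) - (if r < s then t r s else 0))"
      by (intro sum.mono_neutral_left) auto
    finally show ?thesis by (simp add: sum_subtractf)
  qed
  have "koszul_d n (koszul_d n u) B =
    (\<Sum>r\<in>?X. \<Sum>s\<in>?X. if s < r then t r s else 0) - (\<Sum>r\<in>?X. \<Sum>s\<in>?X. if r < s then t r s else 0)"
    by (subst koszul_d_def) (simp add: * sum_subtractf)
  also have "(\<Sum>r\<in>?X. \<Sum>s\<in>?X. if s < r then t r s else 0) = (\<Sum>s\<in>?X. \<Sum>r\<in>?X. if s < r then t s r else 0)"
    by (subst sum.swap) (simp add: t_sym cong: if_cong)
  finally show ?thesis by (simp only: diff_self)
qed

lemma tail_from_1: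
  assumes "\<And>m. f m \<noteq> 0 \<Longrightarrow> set_mset m \<subseteq> {1..n}"
  shows "tail_from 1 f = f"
  using assms by (fastforce simp: tail_from_def fun_eq_iff)

text \<open>The sum telescopes over all variables and stops at f(0,...,0): in degree 0 the homotopy
  contracts \<Omega> only up to H_0(\<Omega>) = K.\<close>

lemma homotopy_empty:
  assumes "\<And>m. u {} m \<noteq> 0 \<Longrightarrow> set_mset m \<subseteq> {1..n}"
  shows "koszul_d n (koszul_h u) {} = u {} - const (u {} {#})"
proof -
  have "koszul_d n (koszul_h u) {} = (\<Sum>r\<in>{1..<Suc n}. shift r (diff_quot r (u {})))"
    by (simp add: koszul_d_def koszul_h_def koszul_sign_def atLeastLessThanSuc_atLeastAtMost)
  also have "\<dots> = tail_from 1 (u {}) - tail_from (Suc n) (u {})"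
    by (rule sum_shift_diff_quot) simp
  also have "tail_from 1 (u {}) = u {}"
    by (rule tail_from_1) (rule assms)
  \<comment> \<open>The only monomial of the series that avoids x_1,...,x_n is 1.\<close>
  also have "tail_from (Suc n) (u {}) = const (u {} {#})"
  proof
    fix m
    show "tail_from (Suc n) (u {}) m = const (u {} {#}) m"
    proof (cases "m = {#}")
      case False
      then obtain r where "r \<in># m" by (meson multiset_nonemptyE)
      then have "set_mset m \<subseteq> {Suc n..} \<Longrightarrow> \<not> set_mset m \<subseteq> {1..n}"
        by (metis atLeastAtMost_iff atLeast_iff not_less_eq_eq subset_iff)
      then have "set_mset m \<subseteq> {Suc n..} \<Longrightarrow> u {} m = 0" using assms by blast
      with False show ?thesis by (auto simp: tail_from_def const_def)
    qed (simp add: tail_from_def const_def)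
  qed
  finally show ?thesis .
qed

text \<open>With a = Min A, split the r outside A. For r < a the new minimum is r, the sign is 1,
  and the terms telescope to u A minus its part in x_a,...,x_n. For r > a the minimum stays a, and
  h\<partial> contains the same terms with opposite sign, because removing a changes the number of
  elements below r by one. The term r = a of h\<partial> restores the missing part of u A.\<close>

lemma homotopy:
  assumes A: "A \<subseteq> {1..n}" "A \<noteq> {}" and supp: "\<And>m. u A m \<noteq> 0 \<Longrightarrow> set_mset m \<subseteq> {1..n}"
  shows "koszul_d n (koszul_h u) A + koszul_h (koszul_d n u) A = u A"
proof -
  define a where "a = Min A"
  define A' where "A' = A - {a}"
  have fin: "finite A" using A finite_subset by blast
  have a1: "a \<in> A"
    using A fin Min_in[of A] by (simp add: a_def)
  then have a2: "1 \<le> a" "a \<le> n"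
    using A(1) by auto
  have "\<And>s. s \<in> A \<Longrightarrow> a \<le> s"
    using fin by (simp add: a_def)
  note a = a1 a2 this
  have AA': "A = insert a A'" "a \<notin> A'" "finite A'" using a fin by (auto simp: A'_def)
  define t :: "nat \<Rightarrow> nat multiset \<Rightarrow> 'a"
    where "t r = scale (koszul_sign r A) (shift r (diff_quot a (u (insert r A'))))" for r
  let ?H = "{1..n} - A - {1..<a}"
  have split: "{1..n} - A = {1..<a} \<union> ?H" "{1..<a} \<inter> ?H = {}"
    using a(2,3) leD[OF a(4)]
    by (auto simp del: not_le not_less)
  have "koszul_d n (koszul_h u) A =
      (\<Sum>r\<in>{1..<a}. scale (koszul_sign r A) (shift r (koszul_h u (insert r A)))) +
      (\<Sum>r\<in>?H. scale (koszul_sign r A) (shift r (koszul_h u (insert r A))))"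
    unfolding koszul_d_def by (subst split(1), subst sum.union_disjoint) (use split in auto)
  also have "(\<Sum>r\<in>{1..<a}. scale (koszul_sign r A) (shift r (koszul_h u (insert r A)))) =
      (\<Sum>r\<in>{1..<a}. shift r (diff_quot r (u A)))"
  proof (rule sum.cong[OF refl])
    fix r assume r: "r \<in> {1..<a}"
    have "r \<notin> A"
      using r leD[OF a(4)] by auto
    moreover have "Min (insert r A) = r"
      using r fin A(2) by (simp add: Min_insert a_def[symmetric])
    moreover have "koszul_sign r A = (1 :: 'a)"
      using r a(4) by (intro koszul_sign_below) (meson atLeastLessThan_iff le_trans less_imp_le)
    ultimately show "scale (koszul_sign r A) (shift r (koszul_h u (insert r A))) = shift r (diff_quot r (u A))"
      by (simp add: koszul_h_def)
  qed
  also have "\<dots> = u A - tail_from a (u A)"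
    by (subst sum_shift_diff_quot) (use a tail_from_1 supp in auto)
  also have "(\<Sum>r\<in>?H. scale (koszul_sign r A) (shift r (koszul_h u (insert r A)))) = (\<Sum>r\<in>?H. t r)"
  proof (rule sum.cong[OF refl])
    fix r assume r: "r \<in> ?H"
    then have "a < r" using a(1) by (cases "r = a") auto
    then have "Min (insert r A) = a"
      using fin A(2) by (simp add: Min_insert a_def[symmetric])
    moreover have "insert r A - {a} = insert r A'"
      using \<open>a < r\<close> by (auto simp: A'_def)
    ultimately show "scale (koszul_sign r A) (shift r (koszul_h u (insert r A))) = t r"
      by (simp add: koszul_h_def t_def)
  qed
  finally have 1: "koszul_d n (koszul_h u) A = u A - tail_from a (u A) + (\<Sum>r\<in>?H. t r)" .
  have "koszul_h (koszul_d n u) A = diff_quot a (koszul_d n u A')"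
    by (simp add: koszul_h_def a_def A'_def)
  also have "\<dots> = (\<Sum>r\<in>{1..n} - A'. scale (koszul_sign r A') (diff_quot a (shift r (u (insert r A')))))"
    by (simp add: koszul_d_def diff_quot_sum diff_quot_scale)
  \<comment> \<open>The indices r < a drop out because d^a(x_r f) = 0.\<close>
  also have "\<dots> = (\<Sum>r\<in>insert a ?H. scale (koszul_sign r A') (diff_quot a (shift r (u (insert r A')))))"
    by (rule sum.mono_neutral_right) (use AA' a in \<open>auto simp: diff_quot_shift\<close>)
  also have "\<dots> = scale (koszul_sign a A') (tail_from a (u A)) +
      (\<Sum>r\<in>?H. scale (koszul_sign r A') (diff_quot a (shift r (u (insert r A')))))"
    by (subst sum.insert) (use AA' in \<open>auto simp: diff_quot_shift\<close>)
  also have "koszul_sign a A' = (1 :: 'a)"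
    by (rule koszul_sign_below) (use a in \<open>auto simp: A'_def\<close>)
  also have "(\<Sum>r\<in>?H. scale (koszul_sign r A') (diff_quot a (shift r (u (insert r A'))))) = (\<Sum>r\<in>?H. - t r)"
  proof (rule sum.cong[OF refl])
    fix r assume r: "r \<in> ?H"
    then have "a < r" using a(1) by (cases "r = a") auto
    then have "koszul_sign r A = - (koszul_sign r A' :: 'a)"
      unfolding AA'(1) using AA' by (simp add: koszul_sign_insert)
    with \<open>a < r\<close> show "scale (koszul_sign r A') (diff_quot a (shift r (u (insert r A')))) = - t r"
      by (simp add: t_def diff_quot_shift scale_distribs)
  qed
  finally have 2: "koszul_h (koszul_d n u) A = tail_from a (u A) - (\<Sum>r\<in>?H. t r)"
    by (simp only: sum_negf scale_simps add_uminus_conv_diff)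
  show ?thesis by (simp only: 1 2) simp
qed

section \<open>Arithmetic of power series and polynomials\<close>

lemma finite_sub_multisets: "finite {p. p \<subseteq># m}"
  by (rule finite_subset[of _ "\<Union>k\<le>size m. multisets_of_size (set_mset m) k"])
    (auto simp: multisets_of_size_def dest: mset_subset_eqD size_mset_mono
      intro!: finite_multisets_of_size[unfolded multisets_of_size_def])

text \<open>Passes from sums over a ring or module record to type-class sums, for which
  \<open>Function_Algebras\<close> supplies the pointwise group structure. For an infinite index set
  both sides are 0 by convention.\<close>

lemma finsum_eq_sum:
  fixes G :: "('a::comm_monoid_add, 'm) ring_scheme"
  assumes "abelian_monoid G" "add G = (+)" "\<zero>\<^bsub>G\<^esub> = 0" "f \<in> A \<rightarrow> carrier G"
  shows "finsum G f A = sum f A"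
proof -
  interpret abelian_monoid G by fact
  show ?thesis
    using assms(4)
  proof (induction A rule: infinite_finite_induct)
    case (infinite A)
    then show ?case
      using assms(3) by (simp add: finsum_def finprod_def)
  qed (simp_all add: assms(2,3))
qed

text \<open>Both rings have the same operations and differ only in the carrier, so they are treated
  together. The operations do not look at the carrier, which is why many identities below hold for
  arbitrary functions.\<close>

locale series_ring = cring S
  for S :: "(nat multiset \<Rightarrow> 'k::field) ring" (structure) and n :: nat +
  assumes S_cases: "S = power_series_ring n \<or> S = polynomial_ring n"
begin

lemma add_eq: "add S = (+)"
  using S_cases by (auto simp: power_series_ring_def polynomial_ring_def fun_eq_iff)

lemma zero_eq: "\<zero> = 0"
  using S_cases by (auto simp: power_series_ring_def polynomial_ring_def fun_eq_iff)

lemma one_eq: "\<one> = const 1"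
  using S_cases by (auto simp: power_series_ring_def polynomial_ring_def const_def)

lemma mult_eq: "f \<otimes> g = (\<lambda>m. \<Sum>p | p \<subseteq># m. f p * g (m - p))"
  using S_cases by (auto simp: power_series_ring_def polynomial_ring_def)

lemma carrier_supp: "f \<in> carrier S \<Longrightarrow> f m \<noteq> 0 \<Longrightarrow> set_mset m \<subseteq> {1..n}"
  using S_cases by (elim disjE) (simp_all add: power_series_ring_def polynomial_ring_def)

lemma carrierI:
  assumes "\<And>m. f m \<noteq> 0 \<Longrightarrow> set_mset m \<subseteq> {1..n}" "finite {m. f m \<noteq> 0}"
  shows "f \<in> carrier S"
  using S_cases assms by (elim disjE) (simp_all add: power_series_ring_def polynomial_ring_def)

text \<open>One closure argument for both rings: an injective reindexing h carries the support of g
  into that of f, so finiteness is inherited in the polynomial case. It covers scalar multiples,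
  multiplication by x_r, and d^r.\<close>

lemma carrier_reindex:
  assumes f: "f \<in> carrier S" and "inj_on h {m. g m \<noteq> 0}"
    and "\<And>m. g m \<noteq> 0 \<Longrightarrow> f (h m) \<noteq> 0" "\<And>m. g m \<noteq> 0 \<Longrightarrow> set_mset m \<subseteq> {1..n}"
  shows "g \<in> carrier S"
proof -
  have "finite {m. g m \<noteq> 0}" if "finite {m. f m \<noteq> 0}"
    using assms(3) by (intro inj_on_finite[OF assms(2) _ that]) auto
  then show ?thesis
    using S_cases f assms(4) by (elim disjE) (simp_all add: power_series_ring_def polynomial_ring_def)
qed

lemma zero_closed' [simp]: "0 \<in> carrier S"
  using zero_closed by (simp add: zero_eq)

lemma add_closed [simp]: "f \<in> carrier S \<Longrightarrow> g \<in> carrier S \<Longrightarrow> f + g \<in> carrier S"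
  using a_closed[of f g] by (simp add: add_eq)



lemma sum_closed: "(\<And>a. a \<in> A \<Longrightarrow> f a \<in> carrier S) \<Longrightarrow> sum f A \<in> carrier S"
proof (induction A rule: infinite_finite_induct)
  case (insert x F)
  then show ?case
    using add_closed[of "f x" "sum f F"] by (simp only: sum.insert insert_iff simp_thms)
qed simp_all

lemma scale_closed [simp]: "f \<in> carrier S \<Longrightarrow> scale c f \<in> carrier S"
  by (rule carrier_reindex[of f id]) (simp_all add: scale_def carrier_supp[simplified])

lemma uminus_closed [simp]: "f \<in> carrier S \<Longrightarrow> - f \<in> carrier S"
  using scale_closed[of f "- 1"] by (simp add: scale_distribs)

lemma diff_closed [simp]: "f \<in> carrier S \<Longrightarrow> g \<in> carrier S \<Longrightarrow> f - g \<in> carrier S"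
  using add_closed[of f "- g"] by (simp del: add_closed)

lemma a_inv_eq: "f \<in> carrier S \<Longrightarrow> \<ominus> f = - f"
  using minus_equality[of "- f" f] by (simp add: add_eq zero_eq)

lemma shift_closed [simp]: "f \<in> carrier S \<Longrightarrow> r \<in> {1..n} \<Longrightarrow> shift r f \<in> carrier S"
proof (rule carrier_reindex[of f "\<lambda>m. m - {#r#}"])
  show "inj_on (\<lambda>m. m - {#r#}) {m. shift r f m \<noteq> 0}"
    by (auto simp: inj_on_def shift_def split: if_splits) (metis insert_DiffM)
  show "set_mset m \<subseteq> {1..n}" if f: "f \<in> carrier S" "r \<in> {1..n}" and "shift r f m \<noteq> 0" for m
  proof -
    from that have "r \<in># m" "set_mset (m - {#r#}) \<subseteq> {1..n}"
      by (simp_all add: shift_def carrier_supp[simplified] split: if_splits)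
    then have "set_mset (add_mset r (m - {#r#})) \<subseteq> {1..n}"
      using f(2) unfolding set_mset_add_mset_insert by blast
    then show ?thesis unfolding insert_DiffM[OF \<open>r \<in># m\<close>] by simp
  qed
qed (auto simp: shift_def split: if_splits)

lemma diff_quot_closed [simp]: "f \<in> carrier S \<Longrightarrow> diff_quot r f \<in> carrier S"
  by (rule carrier_reindex[of f "add_mset r"])
    (auto simp: diff_quot_eq inj_on_def split: if_splits dest!: carrier_supp[of f "add_mset r _"])

lemma const_closed [simp]: "const c \<in> carrier S"
  by (rule carrierI) (auto simp: const_def split: if_splits)

lemma indet_closed [simp]: "r \<in> {1..n} \<Longrightarrow> indet r \<in> carrier S"
  by (rule carrierI) (auto simp: indet_def split: if_splits)

lemma finsum_eq: "f \<in> A \<rightarrow> carrier S \<Longrightarrow> finsum S f A = sum f A"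
  by (rule finsum_eq_sum) (simp_all add: add_eq zero_eq abelian_monoid_axioms)

lemma const_mult: "const c \<otimes> f = scale c f"
proof
  fix m
  have "(const c \<otimes> f) m = (\<Sum>p | p \<subseteq># m. if p = {#} then c * f m else 0)"
    unfolding mult_eq by (rule sum.cong) (auto simp: const_def)
  also have "\<dots> = c * f m"
    by (subst sum.delta[OF finite_sub_multisets]) simp
  finally show "(const c \<otimes> f) m = scale c f m"
    by (simp add: scale_def)
qed

lemma indet_mult: "indet r \<otimes> f = shift r f"
proof
  fix m
  have "(indet r \<otimes> f) m = (\<Sum>p | p \<subseteq># m. if p = {#r#} then f (m - {#r#}) else 0)"
    unfolding mult_eq by (rule sum.cong) (auto simp: indet_def)
  also have "\<dots> = shift r f m"
    by (subst sum.delta[OF finite_sub_multisets]) (simp add: shift_def)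
  finally show "(indet r \<otimes> f) m = shift r f m" .
qed

lemma mult_simps [simp]:
  "f \<otimes> 0 = 0" "0 \<otimes> f = 0" "f \<otimes> scale c g = scale c (f \<otimes> g)"
  by (auto simp: mult_eq fun_eq_iff scale_def sum_distrib_left mult.left_commute)

lemma mult_add_right: "f \<otimes> (g + h) = f \<otimes> g + f \<otimes> h"
  by (auto simp: mult_eq fun_eq_iff sum.distrib algebra_simps)

lemma mult_diff_right: "f \<otimes> (g - h) = f \<otimes> g - f \<otimes> h"
  by (auto simp: mult_eq fun_eq_iff sum_subtractf algebra_simps)

lemma mult_sum_right: "f \<otimes> sum g A = (\<Sum>a\<in>A. f \<otimes> g a)"
  using sum_comp_morphism[of "(\<otimes>) f" g A] by (simp add: o_def mult_add_right)

lemma mult_shift_right: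
  assumes "f \<in> carrier S" "g \<in> carrier S" "r \<in> {1..n}"
  shows "f \<otimes> shift r g = shift r (f \<otimes> g)"
  using assms m_lcomm[of f "indet r" g] by (simp add: indet_mult)

lemma mult_empty: "(f \<otimes> g) {#} = f {#} * g {#}"
  by (simp add: mult_eq)

text \<open>No monomial of g contains x_r, so in a monomial x_r m of the product the factor x_r must
  come from f. Variables below r do not occur in g either, so the truncation also concerns f
  alone.\<close>

lemma diff_quot_mult:
  assumes g: "\<And>m. g m \<noteq> 0 \<Longrightarrow> set_mset m \<subseteq> {r<..}"
  shows "diff_quot r (f \<otimes> g) = diff_quot r f \<otimes> g"
proof
  fix m :: "nat multiset"
  show "diff_quot r (f \<otimes> g) m = (diff_quot r f \<otimes> g) m"
  proof (cases "set_mset m \<subseteq> {r..}")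
    case False
    have "diff_quot r f p * g (m - p) = 0" if "p \<subseteq># m" for p
    proof (rule ccontr)
      assume "diff_quot r f p * g (m - p) \<noteq> 0"
      then have "set_mset p \<subseteq> {r..}" "set_mset (m - p) \<subseteq> {r<..}"
        using g by (auto simp: diff_quot_eq split: if_splits)
      then have "set_mset (p + (m - p)) \<subseteq> {r..}" by auto
      with False that show False by simp
    qed
    then have "(diff_quot r f \<otimes> g) m = 0"
      unfolding mult_eq by (intro sum.neutral) simp
    with False show ?thesis by (simp add: diff_quot_eq)
  next
    case True
    have "diff_quot r (f \<otimes> g) m = (\<Sum>p | p \<subseteq># add_mset r m. f p * g (add_mset r m - p))"
      using True by (simp add: diff_quot_eq mult_eq)
    \<comment> \<open>Only divisors p containing x_r matter: otherwise x_r is left in the cofactor,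
      where g has coefficient 0.\<close>
    also have "\<dots> = (\<Sum>p\<in>add_mset r ` {p. p \<subseteq># m}. f p * g (add_mset r m - p))"
    proof (rule sum.mono_neutral_right)
      show "\<forall>p\<in>{p. p \<subseteq># add_mset r m} - add_mset r ` {p. p \<subseteq># m}. f p * g (add_mset r m - p) = 0"
      proof
        fix p assume p: "p \<in> {p. p \<subseteq># add_mset r m} - add_mset r ` {p. p \<subseteq># m}"
        have "r \<notin># p"
        proof
          assume "r \<in># p"
          then obtain q where "p = add_mset r q" by (metis insert_DiffM)
          with p show False by auto
        qed
        then have "r \<in># add_mset r m - p"
          by (simp add: in_diff_count not_in_iff)
        then show "f p * g (add_mset r m - p) = 0" using g by force
      qed
    qed (auto simp: finite_sub_multisets)
    also have "\<dots> = (\<Sum>p | p \<subseteq># m. f (add_mset r p) * g (m - p))"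
      by (subst sum.reindex) (auto simp: inj_on_def)
    also have "\<dots> = (\<Sum>p | p \<subseteq># m. diff_quot r f p * g (m - p))"
    proof (rule sum.cong[OF refl])
      fix p assume "p \<in> {p. p \<subseteq># m}"
      then have "set_mset p \<subseteq> {r..}" using True by (auto dest: mset_subset_eqD)
      then show "f (add_mset r p) * g (m - p) = diff_quot r f p * g (m - p)"
        by (simp add: diff_quot_eq)
    qed
    finally show ?thesis by (simp add: mult_eq)
  qed
qed

lemma koszul_d_closed: "(\<And>A. u A \<in> carrier S) \<Longrightarrow> koszul_d n u B \<in> carrier S"
  unfolding koszul_d_def by (intro sum_closed) auto

lemma koszul_h_closed: "(\<And>A. u A \<in> carrier S) \<Longrightarrow> koszul_h u A \<in> carrier S"
  by (simp add: koszul_h_def)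

lemma koszul_d_mult:
  assumes "f \<in> carrier S" "\<And>A. u A \<in> carrier S"
  shows "koszul_d n (\<lambda>A. f \<otimes> u A) B = f \<otimes> koszul_d n u B"
  unfolding koszul_d_def mult_sum_right
  by (intro sum.cong) (use assms in \<open>auto simp: mult_shift_right\<close>)

lemma homotopy_empty_carrier:
  assumes "\<And>A. u A \<in> carrier S"
  shows "u {} = const (u {} {#}) + koszul_d n (koszul_h u) {}"
  using homotopy_empty[of u n] carrier_supp[OF assms] by simp

lemma homotopy_carrier:
  assumes "\<And>A. u A \<in> carrier S" "A \<in> subsets_of_size n (Suc k)"
  shows "u A = koszul_d n (koszul_h u) A + koszul_h (koszul_d n u) A"
proof (rule homotopy[symmetric])
  show "A \<subseteq> {1..n}" "A \<noteq> {}"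
    using assms(2) by (auto simp: subsets_of_size_def)
qed (rule carrier_supp[OF assms(1)])

text \<open>Every term of a boundary is divisible by some x_r. Together with minimality this removes
  all constant terms at the end of the independence proof.\<close>

lemma koszul_d_empty: "koszul_d n u {} {#} = 0"
  by (simp add: koszul_d_def sum_fun_apply scale_def shift_def)

end

section \<open>Chasing cycles through a minimal resolution\<close>

text \<open>\<open>\<alpha> l\<close> is the matrix of the differential from degree \<open>l\<close> to degree \<open>l - 1\<close>. A function
  \<open>w :: nat set \<Rightarrow> nat \<Rightarrow> nat multiset \<Rightarrow> 'k\<close> stands for the element
  $\sum_{A,m} w_{A,m}\,dx_A\otimes e_{l,m}$ of $\Omega_k\otimes F_l$; only its values at \<open>A\<close> of
  size \<open>k\<close> and \<open>m\<close> in \<open>{1..b l}\<close> matter.\<close>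

locale minimal_resolution = series_ring S n
  for S :: "(nat multiset \<Rightarrow> 'k::field) ring" (structure) and n :: nat +
  fixes b :: "nat \<Rightarrow> nat" and \<alpha> :: "nat \<Rightarrow> nat \<Rightarrow> nat \<Rightarrow> nat multiset \<Rightarrow> 'k"
  assumes \<alpha>_closed: "\<And>l m p. \<lbrakk>m \<in> {1..b l}; p \<in> {1..b (Suc l)}\<rbrakk> \<Longrightarrow> \<alpha> (Suc l) m p \<in> carrier S"
    and \<alpha>_minimal: "\<And>l m p. \<lbrakk>m \<in> {1..b l}; p \<in> {1..b (Suc l)}\<rbrakk> \<Longrightarrow> \<alpha> (Suc l) m p {#} = 0"
    and complex: "\<And>l m v. \<lbrakk>m \<in> {1..b l}; \<And>q. v q \<in> carrier S\<rbrakk> \<Longrightarrow>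
      (\<Sum>p\<in>{1..b (Suc l)}. \<alpha> (Suc l) m p \<otimes> (\<Sum>q\<in>{1..b (Suc (Suc l))}. \<alpha> (Suc (Suc l)) p q \<otimes> v q)) = 0"
    and exact: "\<And>l v. \<lbrakk>\<And>p. v p \<in> carrier S;
        \<And>m. m \<in> {1..b l} \<Longrightarrow> (\<Sum>p\<in>{1..b (Suc l)}. \<alpha> (Suc l) m p \<otimes> v p) = 0\<rbrakk> \<Longrightarrow>
      \<exists>w. (\<forall>q. w q \<in> carrier S) \<and> (\<forall>p\<in>{1..b (Suc l)}. v p =
        (\<Sum>q\<in>{1..b (Suc (Suc l))}. \<alpha> (Suc (Suc l)) p q \<otimes> w q))"
begin

definition diff_mat :: "nat \<Rightarrow> (nat \<Rightarrow> nat multiset \<Rightarrow> 'k) \<Rightarrow> nat \<Rightarrow> nat multiset \<Rightarrow> 'k" where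
  "diff_mat l v m = (\<Sum>p\<in>{1..b l}. \<alpha> l m p \<otimes> v p)"

lemma diff_mat_cong: "(\<And>p. p \<in> {1..b l} \<Longrightarrow> v p = w p) \<Longrightarrow> diff_mat l v m = diff_mat l w m"
  unfolding diff_mat_def by (rule sum.cong) auto

lemma diff_mat_closed:
  "m \<in> {1..b l} \<Longrightarrow> (\<And>p. v p \<in> carrier S) \<Longrightarrow> diff_mat (Suc l) v m \<in> carrier S"
  unfolding diff_mat_def by (intro sum_closed m_closed \<alpha>_closed) auto

lemma diff_mat_add: "diff_mat l (\<lambda>p. v p + w p) m = diff_mat l v m + diff_mat l w m"
  by (simp add: diff_mat_def mult_add_right sum.distrib)

lemma diff_mat_diff: "diff_mat l (\<lambda>p. v p - w p) m = diff_mat l v m - diff_mat l w m"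
  by (simp add: diff_mat_def mult_diff_right sum_subtractf)

lemma diff_mat_0: "diff_mat l (\<lambda>p. 0) m = 0"
  by (simp add: diff_mat_def)

lemma diff_mat_lincomb:
  "diff_mat l (\<lambda>p. \<Sum>j\<in>J. scale (c j) (v j p)) m = (\<Sum>j\<in>J. scale (c j) (diff_mat l (v j) m))"
  by (simp add: diff_mat_def mult_sum_right scale_sum sum.swap[of _ J])

lemma diff_mat_diff_mat:
  "m \<in> {1..b l} \<Longrightarrow> (\<And>q. v q \<in> carrier S) \<Longrightarrow> diff_mat (Suc l) (diff_mat (Suc (Suc l)) v) m = 0"
  using complex by (simp add: diff_mat_def)

lemma diff_mat_exact:
  assumes "\<And>p. v p \<in> carrier S" "\<And>m. m \<in> {1..b l} \<Longrightarrow> diff_mat (Suc l) v m = 0"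
  obtains w where "\<And>q. w q \<in> carrier S" "\<And>p. p \<in> {1..b (Suc l)} \<Longrightarrow> v p = diff_mat (Suc (Suc l)) w p"
  using exact[of v l] assms unfolding diff_mat_def by blast

text \<open>This makes \<Omega> \<otimes> F a double complex: \<partial> is S-linear, hence commutes
  with the matrices of \<delta>. The homotopy h need not.\<close>

lemma koszul_d_diff_mat:
  assumes "m \<in> {1..b l}" "\<And>A p. w A p \<in> carrier S"
  shows "koszul_d n (\<lambda>A. diff_mat (Suc l) (w A) m) B = diff_mat (Suc l) (\<lambda>p. koszul_d n (\<lambda>A. w A p) B) m"
  unfolding diff_mat_def koszul_d_sum
  by (intro sum.cong refl koszul_d_mult \<alpha>_closed) (use assms in auto)

text \<open>\<open>lifted_cycle k l j\<close> is the component in $\Omega_k\otimes F_l$ of the zigzag that starts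
  at the basis element $e_{l+k,j}$.\<close>

fun lifted_cycle :: "nat \<Rightarrow> nat \<Rightarrow> nat \<Rightarrow> nat set \<Rightarrow> nat \<Rightarrow> nat multiset \<Rightarrow> 'k" where
  "lifted_cycle 0 l j A m = (if m = j then const 1 else 0)"
| "lifted_cycle (Suc k) l j A m = (if m \<in> {1..b l}
     then koszul_h (\<lambda>B. diff_mat (Suc l) (lifted_cycle k (Suc l) j B) m) A else 0)"

text \<open>No restriction on A and m is needed: outside \<open>{1..b l}\<close>, where nothing is
  assumed about \<alpha>, the recursion returns 0. Later statements can therefore quantify over all
  values.\<close>

lemma lifted_cycle_closed: "lifted_cycle k l j A m \<in> carrier S"
proof (induction k arbitrary: l A m)
  case (Suc k)
  then show ?case by (auto intro!: koszul_h_closed diff_mat_closed)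
qed auto

section \<open>The zigzag in the double complex\<close>

lemma koszul_h_0: "u (A - {Min A}) = 0 \<Longrightarrow> koszul_h u A = 0"
  by (simp add: koszul_h_def)

lemma subsets_of_size_0: "subsets_of_size n 0 = {{}}"
  by (auto simp: subsets_of_size_def dest: finite_subset)

lemma subsets_of_size_Min:
  "A \<in> subsets_of_size n (Suc k) \<Longrightarrow> A - {Min A} \<in> subsets_of_size n k"
proof -
  assume A: "A \<in> subsets_of_size n (Suc k)"
  then have "finite A" "A \<noteq> {}"
    by (auto simp: subsets_of_size_def dest: finite_subset)
  then show ?thesis
    using A Min_in[of A] by (auto simp: subsets_of_size_def)
qed

text \<open>The error term h\<partial>(\<delta>z) vanishes because \<partial>\<delta>z =
  \<delta>\<partial>z, the induction hypothesis turns \<partial>z into \<delta> of the preceding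
  component, and \<delta>\<delta> = 0. At the start, z = 1 \<otimes> e_j, the error is instead the
  constant term of a matrix entry, which is 0 by minimality.\<close>

lemma koszul_d_lifted_cycle:
  assumes "A \<in> subsets_of_size n k" "m \<in> {1..b l}" "j \<in> {1..b (l + Suc k)}"
  shows "koszul_d n (\<lambda>A. lifted_cycle (Suc k) l j A m) A =
    diff_mat (Suc l) (lifted_cycle k (Suc l) j A) m"
  using assms
proof (induction k arbitrary: l m A)
  case 0
  let ?u = "\<lambda>B. diff_mat (Suc l) (lifted_cycle 0 (Suc l) j B) m"
  \<comment> \<open>Applied to the unit vector e_j, the matrix of \<delta> selects its column
    j.\<close>
  have u: "?u B = \<alpha> (Suc l) m j" for B
  proof -
    have "?u B = (\<Sum>p\<in>{1..b (Suc l)}. if p = j then \<alpha> (Suc l) m j else 0)"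
      unfolding diff_mat_def
      by (intro sum.cong refl) (use 0 \<alpha>_closed in \<open>auto simp: one_eq[symmetric] simp del: One_nat_def\<close>)
    then show ?thesis using 0(3) by simp
  qed
  have "A = {}" using 0(1) by (simp add: subsets_of_size_0)
  moreover have "const (\<alpha> (Suc l) m j {#}) = 0"
    using \<alpha>_minimal 0 by (auto simp: const_def fun_eq_iff)
  moreover have "koszul_d n (\<lambda>A. lifted_cycle (Suc 0) l j A m) A = koszul_d n (koszul_h ?u) A"
    using 0(2) by (intro arg_cong2[where f="koszul_d n"]) auto
  ultimately show ?case
    using homotopy_empty_carrier[of ?u] u \<alpha>_closed 0 by (simp del: lifted_cycle.simps)
next
  case (Suc k)
  let ?u = "\<lambda>B. diff_mat (Suc l) (lifted_cycle (Suc k) (Suc l) j B) m"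
  have u: "?u B \<in> carrier S" for B
    by (intro diff_mat_closed Suc.prems lifted_cycle_closed)
  have "koszul_d n ?u (A - {Min A}) =
      diff_mat (Suc l) (\<lambda>p. koszul_d n (\<lambda>B. lifted_cycle (Suc k) (Suc l) j B p) (A - {Min A})) m"
    by (intro koszul_d_diff_mat Suc.prems lifted_cycle_closed)
  also have "\<dots> = diff_mat (Suc l) (\<lambda>p. diff_mat (Suc (Suc l)) (lifted_cycle k (Suc (Suc l)) j (A - {Min A})) p) m"
    by (rule diff_mat_cong, rule Suc.IH) (use Suc.prems subsets_of_size_Min in auto)
  also have "\<dots> = 0"
    by (intro diff_mat_diff_mat Suc.prems lifted_cycle_closed)
  finally have "koszul_h (koszul_d n ?u) A = 0"
    by (rule koszul_h_0)
  moreover have "koszul_d n (\<lambda>A. lifted_cycle (Suc (Suc k)) l j A m) A = koszul_d n (koszul_h ?u) A"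
    using Suc.prems by (intro arg_cong2[where f="koszul_d n"]) auto
  ultimately show ?case
    using homotopy_carrier[of ?u, OF u Suc.prems(1)] by (simp del: lifted_cycle.simps)
qed

section \<open>The diagram chase: spanning and independence in the double complex\<close>

lemma koszul_d_exact:
  assumes "\<And>A. u A \<in> carrier S" "\<And>B. B \<in> subsets_of_size n k \<Longrightarrow> koszul_d n u B = 0"
    and "A \<in> subsets_of_size n (Suc k)"
  shows "u A = koszul_d n (koszul_h u) A"
  using homotopy_carrier[of u, OF assms(1,3)] koszul_h_0[of "koszul_d n u" A, OF assms(2)[OF subsets_of_size_Min[OF assms(3)]]]
  by simp

text \<open>If $\partial w=\alpha w'$, then $\alpha\,\partial w'=\partial\partial w=0$, so the induction hypothesis
  expresses \<open>w'\<close> by cycles of lower degree; lifting these back changes \<open>w\<close> into a Koszul cycle,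
  hence a Koszul boundary.\<close>

lemma lifted_cycle_spanning:
  assumes "\<And>A m. w A m \<in> carrier S"
    and "\<And>i B. k = Suc i \<Longrightarrow> B \<in> subsets_of_size n i \<Longrightarrow> \<exists>v. (\<forall>p. v p \<in> carrier S) \<and>
      (\<forall>m\<in>{1..b l}. koszul_d n (\<lambda>A. w A m) B = diff_mat (Suc l) v m)"
  shows "\<exists>c u v. (\<forall>A m. u A m \<in> carrier S) \<and> (\<forall>A p. v A p \<in> carrier S) \<and>
    (\<forall>A\<in>subsets_of_size n k. \<forall>m\<in>{1..b l}. w A m =
      (\<Sum>j\<in>{1..b (l + k)}. scale (c j) (lifted_cycle k l j A m)) +
      koszul_d n (\<lambda>A. u A m) A + diff_mat (Suc l) (v A) m)"
  using assms
proof (induction k arbitrary: l w)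
  case 0
  \<comment> \<open>The coefficients are the constant terms of w, its class in H_0(\<Omega>); the
    homotopy writes the rest as a boundary.\<close>
  define c where "c m = w {} m {#}" for m
  define u where "u A m = koszul_h (\<lambda>B. w B m) A" for A m
  have "w {} m = (\<Sum>j\<in>{1..b l}. scale (c j) (lifted_cycle 0 l j {} m)) +
      koszul_d n (\<lambda>A. u A m) {} + diff_mat (Suc l) (\<lambda>p. 0) m" if m: "m \<in> {1..b l}" for m
  proof -
    have "(\<Sum>j\<in>{1..b l}. scale (c j) (lifted_cycle 0 l j {} m)) =
        (\<Sum>j\<in>{1..b l}. if j = m then const (c m) else 0)"
      by (intro sum.cong) (auto simp: scale_def const_def)
    also have "\<dots> = const (c m)"
      using m by simp
    finally show ?thesis
      using homotopy_empty_carrier[of "\<lambda>B. w B m"] 0(1) by (simp add: c_def u_def diff_mat_0)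
  qed
  note eq = this
  have u: "u A m \<in> carrier S" for A m
    unfolding u_def by (intro koszul_h_closed 0)
  show ?case
    unfolding subsets_of_size_0
  proof (rule exI[of _ c], rule exI[of _ u], rule exI[of _ "\<lambda>A p. 0"], intro conjI ballI allI)
    show "u A m \<in> carrier S" for A m
      by (rule u)
    show "0 \<in> carrier S" by simp
    fix A :: "nat set" and m assume "A \<in> {{}}" "m \<in> {1..b l}"
    then show "w A m = (\<Sum>j\<in>{1..b (l + 0)}. scale (c j) (lifted_cycle 0 l j A m)) +
        koszul_d n (\<lambda>A. u A m) A + diff_mat (Suc l) (\<lambda>p. 0) m"
      using eq[of m] by (simp only: singleton_iff add_0_right)
  qed
next
  case (Suc k)
  \<comment> \<open>The choice function must also have values at sets B of the wrong size; 0 serves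
    there.\<close>
  have "\<forall>B. \<exists>v. (\<forall>p. v p \<in> carrier S) \<and> (B \<in> subsets_of_size n k \<longrightarrow>
      (\<forall>m\<in>{1..b l}. koszul_d n (\<lambda>A. w A m) B = diff_mat (Suc l) v m))"
    (is "\<forall>B. ?P B")
  proof
    fix B
    show "?P B"
    proof (cases "B \<in> subsets_of_size n k")
      case True
      then show ?thesis using Suc.prems(2)[OF refl] by blast
    next
      case False
      then show ?thesis using zero_closed' by (intro exI[of _ "\<lambda>p. 0"]) simp
    qed
  qed
  then obtain w' where w': "\<And>B p. w' B p \<in> carrier S"
    "\<And>B m. B \<in> subsets_of_size n k \<Longrightarrow> m \<in> {1..b l} \<Longrightarrow>
      koszul_d n (\<lambda>A. w A m) B = diff_mat (Suc l) (w' B) m"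
    by metis
  \<comment> \<open>\<delta>(\<partial>w') = \<partial>\<partial>w = 0, so exactness of the
    resolution makes \<partial>w' a \<delta>-image. This is the hypothesis of the induction for w',
    one Koszul degree lower.\<close>
  have IH: "\<exists>v. (\<forall>p. v p \<in> carrier S) \<and>
      (\<forall>m\<in>{1..b (Suc l)}. koszul_d n (\<lambda>A. w' A m) D = diff_mat (Suc (Suc l)) v m)"
    if k: "k = Suc i" and D: "D \<in> subsets_of_size n i" for i D
  proof -
    have "diff_mat (Suc l) (\<lambda>p. koszul_d n (\<lambda>A. w' A p) D) m = 0" if m: "m \<in> {1..b l}" for m
    proof -
      have "diff_mat (Suc l) (\<lambda>p. koszul_d n (\<lambda>A. w' A p) D) m =
          koszul_d n (\<lambda>A. diff_mat (Suc l) (w' A) m) D"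
        by (rule koszul_d_diff_mat[symmetric]) (use m w' in auto)
      also have "\<dots> = koszul_d n (koszul_d n (\<lambda>A. w A m)) D"
        by (rule koszul_d_cong[OF D]) (use w' m k in auto)
      also have "\<dots> = 0"
        using D by (intro koszul_d_koszul_d) (auto simp: subsets_of_size_def dest: finite_subset)
      finally show ?thesis .
    qed
    then show ?thesis
      by (elim diff_mat_exact[rotated]) (use w' in \<open>auto intro!: koszul_d_closed\<close>)
  qed
  have "\<exists>c u v. (\<forall>A m. u A m \<in> carrier S) \<and> (\<forall>A p. v A p \<in> carrier S) \<and>
    (\<forall>A\<in>subsets_of_size n k. \<forall>m\<in>{1..b (Suc l)}. w' A m =
      (\<Sum>j\<in>{1..b (Suc l + k)}. scale (c j) (lifted_cycle k (Suc l) j A m)) +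
      koszul_d n (\<lambda>A. u A m) A + diff_mat (Suc (Suc l)) (v A) m)"
    by (rule Suc.IH[OF w'(1) IH])
  then obtain c u v where
    u: "\<And>A m. u A m \<in> carrier S" and v: "\<And>A p. v A p \<in> carrier S" and
    w'_eq: "\<And>B p. B \<in> subsets_of_size n k \<Longrightarrow> p \<in> {1..b (Suc l)} \<Longrightarrow> w' B p =
      (\<Sum>j\<in>{1..b (Suc l + k)}. scale (c j) (lifted_cycle k (Suc l) j B p)) +
      koszul_d n (\<lambda>A. u A p) B + diff_mat (Suc (Suc l)) (v B) p"
    by (elim exE conjE) (rule that, auto simp only:)
  let ?J = "{1..b (l + Suc k)}"
  \<comment> \<open>The decomposition of w' is lifted back: its cycles become those of the next
    Koszul degree, its part \<partial>u becomes \<delta>u, and its part \<delta>v dies under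
    \<delta>. What is left of w is a Koszul cycle y. The condition on m only keeps the values in
    S.\<close>
  define y where "y A m = w A m - (\<Sum>j\<in>?J. scale (c j) (lifted_cycle (Suc k) l j A m)) -
    (if m \<in> {1..b l} then diff_mat (Suc l) (u A) m else 0)" for A m
  have y: "y A m \<in> carrier S" for A m
    unfolding y_def using Suc.prems(1) lifted_cycle_closed u
    by (auto intro!: diff_closed sum_closed diff_mat_closed simp del: lifted_cycle.simps)
  have "koszul_d n (\<lambda>A. y A m) B = 0" if B: "B \<in> subsets_of_size n k" and m: "m \<in> {1..b l}" for B m
  proof -
    have "koszul_d n (\<lambda>A. y A m) B = koszul_d n (\<lambda>A. w A m) B -
        (\<Sum>j\<in>?J. scale (c j) (koszul_d n (\<lambda>A. lifted_cycle (Suc k) l j A m) B)) -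
        koszul_d n (\<lambda>A. diff_mat (Suc l) (u A) m) B"
      using m by (simp add: y_def koszul_d_diff koszul_d_sum koszul_d_scale del: lifted_cycle.simps)
    also have "koszul_d n (\<lambda>A. w A m) B = diff_mat (Suc l) (w' B) m"
      using w' B m by blast
    also have "\<dots> = diff_mat (Suc l) (\<lambda>p.
      (\<Sum>j\<in>?J. scale (c j) (lifted_cycle k (Suc l) j B p)) +
      koszul_d n (\<lambda>A. u A p) B + diff_mat (Suc (Suc l)) (v B) p) m"
      by (rule diff_mat_cong) (use w'_eq B in simp)
    also have "\<dots> = (\<Sum>j\<in>?J. scale (c j) (diff_mat (Suc l) (lifted_cycle k (Suc l) j B) m)) +
      diff_mat (Suc l) (\<lambda>p. koszul_d n (\<lambda>A. u A p) B) m"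
      by (simp only: diff_mat_add diff_mat_lincomb diff_mat_diff_mat[OF m v] add_0_right)
    also have "(\<Sum>j\<in>?J. scale (c j) (koszul_d n (\<lambda>A. lifted_cycle (Suc k) l j A m) B)) =
        (\<Sum>j\<in>?J. scale (c j) (diff_mat (Suc l) (lifted_cycle k (Suc l) j B) m))"
      by (intro sum.cong refl arg_cong[where f="scale _"] koszul_d_lifted_cycle) (use B m in auto)
    also have "koszul_d n (\<lambda>A. diff_mat (Suc l) (u A) m) B =
        diff_mat (Suc l) (\<lambda>p. koszul_d n (\<lambda>A. u A p) B) m"
      by (rule koszul_d_diff_mat) (use m u in auto)
    finally show ?thesis by (simp only: add_diff_cancel_left' diff_self)
  qed
  then have y_eq: "y A m = koszul_d n (koszul_h (\<lambda>A. y A m)) A"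
    if "A \<in> subsets_of_size n (Suc k)" "m \<in> {1..b l}" for A m
    using that y by (intro koszul_d_exact) auto
  have "w A m = (\<Sum>j\<in>?J. scale (c j) (lifted_cycle (Suc k) l j A m)) +
      koszul_d n (koszul_h (\<lambda>A. y A m)) A + diff_mat (Suc l) (u A) m"
    if "A \<in> subsets_of_size n (Suc k)" "m \<in> {1..b l}" for A m
    unfolding y_eq[OF that, symmetric] using that by (simp add: y_def del: lifted_cycle.simps)
  note eq = this
  show ?case
  proof (rule exI[of _ c], rule exI[of _ "\<lambda>A m. koszul_h (\<lambda>A. y A m) A"], rule exI[of _ u],
      intro conjI ballI allI)
    show "koszul_h (\<lambda>A. y A m) A \<in> carrier S" "u A m \<in> carrier S" for A m
      by (intro koszul_h_closed y) (rule u)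
  qed (rule eq)
qed

text \<open>Applying $\partial$ and exactness of \<open>\<alpha>\<close> reduces \<open>k\<close>; for $k=0$ the right-hand side has
  vanishing constant term by minimality.\<close>

lemma lifted_cycle_independent:
  assumes "\<And>A m. u A m \<in> carrier S" "\<And>A p. v A p \<in> carrier S"
    and "\<And>A m. A \<in> subsets_of_size n k \<Longrightarrow> m \<in> {1..b l} \<Longrightarrow>
      (\<Sum>j\<in>{1..b (l + k)}. scale (c j) (lifted_cycle k l j A m)) =
      koszul_d n (\<lambda>A. u A m) A + diff_mat (Suc l) (v A) m"
    and "j \<in> {1..b (l + k)}"
  shows "c j = 0"
  using assms
proof (induction k arbitrary: l u v)
  case 0
  have j: "j \<in> {1..b l}" using 0(4) by simp
  have "c j = (\<Sum>i\<in>{1..b l}. if i = j then c j else 0)"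
    using j by simp
  also have "\<dots> = (\<Sum>i\<in>{1..b (l + 0)}. scale (c i) (lifted_cycle 0 l i {} j)) {#}"
    unfolding sum_fun_apply by (intro sum.cong) (auto simp: scale_def const_def)
  also have "\<dots> = (koszul_d n (\<lambda>A. u A j) {} + diff_mat (Suc l) (v {}) j) {#}"
    by (subst 0(3)) (use j in \<open>auto simp: subsets_of_size_0\<close>)
  also have "\<dots> = 0"
    using j \<alpha>_minimal by (simp add: koszul_d_empty diff_mat_def sum_fun_apply mult_empty)
  finally show ?case .
next
  case (Suc k)
  let ?J = "{1..b (l + Suc k)}"
  \<comment> \<open>Applying \<partial> to the given relation and using the zigzag relation yields
    \<delta>y = 0.\<close>
  define y where "y B p = (\<Sum>j\<in>?J. scale (c j) (lifted_cycle k (Suc l) j B p)) -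
    koszul_d n (\<lambda>A. v A p) B" for B p
  have y: "y B p \<in> carrier S" for B p
    unfolding y_def using Suc.prems(2) lifted_cycle_closed
    by (auto intro!: diff_closed sum_closed koszul_d_closed)
  have 1: "diff_mat (Suc l) (y B) m = 0" if B: "B \<in> subsets_of_size n k" and m: "m \<in> {1..b l}" for B m
  proof -
    have "(\<Sum>j\<in>?J. scale (c j) (diff_mat (Suc l) (lifted_cycle k (Suc l) j B) m)) =
        (\<Sum>j\<in>?J. scale (c j) (koszul_d n (\<lambda>A. lifted_cycle (Suc k) l j A m) B))"
      by (intro sum.cong refl arg_cong[where f="scale _"] koszul_d_lifted_cycle[symmetric]) (use B m in auto)
    also have "\<dots> = koszul_d n (\<lambda>A. \<Sum>j\<in>?J. scale (c j) (lifted_cycle (Suc k) l j A m)) B"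
      by (simp add: koszul_d_sum koszul_d_scale del: lifted_cycle.simps)
    also have "\<dots> = koszul_d n (\<lambda>A. koszul_d n (\<lambda>A. u A m) A + diff_mat (Suc l) (v A) m) B"
      by (rule koszul_d_cong[OF B]) (use Suc.prems(3) m in blast)
    also have "\<dots> = koszul_d n (koszul_d n (\<lambda>A. u A m)) B + koszul_d n (\<lambda>A. diff_mat (Suc l) (v A) m) B"
      by (rule koszul_d_add)
    also have "koszul_d n (koszul_d n (\<lambda>A. u A m)) B = 0"
      using B by (intro koszul_d_koszul_d) (auto simp: subsets_of_size_def dest: finite_subset)
    also have "koszul_d n (\<lambda>A. diff_mat (Suc l) (v A) m) B =
        diff_mat (Suc l) (\<lambda>p. koszul_d n (\<lambda>A. v A p) B) m"
      by (rule koszul_d_diff_mat) (use m Suc.prems(2) in auto)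
    finally show ?thesis
      by (simp add: y_def[abs_def] diff_mat_diff diff_mat_lincomb)
  qed
  have "\<forall>B. \<exists>v'. (\<forall>q. v' q \<in> carrier S) \<and> (B \<in> subsets_of_size n k \<longrightarrow>
      (\<forall>p\<in>{1..b (Suc l)}. y B p = diff_mat (Suc (Suc l)) v' p))"
    (is "\<forall>B. ?P B")
  proof
    fix B
    show "?P B"
    proof (cases "B \<in> subsets_of_size n k")
      case True
      with 1 obtain v' where "\<And>q. v' q \<in> carrier S"
        "\<And>p. p \<in> {1..b (Suc l)} \<Longrightarrow> y B p = diff_mat (Suc (Suc l)) v' p"
        using diff_mat_exact[of "y B" l] y by blast
      then show ?thesis by blast
    next
      case False
      then show ?thesis using zero_closed' by (intro exI[of _ "\<lambda>p. 0"]) simp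
    qed
  qed
  then obtain v' where v': "\<And>B q. v' B q \<in> carrier S"
    "\<And>B p. B \<in> subsets_of_size n k \<Longrightarrow> p \<in> {1..b (Suc l)} \<Longrightarrow> y B p = diff_mat (Suc (Suc l)) (v' B) p"
    by metis
  show ?case
  \<comment> \<open>The old \<delta>-part v becomes the \<partial>-part one Koszul degree lower;
    exactness has supplied the new \<delta>-part v'.\<close>
  proof (rule Suc.IH[of v v' "Suc l"])
    show "(\<Sum>j\<in>{1..b (Suc l + k)}. scale (c j) (lifted_cycle k (Suc l) j A m)) =
        koszul_d n (\<lambda>A. v A m) A + diff_mat (Suc (Suc l)) (v' A) m"
      if "A \<in> subsets_of_size n k" "m \<in> {1..b (Suc l)}" for A m
      using v'(2)[OF that, symmetric] by (simp add: y_def)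
  qed (use Suc.prems v' in auto)
qed

end

section \<open>Ordered enumeration of index sets\<close>

lemma elem_less:
  assumes "1 \<le> s" "s < t" "t \<le> card A"
  shows "elem A s < elem A t"
  unfolding elem_def using assms
  by (intro sorted_wrt_nth_less[OF strict_sorted_list_of_set]) auto

lemma elem_bij_betw:
  assumes "finite A"
  shows "bij_betw (elem A) {1..card A} A"
proof -
  have "bij_betw (\<lambda>k. k - 1) {1..card A} {..<card A}"
    by (rule bij_betw_byWitness[of _ Suc]) auto
  moreover have "bij_betw ((!) (sorted_list_of_set A)) {..<card A} A"
    by (rule bij_betw_nth) (use assms in auto)
  ultimately show ?thesis
    using bij_betw_trans by (fastforce simp: elem_def[abs_def] o_def)
qed

lemma elem_in: "finite A \<Longrightarrow> t \<in> {1..card A} \<Longrightarrow> elem A t \<in> A"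
  using elem_bij_betw bij_betwE by blast

text \<open>Deleting the minimum, as \<open>koszul_h\<close> does, turns A without its l smallest
  elements into A without its l + 1 smallest. The recursion of \<open>lifted_cycle\<close> therefore
  runs through these final segments of A.\<close>

lemma elem_image_split:
  assumes "finite A" "l < card A"
  shows "Min (elem A ` {l<..card A}) = elem A (Suc l)"
    and "elem A ` {l<..card A} - {elem A (Suc l)} = elem A ` {Suc l<..card A}"
    and "\<And>x. x \<in> elem A ` {Suc l<..card A} \<Longrightarrow> elem A (Suc l) < x"
    and "card (elem A ` {l<..card A}) = card A - l"
proof -
  show less: "elem A (Suc l) < x" if "x \<in> elem A ` {Suc l<..card A}" for x
    using that elem_less[of "Suc l"] by auto
  have ins: "{l<..card A} = insert (Suc l) {Suc l<..card A}"
    using assms by auto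
  show "Min (elem A ` {l<..card A}) = elem A (Suc l)"
    unfolding ins by (rule Min_eqI) (use less less_imp_le in fastforce)+
  show "elem A ` {l<..card A} - {elem A (Suc l)} = elem A ` {Suc l<..card A}"
    unfolding ins using less order.irrefl by fastforce
  have "inj_on (elem A) {l<..card A}"
    by (rule inj_on_subset[OF bij_betw_imp_inj_on[OF elem_bij_betw]]) (use assms in auto)
  then show "card (elem A ` {l<..card A}) = card A - l"
    by (simp add: card_image)
qed

text \<open>Translates the position k of the factor dx_{r_k} into the count used by
  \<open>koszul_sign\<close>.\<close>

lemma card_below_elem:
  assumes "finite A" "k \<in> {1..card A}"
  shows "card {s\<in>A. s < elem A k} = k - 1"
proof -
  have "{s\<in>A. s < elem A k} = elem A ` {1..<k}"
  proof
    show "elem A ` {1..<k} \<subseteq> {s\<in>A. s < elem A k}"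
      using assms elem_less[of _ k A] elem_in[of A] by auto
    show "{s\<in>A. s < elem A k} \<subseteq> elem A ` {1..<k}"
    proof
      fix s assume s: "s \<in> {s\<in>A. s < elem A k}"
      then obtain t where t: "t \<in> {1..card A}" "s = elem A t"
        using bij_betw_imp_surj_on[OF elem_bij_betw[OF assms(1)]] by blast
      have "t < k"
      proof (rule ccontr)
        assume "\<not> t < k"
        then have "t = k \<or> elem A k < elem A t"
          using elem_less[of k t A] t(1) assms(2) by fastforce
        then show False using s t by auto
      qed
      then show "s \<in> elem A ` {1..<k}" using t by auto
    qed
  qed
  moreover have "inj_on (elem A) {1..<k}"
    by (rule inj_on_subset[OF bij_betw_imp_inj_on[OF elem_bij_betw]]) (use assms in auto)
  ultimately show ?thesis by (simp add: card_image)
qed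

section \<open>The Koszul cycles of a resolution\<close>

context minimal_resolution
begin

text \<open>For nonempty A the outermost step of the recursion is d^{Min A}, whose values involve
  only variables from x_{Min A} on; for empty A the entry is constant. This is the support condition
  of \<open>diff_quot_mult\<close> for the next step of the recursion.\<close>

lemma lifted_cycle_supp:
  assumes "finite A" "card A = k" "\<And>x. x \<in> A \<Longrightarrow> r < x" "lifted_cycle k l j A m q \<noteq> 0"
  shows "set_mset q \<subseteq> {r<..}"
proof (cases k)
  case 0
  with assms show ?thesis by (auto simp: const_def split: if_splits)
next
  case (Suc k')
  then have "A \<noteq> {}" using assms by auto
  then have "r < Min A" using assms by auto
  moreover have "set_mset q \<subseteq> {Min A..}"
    using assms(4) Suc by (auto simp: koszul_h_def diff_quot_eq split: if_splits)
  ultimately show ?thesis by auto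
qed

text \<open>The part of the coefficient of dx_A in z_{ij} that belongs to the positions after l,
  with j_l = m prescribed. Tuples live on the positions after l only; the update
  \<open>g(l := m)\<close> supplies the starting index to the first factor.\<close>

definition path_sum :: "nat set \<Rightarrow> nat \<Rightarrow> nat \<Rightarrow> nat \<Rightarrow> nat multiset \<Rightarrow> 'k" where
  "path_sum A j l m = (\<Sum>g\<in>(\<Pi>\<^sub>E t\<in>{l<..card A}. if t = card A then {j} else {1..b t}).
    \<Otimes>\<^bsub>S\<^esub>t\<in>{l<..card A}. diff_quot (elem A t) (\<alpha> t ((g(l := m)) (t - 1)) ((g(l := m)) t)))"

lemma \<alpha>_closed': "1 \<le> t \<Longrightarrow> x \<in> {1..b (t - 1)} \<Longrightarrow> y \<in> {1..b t} \<Longrightarrow> \<alpha> t x y \<in> carrier S"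
  using \<alpha>_closed[of x "t - 1" y] by (cases t) auto

text \<open>Splits off the index j_{l+1} = p, which is shared by the first factor and the remaining
  product; at the last position it is forced to be j.\<close>

lemma path_sum_Suc:
  assumes l: "l < card A" and j: "j \<in> {1..b (card A)}" and m: "m \<in> {1..b l}"
  shows "path_sum A j l m = (\<Sum>p\<in>(if Suc l = card A then {j} else {1..b (Suc l)}).
    diff_quot (elem A (Suc l)) (\<alpha> (Suc l) m p) \<otimes> path_sum A j (Suc l) p)"
proof -
  let ?T = "\<lambda>t. if t = card A then {j} else {1..b t}"
  let ?X = "{Suc l<..card A}"
  define h where "h g t = diff_quot (elem A t) (\<alpha> t ((g(l := m)) (t - 1)) ((g(l := m)) t))" for g t
  have ins: "{l<..card A} = insert (Suc l) ?X"
    using l by auto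
  have inj: "inj_on (\<lambda>(y, g). g(Suc l := y)) (?T (Suc l) \<times> Pi\<^sub>E ?X ?T)"
    by (rule inj_combinator) simp
  have T: "?T t \<subseteq> {1..b t}" for t
    using j by auto
  have 1: "path_sum A j l m = (\<Sum>g\<in>(\<lambda>(y, g). g(Suc l := y)) ` (?T (Suc l) \<times> Pi\<^sub>E ?X ?T). \<Otimes>\<^bsub>S\<^esub>t\<in>{l<..card A}. h g t)"
    unfolding path_sum_def h_def[abs_def] by (subst ins, subst PiE_insert_eq) simp
  have 2: "(\<Sum>g\<in>(\<lambda>(y, g). g(Suc l := y)) ` (?T (Suc l) \<times> Pi\<^sub>E ?X ?T). \<Otimes>\<^bsub>S\<^esub>t\<in>{l<..card A}. h g t) =
      (\<Sum>(p, g)\<in>?T (Suc l) \<times> Pi\<^sub>E ?X ?T. \<Otimes>\<^bsub>S\<^esub>t\<in>{l<..card A}. h (g(Suc l := p)) t)"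
    by (subst sum.reindex[OF inj]) (simp add: case_prod_unfold)
  have 3: "(\<Sum>(p, g)\<in>?T (Suc l) \<times> Pi\<^sub>E ?X ?T. \<Otimes>\<^bsub>S\<^esub>t\<in>{l<..card A}. h (g(Suc l := p)) t) =
      (\<Sum>p\<in>?T (Suc l). \<Sum>g\<in>Pi\<^sub>E ?X ?T. \<Otimes>\<^bsub>S\<^esub>t\<in>{l<..card A}. h (g(Suc l := p)) t)"
    by (rule sum.cartesian_product[symmetric])
  have 4: "(\<Sum>p\<in>?T (Suc l). \<Sum>g\<in>Pi\<^sub>E ?X ?T. \<Otimes>\<^bsub>S\<^esub>t\<in>{l<..card A}. h (g(Suc l := p)) t) = (\<Sum>p\<in>?T (Suc l). \<Sum>g\<in>Pi\<^sub>E ?X ?T. diff_quot (elem A (Suc l)) (\<alpha> (Suc l) m p) \<otimes>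
      (\<Otimes>\<^bsub>S\<^esub>t\<in>?X. diff_quot (elem A t) (\<alpha> t ((g(Suc l := p)) (t - 1)) ((g(Suc l := p)) t))))"
  proof (rule sum.cong[OF refl], rule sum.cong[OF refl])
    fix p g assume p: "p \<in> ?T (Suc l)" and g: "g \<in> Pi\<^sub>E ?X ?T"
    \<comment> \<open>For t > l + 1 both t and t - 1 exceed l, so these factors do not see the
      starting index m.\<close>
    have h: "h (g(Suc l := p)) t = diff_quot (elem A t) (\<alpha> t ((g(Suc l := p)) (t - 1)) ((g(Suc l := p)) t))"
      if t: "t \<in> ?X" for t
    proof -
      obtain s where "t = Suc s" "l < s" using t by (cases t) auto
      then show ?thesis by (simp add: h_def)
    qed
    have gT: "(g(Suc l := p)) t \<in> {1..b t}" if "t \<in> {l<..card A}" for t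
    proof (cases "t = Suc l")
      case True
      then show ?thesis using p T[of "Suc l"] by auto
    next
      case False
      then have "t \<in> ?X" using that by auto
      then have "g t \<in> ?T t" using g by (rule PiE_mem[rotated])
      then show ?thesis using T[of t] False by auto
    qed
    have hX: "diff_quot (elem A t) (\<alpha> t ((g(Suc l := p)) (t - 1)) ((g(Suc l := p)) t)) \<in> carrier S" if t: "t \<in> ?X" for t
    proof -
      have t': "t - 1 \<in> {l<..card A}" "t \<in> {l<..card A}" "t \<noteq> Suc l" "1 \<le> t"
        using t by auto
      then show ?thesis
        using gT[OF t'(1)] gT[OF t'(2)] t'(4) by (intro diff_quot_closed \<alpha>_closed')
    qed
    have h0: "h (g(Suc l := p)) (Suc l) = diff_quot (elem A (Suc l)) (\<alpha> (Suc l) m p)"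
      by (simp add: h_def)
    have "(\<Otimes>\<^bsub>S\<^esub>t\<in>{l<..card A}. h (g(Suc l := p)) t) = h (g(Suc l := p)) (Suc l) \<otimes> (\<Otimes>\<^bsub>S\<^esub>t\<in>?X. h (g(Suc l := p)) t)"
      unfolding ins
    proof (rule finprod_insert)
      show "h (g(Suc l := p)) \<in> ?X \<rightarrow> carrier S"
        using hX h by auto
      show "h (g(Suc l := p)) (Suc l) \<in> carrier S"
        unfolding h0 using m gT[of "Suc l"] l by (intro diff_quot_closed \<alpha>_closed) auto
    qed auto
    also have "(\<Otimes>\<^bsub>S\<^esub>t\<in>?X. h (g(Suc l := p)) t) =
        (\<Otimes>\<^bsub>S\<^esub>t\<in>?X. diff_quot (elem A t) (\<alpha> t ((g(Suc l := p)) (t - 1)) ((g(Suc l := p)) t)))"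
      by (rule finprod_cong') (use h hX in auto)
    finally show "(\<Otimes>\<^bsub>S\<^esub>t\<in>{l<..card A}. h (g(Suc l := p)) t) = diff_quot (elem A (Suc l)) (\<alpha> (Suc l) m p) \<otimes>
      (\<Otimes>\<^bsub>S\<^esub>t\<in>?X. diff_quot (elem A t) (\<alpha> t ((g(Suc l := p)) (t - 1)) ((g(Suc l := p)) t)))"
      by (simp only: h0)
  qed
  show ?thesis
    unfolding 1 2 3 4 by (simp only: path_sum_def mult_sum_right)
qed

text \<open>Since $d^r(fg)=d^r(f)\,g$ for $g\in K[[x_{r+1},\dots,x_n]]$, iterating the contracting homotopy
  splits into products of the $d^{r_l}(\alpha^{(l)}_{j_{l-1}j_l})$.\<close>

lemma lifted_cycle_eq_path_sum:
  assumes "finite A" "card A = l + k" "j \<in> {1..b (card A)}"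
    and "m \<in> (if l = card A then {j} else {1..b l})"
  shows "lifted_cycle k l j (elem A ` {l<..card A}) m = path_sum A j l m"
  using assms(2,4)
proof (induction k arbitrary: l m)
  case 0
  then show ?case
    by (simp add: path_sum_def one_eq)
next
  case (Suc k)
  let ?r = "elem A (Suc l)" and ?A = "elem A ` {Suc l<..card A}"
  let ?T = "if Suc l = card A then {j} else {1..b (Suc l)}"
  have l: "l < card A" using Suc.prems by simp
  have m: "m \<in> {1..b l}" using Suc.prems by (auto split: if_splits)
  note split = elem_image_split[OF assms(1) l]
  have card: "card ?A = k"
  proof (cases "Suc l < card A")
    case True
    then show ?thesis using elem_image_split(4)[OF assms(1) True] Suc.prems by simp
  next
    case False
    then show ?thesis using Suc.prems by simp
  qed
  have "lifted_cycle (Suc k) l j (elem A ` {l<..card A}) m =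
      diff_quot ?r (\<Sum>p\<in>{1..b (Suc l)}. \<alpha> (Suc l) m p \<otimes> lifted_cycle k (Suc l) j ?A p)"
    using m split by (simp add: koszul_h_def diff_mat_def)
  \<comment> \<open>The entries at \<open>?A\<close> involve only variables beyond the one with
    index \<open>?r\<close>, so the difference quotient acts on the matrix entry alone.\<close>
  also have "\<dots> = (\<Sum>p\<in>{1..b (Suc l)}. diff_quot ?r (\<alpha> (Suc l) m p) \<otimes> lifted_cycle k (Suc l) j ?A p)"
    unfolding diff_quot_sum
    by (intro sum.cong refl diff_quot_mult) (rule lifted_cycle_supp, use card split(3) in auto)
  \<comment> \<open>At the last position the remaining component is the unit vector e_j in Koszul
    degree 0, so only p = j survives.\<close>
  also have "\<dots> = (\<Sum>p\<in>?T. diff_quot ?r (\<alpha> (Suc l) m p) \<otimes> lifted_cycle k (Suc l) j ?A p)"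
  proof (rule sum.mono_neutral_right)
    show "?T \<subseteq> {1..b (Suc l)}" using assms(3) by auto
    show "\<forall>p\<in>{1..b (Suc l)} - ?T. diff_quot ?r (\<alpha> (Suc l) m p) \<otimes> lifted_cycle k (Suc l) j ?A p = 0"
    proof
      fix p assume "p \<in> {1..b (Suc l)} - ?T"
      then have "Suc l = card A" "p \<noteq> j" by (auto split: if_splits)
      then have "k = 0" using Suc.prems by simp
      with \<open>p \<noteq> j\<close> show "diff_quot ?r (\<alpha> (Suc l) m p) \<otimes> lifted_cycle k (Suc l) j ?A p = 0"
        by simp
    qed
  qed auto
  also have "\<dots> = (\<Sum>p\<in>?T. diff_quot ?r (\<alpha> (Suc l) m p) \<otimes> path_sum A j (Suc l) p)"
    by (intro sum.cong refl arg_cong2[where f="(\<otimes>)"] Suc.IH) (use Suc.prems in auto)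
  finally show ?case
    by (simp only: path_sum_Suc[OF l assms(3) m])
qed

text \<open>The tuples in \<open>index_paths\<close> carry j_0 = 1 themselves, whereas those in
  \<open>path_sum\<close> begin after position 0; \<open>g(0 := 1)\<close> is the bijection.\<close>

lemma path_sum_index_paths:
  assumes "i \<ge> 1" "card A = i"
  shows "(\<Sum>J\<in>index_paths b i j. \<Otimes>\<^bsub>S\<^esub>l\<in>{1..i}. diff_quot (elem A l) (\<alpha> l (J (l - 1)) (J l))) =
    path_sum A j 0 1"
proof -
  let ?T = "\<lambda>l. if l = 0 then {1} else if l = i then {j} else {1..b l}"
  have "index_paths b i j = (\<lambda>(y, g). g(0 := y)) ` (?T 0 \<times> Pi\<^sub>E {0<..i} ?T)"
    unfolding index_paths_def by (subst PiE_insert_eq[symmetric]) (auto intro!: arg_cong2[where f=PiE])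
  also have "?T 0 \<times> Pi\<^sub>E {0<..i} ?T = Pair 1 ` Pi\<^sub>E {0<..i} ?T"
    by auto
  also have "Pi\<^sub>E {0<..i} ?T = (\<Pi>\<^sub>E t\<in>{0<..i}. if t = i then {j} else {1..b t})"
    by (rule PiE_cong) auto
  finally have *: "index_paths b i j =
      (\<lambda>g. g(0 := 1)) ` (\<Pi>\<^sub>E t\<in>{0<..i}. if t = i then {j} else {1..b t})"
    by (simp add: image_image fun_upd_def)
  \<comment> \<open>Extensionality makes g \<open>undefined\<close> at 0, so overwriting that value
    loses nothing.\<close>
  have "inj_on (\<lambda>g. g(0 := 1::nat)) (\<Pi>\<^sub>E t\<in>{0<..i}. if t = i then {j} else {1..b t})"
  proof (rule inj_onI)
    fix g h :: "nat \<Rightarrow> nat"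
    assume g: "g \<in> (\<Pi>\<^sub>E t\<in>{0<..i}. if t = i then {j} else {1..b t})"
      "h \<in> (\<Pi>\<^sub>E t\<in>{0<..i}. if t = i then {j} else {1..b t})" and eq: "g(0 := 1) = h(0 := 1)"
    show "g = h"
    proof
      fix x show "g x = h x"
      proof (cases "x = 0")
        case True
        then show ?thesis using PiE_arb[OF g(1), of x] PiE_arb[OF g(2), of x] by simp
      next
        case False
        then show ?thesis using fun_cong[OF eq, of x] by simp
      qed
    qed
  qed
  moreover have "{1..i} = {0<..i}" by auto
  ultimately show ?thesis
    unfolding * path_sum_def by (subst sum.reindex) (simp_all add: assms)
qed

end

section \<open>Modules, quotients and homology\<close>

lemma quotient_module_facts:
  assumes M: "module R M" and N: "submodule N R M"
  shows "carrier (quotient_module M N) = (\<lambda>x. N +>\<^bsub>M\<^esub> x) ` carrier M"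
    and "\<zero>\<^bsub>quotient_module M N\<^esub> = N +>\<^bsub>M\<^esub> \<zero>\<^bsub>M\<^esub>"
    and "\<And>x y. \<lbrakk>x \<in> carrier M; y \<in> carrier M\<rbrakk> \<Longrightarrow>
      (N +>\<^bsub>M\<^esub> x) \<oplus>\<^bsub>quotient_module M N\<^esub> (N +>\<^bsub>M\<^esub> y) = N +>\<^bsub>M\<^esub> (x \<oplus>\<^bsub>M\<^esub> y)"
    and "\<And>x y. \<lbrakk>x \<in> carrier M; y \<in> carrier M\<rbrakk> \<Longrightarrow>
      N +>\<^bsub>M\<^esub> x = N +>\<^bsub>M\<^esub> y \<longleftrightarrow> x \<ominus>\<^bsub>M\<^esub> y \<in> N"
proof -
  interpret M: module R M by fact
  interpret N: submodule N R M by fact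
  interpret N: abelian_subgroup N M
    by (intro abelian_subgroupI3 additive_subgroup.intro N.subgroup_axioms M.abelian_group_axioms)
  show "carrier (quotient_module M N) = (\<lambda>x. N +>\<^bsub>M\<^esub> x) ` carrier M"
    by (auto simp: quotient_module_def A_RCOSETS_def')
  show "\<zero>\<^bsub>quotient_module M N\<^esub> = N +>\<^bsub>M\<^esub> \<zero>\<^bsub>M\<^esub>"
    using M.a_coset_add_zero[OF N.a_subset] by (simp add: quotient_module_def)
  fix x y assume x: "x \<in> carrier M" and y: "y \<in> carrier M"
  show "(N +>\<^bsub>M\<^esub> x) \<oplus>\<^bsub>quotient_module M N\<^esub> (N +>\<^bsub>M\<^esub> y) = N +>\<^bsub>M\<^esub> (x \<oplus>\<^bsub>M\<^esub> y)"
    using N.a_rcos_sum[OF x y] by (simp add: quotient_module_def)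
  show "N +>\<^bsub>M\<^esub> x = N +>\<^bsub>M\<^esub> y \<longleftrightarrow> x \<ominus>\<^bsub>M\<^esub> y \<in> N"
  proof
    assume "N +>\<^bsub>M\<^esub> x = N +>\<^bsub>M\<^esub> y"
    then have "x \<in> N +>\<^bsub>M\<^esub> y"
      using N.a_rcos_self[OF x] by simp
    then obtain h where h: "h \<in> N" "x = h \<oplus>\<^bsub>M\<^esub> y"
      by (auto simp: a_r_coset_def')
    then have "x \<ominus>\<^bsub>M\<^esub> y = h"
      using y N.a_Hcarr by (simp add: a_minus_def M.a_assoc M.r_neg)
    with h show "x \<ominus>\<^bsub>M\<^esub> y \<in> N" by simp
  next
    assume h: "x \<ominus>\<^bsub>M\<^esub> y \<in> N"
    have "x = (x \<ominus>\<^bsub>M\<^esub> y) \<oplus>\<^bsub>M\<^esub> y"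
      using x y by (simp add: a_minus_def M.a_assoc M.l_neg)
    then have "x \<in> N +>\<^bsub>M\<^esub> y"
      using h by (auto simp: a_r_coset_def')
    then show "N +>\<^bsub>M\<^esub> x = N +>\<^bsub>M\<^esub> y"
      using N.a_repr_independence'[OF _ y] by simp
  qed
qed

lemma mod_homD:
  assumes "module R M" "module R N" "f \<in> mod_hom R M N"
  shows "\<And>x. x \<in> carrier M \<Longrightarrow> f x \<in> carrier N"
    and "\<And>x y. x \<in> carrier M \<Longrightarrow> y \<in> carrier M \<Longrightarrow> f (x \<oplus>\<^bsub>M\<^esub> y) = f x \<oplus>\<^bsub>N\<^esub> f y"
    and "\<And>a x. a \<in> carrier R \<Longrightarrow> x \<in> carrier M \<Longrightarrow> f (a \<odot>\<^bsub>M\<^esub> x) = a \<odot>\<^bsub>N\<^esub> f x"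
    and "f \<zero>\<^bsub>M\<^esub> = \<zero>\<^bsub>N\<^esub>"
    and "\<And>J g. finite J \<Longrightarrow> g \<in> J \<rightarrow> carrier M \<Longrightarrow>
      f (finsum M g J) = (\<Oplus>\<^bsub>N\<^esub>j\<in>J. f (g j))"
proof -
  interpret M: module R M by fact
  interpret N: module R N by fact
  show 1: "f x \<in> carrier N" if "x \<in> carrier M" for x
    using assms(3) that by (auto simp: mod_hom_def)
  show 2: "f (x \<oplus>\<^bsub>M\<^esub> y) = f x \<oplus>\<^bsub>N\<^esub> f y" if "x \<in> carrier M" "y \<in> carrier M" for x y
    using assms(3) that by (auto simp: mod_hom_def)
  show 3: "f (a \<odot>\<^bsub>M\<^esub> x) = a \<odot>\<^bsub>N\<^esub> f x" if "a \<in> carrier R" "x \<in> carrier M" for a x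
    using assms(3) that by (auto simp: mod_hom_def)
  show 4: "f \<zero>\<^bsub>M\<^esub> = \<zero>\<^bsub>N\<^esub>"
    using 3[of "\<zero>\<^bsub>R\<^esub>" "\<zero>\<^bsub>M\<^esub>"] 1[of "\<zero>\<^bsub>M\<^esub>"] by simp
  show "f (finsum M g J) = (\<Oplus>\<^bsub>N\<^esub>j\<in>J. f (g j))" if "finite J" "g \<in> J \<rightarrow> carrier M" for J g
    using that
  proof (induction J rule: finite_induct)
    case (insert x F)
    then have "g x \<in> carrier M" "g \<in> F \<rightarrow> carrier M" by auto
    with insert show ?case
      by (simp add: 2 1 Pi_iff)
  qed (simp add: 4)
qed

text \<open>Only degrees \<open>Suc k\<close> are treated, where \<open>i - 1\<close> in
  \<open>cycles\<close> is the true predecessor. Equality of classes is phrased with a sum instead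
  of a difference, so that no inverses in the quotient modules have to be computed later.\<close>

lemma homology_facts:
  fixes C :: "nat \<Rightarrow> ('a, 'b) module"
  assumes C: "\<And>k. module R (C k)" and d: "\<And>k. d (Suc k) \<in> mod_hom R (C (Suc k)) (C k)"
    and dd: "\<forall>x\<in>carrier (C (Suc (Suc k))). d (Suc k) (d (Suc (Suc k)) x) = \<zero>\<^bsub>C k\<^esub>"
  defines "H \<equiv> homology C d (Suc k)" and "c \<equiv> homology_class C d (Suc k)"
    and "Z \<equiv> cycles C d (Suc k)"
  shows "module R H"
    and "carrier H = c ` Z"
    and "\<zero>\<^bsub>H\<^esub> = c \<zero>\<^bsub>C (Suc k)\<^esub>"
    and "\<And>x y. \<lbrakk>x \<in> Z; y \<in> Z\<rbrakk> \<Longrightarrow> c x \<oplus>\<^bsub>H\<^esub> c y = c (x \<oplus>\<^bsub>C (Suc k)\<^esub> y)"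
    and "\<And>a x. \<lbrakk>a \<in> carrier R; x \<in> Z\<rbrakk> \<Longrightarrow> a \<odot>\<^bsub>H\<^esub> c x = c (a \<odot>\<^bsub>C (Suc k)\<^esub> x)"
    and "\<And>x y. \<lbrakk>x \<in> Z; y \<in> Z\<rbrakk> \<Longrightarrow> c x = c y \<longleftrightarrow> (\<exists>u\<in>carrier (C (Suc (Suc k))).
      x = d (Suc (Suc k)) u \<oplus>\<^bsub>C (Suc k)\<^esub> y)"
proof -
  interpret C0: module R "C k" by (rule C)
  interpret C1: module R "C (Suc k)" by (rule C)
  interpret C2: module R "C (Suc (Suc k))" by (rule C)
  note d1 = mod_homD[OF C C d[of k]]
  note d2 = mod_homD[OF C C d[of "Suc k"]]
  let ?B = "boundaries C d (Suc k)"
  have Z: "x \<in> Z \<longleftrightarrow> x \<in> carrier (C (Suc k)) \<and> d (Suc k) x = \<zero>\<^bsub>C k\<^esub>" for x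
    by (auto simp: Z_def cycles_def a_kernel_def')
  \<comment> \<open>With negation as multiplication by -1, closure under inverses follows from
    linearity.\<close>
  have neg: "\<ominus>\<^bsub>C (Suc j)\<^esub> x = (\<ominus>\<^bsub>R\<^esub> \<one>\<^bsub>R\<^esub>) \<odot>\<^bsub>C (Suc j)\<^esub> x" if "x \<in> carrier (C (Suc j))" for x j
    using module.smult_l_minus[OF C C0.R.one_closed that] module.smult_one[OF C that] by simp
  have subZ: "submodule Z R (C (Suc k))"
    by (rule C1.submoduleI) (auto simp: Z d1 neg)
  interpret ZM: module R "(C (Suc k))\<lparr>carrier := Z\<rparr>"
    by (rule submodule.submodule_is_module[OF subZ C])
  have BZ: "?B \<subseteq> Z"
    by (auto simp: boundaries_def Z d2 dd)
  have ZC: "Z \<subseteq> carrier (C (Suc k))" by (auto simp: Z)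
  \<comment> \<open>Negation is defined by a description over the carrier, so it must be compared
    again once the carrier shrinks to the cycles.\<close>
  have inv_eq: "\<ominus>\<^bsub>(C (Suc k))\<lparr>carrier := Z\<rparr>\<^esub> x = \<ominus>\<^bsub>C (Suc k)\<^esub> x" if "x \<in> Z" for x
  proof -
    have "\<ominus>\<^bsub>C (Suc k)\<^esub> x \<in> Z" using that by (rule C1.submoduleE(3)[OF subZ])
    then show ?thesis
      using that ZC by (intro ZM.minus_equality) (auto simp: C1.l_neg)
  qed
  have subB: "submodule ?B R ((C (Suc k))\<lparr>carrier := Z\<rparr>)"
  proof (rule ZM.submoduleI)
    show "?B \<subseteq> carrier ((C (Suc k))\<lparr>carrier := Z\<rparr>)" using BZ by simp
    show "\<zero>\<^bsub>(C (Suc k))\<lparr>carrier := Z\<rparr>\<^esub> \<in> ?B"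
      using d2(4) C2.zero_closed by (force simp: boundaries_def)
    show "\<ominus>\<^bsub>(C (Suc k))\<lparr>carrier := Z\<rparr>\<^esub> a \<in> ?B" if a: "a \<in> ?B" for a
    proof -
      have "\<ominus>\<^bsub>(C (Suc k))\<lparr>carrier := Z\<rparr>\<^esub> a = (\<ominus>\<^bsub>R\<^esub> \<one>\<^bsub>R\<^esub>) \<odot>\<^bsub>C (Suc k)\<^esub> a"
        using a BZ ZC by (subst inv_eq) (auto simp: neg)
      moreover obtain u where "u \<in> carrier (C (Suc (Suc k)))" "a = d (Suc (Suc k)) u"
        using a by (auto simp: boundaries_def)
      ultimately show ?thesis
        using d2(3)[of "\<ominus>\<^bsub>R\<^esub> \<one>\<^bsub>R\<^esub>" u] by (auto simp: boundaries_def intro!: image_eqI[of _ _ "(\<ominus>\<^bsub>R\<^esub> \<one>\<^bsub>R\<^esub>) \<odot>\<^bsub>C (Suc (Suc k))\<^esub> u"])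
    qed
    show "a \<oplus>\<^bsub>(C (Suc k))\<lparr>carrier := Z\<rparr>\<^esub> a' \<in> ?B" if "a \<in> ?B" "a' \<in> ?B" for a a'
    proof -
      from that obtain u u' where "u \<in> carrier (C (Suc (Suc k)))" "a = d (Suc (Suc k)) u"
        "u' \<in> carrier (C (Suc (Suc k)))" "a' = d (Suc (Suc k)) u'"
        by (auto simp: boundaries_def)
      then show ?thesis
        using d2(2)[of u u'] by (auto simp: boundaries_def intro!: image_eqI[of _ _ "u \<oplus>\<^bsub>C (Suc (Suc k))\<^esub> u'"])
    qed
    show "r \<odot>\<^bsub>(C (Suc k))\<lparr>carrier := Z\<rparr>\<^esub> a \<in> ?B" if "r \<in> carrier R" "a \<in> ?B" for r a
    proof -
      from that obtain u where "u \<in> carrier (C (Suc (Suc k)))" "a = d (Suc (Suc k)) u"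
        by (auto simp: boundaries_def)
      then show ?thesis
        using d2(3)[of r u] that by (auto simp: boundaries_def intro!: image_eqI[of _ _ "r \<odot>\<^bsub>C (Suc (Suc k))\<^esub> u"])
    qed
  qed
  have c: "c x = ?B +>\<^bsub>(C (Suc k))\<lparr>carrier := Z\<rparr>\<^esub> x" for x
    by (simp add: c_def homology_class_def a_r_coset_def')
  have H: "H = quotient_module ((C (Suc k))\<lparr>carrier := Z\<rparr>) ?B"
    by (simp add: H_def homology_def Z_def)
  note qm = quotient_module_module[OF ZM.module_axioms subB]
  note qf = quotient_module_facts[OF ZM.module_axioms subB]
  show "module R H" using qm(1) by (simp add: H)
  show "carrier H = c ` Z" using qf(1) by (simp add: H c)
  show "\<zero>\<^bsub>H\<^esub> = c \<zero>\<^bsub>C (Suc k)\<^esub>" using qf(2) by (simp add: H c)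
  show "c x \<oplus>\<^bsub>H\<^esub> c y = c (x \<oplus>\<^bsub>C (Suc k)\<^esub> y)" if "x \<in> Z" "y \<in> Z" for x y
    using qf(3)[of x y] that by (simp add: H c)
  show "a \<odot>\<^bsub>H\<^esub> c x = c (a \<odot>\<^bsub>C (Suc k)\<^esub> x)" if "a \<in> carrier R" "x \<in> Z" for a x
    using qm(2)[of a x] that by (simp add: H c)
  fix x y assume xy: "x \<in> Z" "y \<in> Z"
  then have xyC: "x \<in> carrier (C (Suc k))" "y \<in> carrier (C (Suc k))" using ZC by auto
  have "c x = c y \<longleftrightarrow> x \<ominus>\<^bsub>(C (Suc k))\<lparr>carrier := Z\<rparr>\<^esub> y \<in> ?B"
    using qf(4)[of x y] xy by (simp add: c)
  also have "x \<ominus>\<^bsub>(C (Suc k))\<lparr>carrier := Z\<rparr>\<^esub> y = x \<ominus>\<^bsub>C (Suc k)\<^esub> y"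
    using xy by (simp add: a_minus_def inv_eq)
  also have "x \<ominus>\<^bsub>C (Suc k)\<^esub> y \<in> ?B \<longleftrightarrow> (\<exists>u\<in>carrier (C (Suc (Suc k))). x \<ominus>\<^bsub>C (Suc k)\<^esub> y = d (Suc (Suc k)) u)"
    by (auto simp: boundaries_def)
  also have "\<dots> \<longleftrightarrow> (\<exists>u\<in>carrier (C (Suc (Suc k))). x = d (Suc (Suc k)) u \<oplus>\<^bsub>C (Suc k)\<^esub> y)"
  proof (rule bex_cong[OF refl])
    fix u assume u: "u \<in> carrier (C (Suc (Suc k)))"
    show "(x \<ominus>\<^bsub>C (Suc k)\<^esub> y = d (Suc (Suc k)) u) = (x = d (Suc (Suc k)) u \<oplus>\<^bsub>C (Suc k)\<^esub> y)"
    proof -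
      have "x = (x \<ominus>\<^bsub>C (Suc k)\<^esub> y) \<oplus>\<^bsub>C (Suc k)\<^esub> y"
        using xyC by (simp add: a_minus_def C1.a_assoc C1.l_neg)
      moreover have "(d (Suc (Suc k)) u \<oplus>\<^bsub>C (Suc k)\<^esub> y) \<ominus>\<^bsub>C (Suc k)\<^esub> y = d (Suc (Suc k)) u"
        using xyC d2(1)[OF u] by (simp add: a_minus_def C1.a_assoc C1.r_neg)
      ultimately show ?thesis by metis
    qed
  qed
  finally show "c x = c y \<longleftrightarrow> (\<exists>u\<in>carrier (C (Suc (Suc k))). x = d (Suc (Suc k)) u \<oplus>\<^bsub>C (Suc k)\<^esub> y)" .
qed

lemma module_free_module:
  fixes R :: "('a, 'r) ring_scheme" and B :: "'i set"
  assumes "cring R"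
  shows "module R (free_module R B)"
proof -
  interpret cring R by fact
  have fin: "finite {x. v x \<oplus>\<^bsub>R\<^esub> w x \<noteq> \<zero>\<^bsub>R\<^esub>}"
    if "finite {x. v x \<noteq> \<zero>\<^bsub>R\<^esub>}" "finite {x. w x \<noteq> \<zero>\<^bsub>R\<^esub>}" for v w :: "'i \<Rightarrow> 'a"
    by (rule finite_subset[OF _ finite_UnI[OF that]]) auto
  have clos: "w x \<in> carrier R" if "w \<in> carrier (free_module R B)" for w x
    using that by (cases "x \<in> B") (auto simp: free_module_def)
  have ab: "abelian_group (free_module R B)"
  proof (rule abelian_groupI)
    fix w assume w: "w \<in> carrier (free_module R B)"
    have "{x. \<ominus>\<^bsub>R\<^esub> w x \<noteq> \<zero>\<^bsub>R\<^esub>} \<subseteq> {x. w x \<noteq> \<zero>\<^bsub>R\<^esub>}" by auto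
    then have "(\<lambda>x. \<ominus>\<^bsub>R\<^esub> w x) \<in> carrier (free_module R B)"
      using w by (auto simp: free_module_def elim: finite_subset)
    moreover have "(\<lambda>x. \<ominus>\<^bsub>R\<^esub> w x) \<oplus>\<^bsub>free_module R B\<^esub> w = \<zero>\<^bsub>free_module R B\<^esub>"
      using clos[OF w] by (auto simp: free_module_def l_neg)
    ultimately show "\<exists>v\<in>carrier (free_module R B). v \<oplus>\<^bsub>free_module R B\<^esub> w = \<zero>\<^bsub>free_module R B\<^esub>"
      by blast
    show "\<zero>\<^bsub>free_module R B\<^esub> \<oplus>\<^bsub>free_module R B\<^esub> w = w"
      using clos[OF w] by (auto simp: free_module_def)
    fix v assume v: "v \<in> carrier (free_module R B)"
    show "w \<oplus>\<^bsub>free_module R B\<^esub> v \<in> carrier (free_module R B)"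
      using v w fin by (auto simp: free_module_def)
    show "w \<oplus>\<^bsub>free_module R B\<^esub> v = v \<oplus>\<^bsub>free_module R B\<^esub> w"
      using clos[OF v] clos[OF w] by (auto simp: free_module_def a_comm)
    fix u assume u: "u \<in> carrier (free_module R B)"
    show "w \<oplus>\<^bsub>free_module R B\<^esub> v \<oplus>\<^bsub>free_module R B\<^esub> u = w \<oplus>\<^bsub>free_module R B\<^esub> (v \<oplus>\<^bsub>free_module R B\<^esub> u)"
      using clos[OF v] clos[OF w] clos[OF u] by (auto simp: free_module_def a_assoc)
  qed (auto simp: free_module_def)
  show ?thesis
  proof (rule moduleI[OF assms ab])
    fix a w assume aw: "a \<in> carrier R" "w \<in> carrier (free_module R B)"
    have "{x. a \<otimes>\<^bsub>R\<^esub> w x \<noteq> \<zero>\<^bsub>R\<^esub>} \<subseteq> {x. w x \<noteq> \<zero>\<^bsub>R\<^esub>}" using aw by auto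
    then show "a \<odot>\<^bsub>free_module R B\<^esub> w \<in> carrier (free_module R B)"
      using aw by (auto simp: free_module_def elim: finite_subset)
    fix a' assume a': "a' \<in> carrier R"
    show "(a \<oplus>\<^bsub>R\<^esub> a') \<odot>\<^bsub>free_module R B\<^esub> w =
        a \<odot>\<^bsub>free_module R B\<^esub> w \<oplus>\<^bsub>free_module R B\<^esub> a' \<odot>\<^bsub>free_module R B\<^esub> w"
      using clos[OF aw(2)] aw a' by (simp add: free_module_def l_distr)
    show "(a \<otimes>\<^bsub>R\<^esub> a') \<odot>\<^bsub>free_module R B\<^esub> w = a \<odot>\<^bsub>free_module R B\<^esub> (a' \<odot>\<^bsub>free_module R B\<^esub> w)"
      using clos[OF aw(2)] aw a' by (simp add: free_module_def m_assoc)
  next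
    fix a v w assume "a \<in> carrier R" "v \<in> carrier (free_module R B)" "w \<in> carrier (free_module R B)"
    then show "a \<odot>\<^bsub>free_module R B\<^esub> (v \<oplus>\<^bsub>free_module R B\<^esub> w) =
        a \<odot>\<^bsub>free_module R B\<^esub> v \<oplus>\<^bsub>free_module R B\<^esub> a \<odot>\<^bsub>free_module R B\<^esub> w"
      using clos[of v] clos[of w] by (simp add: free_module_def r_distr)
  next
    fix w assume "w \<in> carrier (free_module R B)"
    then show "\<one>\<^bsub>R\<^esub> \<odot>\<^bsub>free_module R B\<^esub> w = w"
      using clos[of w] by (simp add: free_module_def)
  qed
qed

section \<open>The Koszul complex in coordinates\<close>

lemma finite_subsets_of_size [simp]: "finite (subsets_of_size n k)"
  by (rule finite_subset[of _ "Pow {1..n}"]) (auto simp: subsets_of_size_def)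

lemma finite_if_subsets_of_size: "A \<in> subsets_of_size n k \<Longrightarrow> finite A"
  by (auto simp: subsets_of_size_def dest: finite_subset)

context series_ring
begin

lemma module_koszul: "module S (koszul S n k)"
  unfolding koszul_def by (rule module_free_module) (rule cring_axioms)

lemma koszul_carrier:
  "w \<in> carrier (koszul S n k) \<longleftrightarrow> (\<forall>A. w A \<in> carrier S) \<and> (\<forall>A. A \<notin> subsets_of_size n k \<longrightarrow> w A = 0)"
proof -
  have "finite {A. w A \<noteq> 0}" if "\<forall>A. A \<notin> subsets_of_size n k \<longrightarrow> w A = 0"
    by (rule finite_subset[of _ "subsets_of_size n k"]) (use that in auto)
  then show ?thesis
    by (auto simp: koszul_def free_module_def zero_eq)
qed

lemma koszul_add: "add (koszul S n k) = (+)"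
  by (simp add: koszul_def free_module_def add_eq fun_eq_iff)

lemma koszul_zero: "\<zero>\<^bsub>koszul S n k\<^esub> = 0"
  by (simp add: koszul_def free_module_def zero_eq fun_eq_iff)

lemma koszul_smult: "a \<odot>\<^bsub>koszul S n k\<^esub> w = (\<lambda>A. a \<otimes> w A)"
  by (simp add: koszul_def free_module_def)

lemma finsum_koszul:
  "f \<in> J \<rightarrow> carrier (koszul S n k) \<Longrightarrow> finsum (koszul S n k) f J = sum f J"
  by (rule finsum_eq_sum)
    (use module_koszul[of k] in \<open>auto simp: koszul_add koszul_zero module_def abelian_group_def\<close>)

lemma mult_unit_vec: "c \<in> carrier S \<Longrightarrow> c \<otimes> unit_vec S A B = (if B = A then c else 0)"
  by (simp add: unit_vec_def zero_eq[symmetric])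

lemma finsum_unit_vec:
  assumes "\<And>A. A \<in> subsets_of_size n k \<Longrightarrow> c A \<in> carrier S"
  shows "(\<Oplus>\<^bsub>koszul S n k\<^esub>A\<in>subsets_of_size n k. c A \<odot>\<^bsub>koszul S n k\<^esub> unit_vec S A) =
    (\<lambda>A. if A \<in> subsets_of_size n k then c A else 0)"
proof -
  have "(\<lambda>A. c A \<odot>\<^bsub>koszul S n k\<^esub> unit_vec S A) \<in> subsets_of_size n k \<rightarrow> carrier (koszul S n k)"
    using assms by (auto simp: koszul_carrier koszul_smult mult_unit_vec)
  then have "(\<Oplus>\<^bsub>koszul S n k\<^esub>A\<in>subsets_of_size n k. c A \<odot>\<^bsub>koszul S n k\<^esub> unit_vec S A) =
      (\<Sum>A\<in>subsets_of_size n k. c A \<odot>\<^bsub>koszul S n k\<^esub> unit_vec S A)"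
    by (rule finsum_koszul)
  also have "\<dots> = (\<lambda>A. if A \<in> subsets_of_size n k then c A else 0)"
  proof
    fix B
    have "(\<Sum>A\<in>subsets_of_size n k. c A \<odot>\<^bsub>koszul S n k\<^esub> unit_vec S A) B =
        (\<Sum>A\<in>subsets_of_size n k. if B = A then c A else 0)"
      unfolding sum_fun_apply[where x=B] koszul_smult by (rule sum.cong) (use assms in \<open>auto simp: mult_unit_vec\<close>)
    then show "(\<Sum>A\<in>subsets_of_size n k. c A \<odot>\<^bsub>koszul S n k\<^esub> unit_vec S A) B =
        (if B \<in> subsets_of_size n k then c B else 0)"
      by simp
  qed
  finally show ?thesis .
qed

text \<open>The right-hand side is a submodule containing all products, and conversely w is the
  finite sum of the products of w A in I with dx_A. Congruence modulo I\<Omega> can thus be tested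
  coefficient by coefficient.\<close>

lemma ideal_smult_koszul:
  assumes "ideal I S"
  shows "ideal_smult S I (koszul S n k) = {w \<in> carrier (koszul S n k). \<forall>A. w A \<in> I}"
proof -
  interpret I: ideal I S by fact
  interpret K: module S "koszul S n k" by (rule module_koszul)
  note Is = submodule_ideal_smult[OF module_koszul[of k] I.a_subset]
  have I0: "0 \<in> I" using I.zero_closed by (simp add: zero_eq)
  have I_add: "f + g \<in> I" if "f \<in> I" "g \<in> I" for f g
    using I.a_closed[OF that] by (simp add: add_eq)
  have I_neg: "- f \<in> I" if "f \<in> I" for f
    using I.a_inv_closed[OF that] I.a_Hcarr[OF that] by (simp add: a_inv_eq)
  let ?N = "{w \<in> carrier (koszul S n k). \<forall>A. w A \<in> I}"
  have neg: "\<ominus>\<^bsub>koszul S n k\<^esub> w = - w" if w: "w \<in> carrier (koszul S n k)" for w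
    using w by (intro K.minus_equality) (auto simp: koszul_carrier koszul_add koszul_zero)
  show ?thesis
  proof
    show "ideal_smult S I (koszul S n k) \<subseteq> ?N"
    proof (rule Is(3))
      show "submodule ?N S (koszul S n k)"
      proof (rule K.submoduleI)
        show "\<ominus>\<^bsub>koszul S n k\<^esub> w \<in> ?N" if "w \<in> ?N" for w
          using that K.a_inv_closed[of w] I_neg by (auto simp: neg)
        show "v \<oplus>\<^bsub>koszul S n k\<^esub> w \<in> ?N" if "v \<in> ?N" "w \<in> ?N" for v w
          using that K.a_closed[of v w] I_add by (auto simp: koszul_add)
        show "a \<odot>\<^bsub>koszul S n k\<^esub> w \<in> ?N" if "a \<in> carrier S" "w \<in> ?N" for a w
          using that K.smult_closed[of a w] I.I_l_closed by (auto simp: koszul_smult)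
      qed (use K.zero_closed I0 in \<open>auto simp: koszul_zero\<close>)
      show "a \<odot>\<^bsub>koszul S n k\<^esub> w \<in> ?N" if "a \<in> I" "w \<in> carrier (koszul S n k)" for a w
        using that K.smult_closed[of a w] I.I_r_closed I.a_Hcarr[OF that(1)]
        by (auto simp: koszul_smult koszul_carrier)
    qed
    show "?N \<subseteq> ideal_smult S I (koszul S n k)"
    proof
      fix w assume w: "w \<in> ?N"
      have eq: "w = (\<Oplus>\<^bsub>koszul S n k\<^esub>A\<in>subsets_of_size n k. w A \<odot>\<^bsub>koszul S n k\<^esub> unit_vec S A)"
        using w by (subst finsum_unit_vec) (auto simp: koszul_carrier fun_eq_iff)
      have wA: "w A \<in> carrier S" for A
        using w by (simp add: koszul_carrier)
      have "(\<Oplus>\<^bsub>koszul S n k\<^esub>A\<in>J. w A \<odot>\<^bsub>koszul S n k\<^esub> unit_vec S A) \<in> ideal_smult S I (koszul S n k)"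
        if "finite J" "J \<subseteq> subsets_of_size n k" for J
        using that
      proof (induction J rule: finite_induct)
        case empty
        then show ?case
          using subgroup.one_closed[OF submodule.axioms(1)[OF Is(1)]] by simp
      next
        case (insert A J)
        have unit: "unit_vec S A \<in> carrier (koszul S n k)" if "A \<in> subsets_of_size n k" for A
          using that by (auto simp: koszul_carrier unit_vec_def zero_eq)
        have A: "w A \<odot>\<^bsub>koszul S n k\<^esub> unit_vec S A \<in> ideal_smult S I (koszul S n k)"
          using w insert by (intro Is(2) unit) auto
        have "(\<lambda>A. w A \<odot>\<^bsub>koszul S n k\<^esub> unit_vec S A) \<in> insert A J \<rightarrow> carrier (koszul S n k)"
          using insert.prems unit wA by (auto intro!: K.smult_closed)
        then show ?case
          using insert A K.submoduleE(5)[OF Is(1)] by simp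
      qed
      then show "w \<in> ideal_smult S I (koszul S n k)"
        by (subst eq) simp
    qed
  qed
qed

lemma minus_one_power: "(\<ominus> \<one>) [^] (t::nat) = const ((- 1) ^ t)"
proof (induction t)
  case 0
  then show ?case by (simp add: one_eq)
next
  case (Suc t)
  have "\<ominus> \<one> = const (- 1)"
    by (simp add: a_inv_eq) (auto simp: one_eq const_def)
  then have "(\<ominus> \<one>) [^] Suc t = const ((- 1) ^ t) \<otimes> const (- 1)"
    using Suc by simp
  also have "\<dots> = const ((- 1) ^ Suc t)"
    unfolding const_mult by (auto simp: scale_def const_def)
  finally show ?case .
qed

text \<open>The sum over pairs (A, r) with r in A is regrouped by the target set A - {r}, after
  replacing positions in A by elements of A.\<close>

lemma koszul_diff_eq:
  assumes w: "w \<in> carrier (koszul S n (Suc k))"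
  shows "koszul_diff S indet n (Suc k) w = (\<lambda>B. if B \<in> subsets_of_size n k then koszul_d n w B else 0)"
proof -
  let ?K = "koszul S n k" and ?X = "subsets_of_size n (Suc k)"
  interpret K: module S ?K by (rule module_koszul)
  define s where "s A t = (\<ominus> \<one>) [^] (t + 1) \<otimes> indet (elem A t)" for A t
  have s: "s A t = scale ((- 1) ^ (t + 1)) (indet (elem A t))" for A t
    unfolding s_def minus_one_power const_mult ..
  have A: "finite A" "card A = Suc k" "A \<subseteq> {1..n}" if "A \<in> ?X" for A
    using that by (auto simp: subsets_of_size_def dest: finite_subset)
  have elem_n: "elem A t \<in> {1..n}" if "A \<in> ?X" "t \<in> {1..Suc k}" for A t
    using elem_in[of A t] A[OF that(1)] that(2) by auto
  have s_closed: "s A t \<in> carrier S" if "A \<in> ?X" "t \<in> {1..Suc k}" for A t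
    unfolding s using elem_n[OF that] by simp
  have diff_elem: "A - {elem A t} \<in> subsets_of_size n k" if "A \<in> ?X" "t \<in> {1..Suc k}" for A t
    using A[OF that(1)] elem_in[of A t] that(2) by (auto simp: subsets_of_size_def)
  have wA: "w A \<in> carrier S" for A
    using w by (simp add: koszul_carrier)
  have unit: "s A t \<odot>\<^bsub>?K\<^esub> unit_vec S (A - {elem A t}) \<in> carrier ?K" if "A \<in> ?X" "t \<in> {1..Suc k}" for A t
    using s_closed[OF that] diff_elem[OF that] by (auto simp: koszul_carrier koszul_smult mult_unit_vec)
  have "koszul_diff S indet n (Suc k) w =
      (\<Oplus>\<^bsub>?K\<^esub>A\<in>?X. w A \<odot>\<^bsub>?K\<^esub> (\<Oplus>\<^bsub>?K\<^esub>t\<in>{1..Suc k}. s A t \<odot>\<^bsub>?K\<^esub> unit_vec S (A - {elem A t})))"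
    by (simp add: koszul_diff_def s_def)
  also have "\<dots> = (\<Sum>A\<in>?X. w A \<odot>\<^bsub>?K\<^esub> (\<Oplus>\<^bsub>?K\<^esub>t\<in>{1..Suc k}. s A t \<odot>\<^bsub>?K\<^esub> unit_vec S (A - {elem A t})))"
    by (intro finsum_koszul Pi_I K.smult_closed K.finsum_closed wA unit)
  also have "\<dots> = (\<Sum>A\<in>?X. w A \<odot>\<^bsub>?K\<^esub> (\<Sum>t\<in>{1..Suc k}. s A t \<odot>\<^bsub>?K\<^esub> unit_vec S (A - {elem A t})))"
    by (intro sum.cong refl arg_cong[where f="(\<odot>\<^bsub>?K\<^esub>) _"] finsum_koszul) (use unit in auto)
  finally have 1: "koszul_diff S indet n (Suc k) w = \<dots>" .
  have 2: "(\<Sum>A\<in>?X. w A \<odot>\<^bsub>?K\<^esub> (\<Sum>t\<in>{1..Suc k}. s A t \<odot>\<^bsub>?K\<^esub> unit_vec S (A - {elem A t}))) B =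
      (\<Sum>A\<in>?X. \<Sum>r\<in>A. if B = A - {r} then scale (koszul_sign r B) (shift r (w A)) else 0)" for B
    unfolding sum_fun_apply[where x=B] koszul_smult[where a="w _"] mult_sum_right
  proof (rule sum.cong[OF refl])
    fix A assume AX: "A \<in> ?X"
    \<comment> \<open>The t-th element of A has t - 1 elements below it, and the exponents t + 1 and
      t - 1 have the same parity.\<close>
    have sign: "(- 1) ^ (t + 1) = (koszul_sign (elem A t) (A - {elem A t}) :: 'k)" if "t \<in> {1..Suc k}" for t
    proof -
      have "{s\<in>A - {elem A t}. s < elem A t} = {s\<in>A. s < elem A t}" by auto
      then have "koszul_sign (elem A t) (A - {elem A t}) = ((- 1) ^ (t - 1) :: 'k)"
        using card_below_elem[of A t] A[OF AX] that by (simp add: koszul_sign_def)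
      then show ?thesis using that by (cases t) auto
    qed
    have "(\<Sum>t\<in>{1..Suc k}. w A \<otimes> (s A t \<otimes> unit_vec S (A - {elem A t}) B)) =
        (\<Sum>t\<in>{1..Suc k}. if B = A - {elem A t} then scale (koszul_sign (elem A t) B) (shift (elem A t) (w A)) else 0)"
    proof (rule sum.cong[OF refl])
      fix t assume t: "t \<in> {1..Suc k}"
      have "w A \<otimes> s A t = scale ((- 1) ^ (t + 1)) (shift (elem A t) (w A))"
        unfolding s using m_comm[OF wA indet_closed[OF elem_n[OF AX t]]] by (simp add: indet_mult)
      then show "w A \<otimes> (s A t \<otimes> unit_vec S (A - {elem A t}) B) =
          (if B = A - {elem A t} then scale (koszul_sign (elem A t) B) (shift (elem A t) (w A)) else 0)"
        using sign[OF t] s_closed[OF AX t] by (simp add: mult_unit_vec)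
    qed
    also have "\<dots> = (\<Sum>r\<in>A. if B = A - {r} then scale (koszul_sign r B) (shift r (w A)) else 0)"
      by (rule sum.reindex_bij_betw) (use elem_bij_betw[of A] A[OF AX] in simp)
    finally show "(\<Sum>t\<in>{1..Suc k}. w A \<otimes> (s A t \<odot>\<^bsub>?K\<^esub> unit_vec S (A - {elem A t})) B) =
        (\<Sum>r\<in>A. if B = A - {r} then scale (koszul_sign r B) (shift r (w A)) else 0)"
      by (simp add: koszul_smult)
  qed
  have 3: "(\<Sum>A\<in>?X. \<Sum>r\<in>A. if B = A - {r} then scale (koszul_sign r B) (shift r (w A)) else 0) =
      (if B \<in> subsets_of_size n k then koszul_d n w B else 0)" for B
  proof (cases "B \<in> subsets_of_size n k")
    case False
    have "B \<noteq> A - {r}" if "A \<in> ?X" "r \<in> A" for A r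
      using False A[OF that(1)] that(2) by (auto simp: subsets_of_size_def)
    then show ?thesis using False by (simp cong: sum.cong)
  next
    case True
    let ?f = "\<lambda>(A, r). if B = A - {r} then scale (koszul_sign r B) (shift r (w A)) else 0"
    have "(\<Sum>A\<in>?X. \<Sum>r\<in>A. ?f (A, r)) = (\<Sum>p\<in>Sigma ?X (\<lambda>A. A). ?f p)"
      by (subst sum.Sigma) (use A in auto)
    \<comment> \<open>The pairs (A, r) with A - {r} = B are exactly those with A = B \<union> {r}
      and r outside B.\<close>
    also have "\<dots> = (\<Sum>p\<in>(\<lambda>r. (insert r B, r)) ` ({1..n} - B). ?f p)"
    proof (rule sum.mono_neutral_right)
      show "finite (Sigma ?X (\<lambda>A. A))" using A by auto
      show "(\<lambda>r. (insert r B, r)) ` ({1..n} - B) \<subseteq> Sigma ?X (\<lambda>A. A)"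
        using insert_subsets_of_size[OF True] by auto
      show "\<forall>p\<in>Sigma ?X (\<lambda>A. A) - (\<lambda>r. (insert r B, r)) ` ({1..n} - B). ?f p = 0"
      proof
        fix p assume p: "p \<in> Sigma ?X (\<lambda>A. A) - (\<lambda>r. (insert r B, r)) ` ({1..n} - B)"
        obtain A r where p_eq: "p = (A, r)" by (cases p)
        have Ar: "A \<in> ?X" "r \<in> A" "(A, r) \<notin> (\<lambda>r. (insert r B, r)) ` ({1..n} - B)"
          using p by (auto simp: p_eq)
        have "B \<noteq> A - {r}"
        proof
          assume "B = A - {r}"
          then have "A = insert r B" "r \<in> {1..n} - B" using Ar A(3) by auto
          with Ar(3) show False by blast
        qed
        then show "?f p = 0" by (simp add: p_eq)
      qed
    qed
    also have "\<dots> = (\<Sum>r\<in>{1..n} - B. ?f (insert r B, r))"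
      by (subst sum.reindex) (auto simp: inj_on_def)
    also have "\<dots> = koszul_d n w B"
      unfolding koszul_d_def by (rule sum.cong) auto
    finally show ?thesis using True by simp
  qed
  show ?thesis
    unfolding 1 by (rule ext) (simp only: 2 3)
qed

end

section \<open>Linear combinations of a basis\<close>

definition lincomb ::
    "('a, 'r) ring_scheme \<Rightarrow> ('a, 'b, 'm) module_scheme \<Rightarrow> 'i set \<Rightarrow> ('i \<Rightarrow> 'b) \<Rightarrow> ('i \<Rightarrow> 'a) \<Rightarrow> 'b" where
  "lincomb R M J v c = (\<Oplus>\<^bsub>M\<^esub>j\<in>J. c j \<odot>\<^bsub>M\<^esub> v j)"

locale module_basis = module R M for R :: "('a, 'r) ring_scheme" (structure) and M :: "('a, 'b, 'm) module_scheme" +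
  fixes J :: "'i set" and v :: "'i \<Rightarrow> 'b"
  assumes basis: "is_basis R M J v"
begin

abbreviation "lc \<equiv> lincomb R M J v"

lemma basis_closed: "j \<in> J \<Longrightarrow> v j \<in> carrier M"
  using basis by (auto simp: is_basis_def)

lemma basis_finite: "finite J"
  using basis by (simp add: is_basis_def)

lemma lincomb_cong:
  assumes "\<And>j. j \<in> J \<Longrightarrow> c j \<in> carrier R" "\<And>j. j \<in> J \<Longrightarrow> c j = c' j"
  shows "lc c = lc c'"
proof -
  have "c' j \<in> carrier R" if "j \<in> J" for j using assms[OF that] by simp
  then show ?thesis
    unfolding lincomb_def using assms basis_closed by (intro M.finsum_cong') auto
qed

lemma lincomb_closed: "(\<And>j. j \<in> J \<Longrightarrow> c j \<in> carrier R) \<Longrightarrow> lc c \<in> carrier M"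
  unfolding lincomb_def using basis_closed by (intro M.finsum_closed) auto

lemma lincomb_expand:
  assumes "x \<in> carrier M"
  obtains c where "\<And>j. c j \<in> carrier R" "x = lc c"
proof -
  obtain c where c: "c \<in> J \<rightarrow>\<^sub>E carrier R" "x = lc c"
    using basis assms unfolding is_basis_def lincomb_def by blast
  show thesis
  \<comment> \<open>Extension by 0 gives coefficients that lie in the ring at every index, the form
    used for coordinate vectors throughout.\<close>
  proof (rule that[of "\<lambda>j. if j \<in> J then c j else \<zero>"])
    show "x = lc (\<lambda>j. if j \<in> J then c j else \<zero>)"
      unfolding c(2) by (rule lincomb_cong) (use c(1) in auto)
  qed (use c(1) in auto)
qed

lemma lincomb_inject:
  assumes "\<And>j. j \<in> J \<Longrightarrow> c j \<in> carrier R" "\<And>j. j \<in> J \<Longrightarrow> c' j \<in> carrier R"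
    and "lc c = lc c'" and "j \<in> J"
  shows "c j = c' j"
proof -
  have c: "lc c = lc (restrict c J)"
    by (rule lincomb_cong) (use assms(1) in auto)
  have c': "lc c = lc (restrict c' J)"
    unfolding assms(3) by (rule lincomb_cong) (use assms(2) in auto)
  have "\<exists>!d. d \<in> J \<rightarrow>\<^sub>E carrier R \<and> lc c = lc d"
    using basis lincomb_closed[of c] assms(1) by (simp add: is_basis_def lincomb_def)
  then have uniq: "d = d'" if "d \<in> J \<rightarrow>\<^sub>E carrier R \<and> lc c = lc d" "d' \<in> J \<rightarrow>\<^sub>E carrier R \<and> lc c = lc d'" for d d'
    using that by blast
  have "restrict c J = restrict c' J"
    by (rule uniq) (use c c' assms(1,2) in auto)
  then show ?thesis
    using assms(4) by (metis restrict_apply')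
qed

lemma lincomb_add:
  assumes "\<And>j. j \<in> J \<Longrightarrow> c j \<in> carrier R" "\<And>j. j \<in> J \<Longrightarrow> c' j \<in> carrier R"
  shows "lc c \<oplus>\<^bsub>M\<^esub> lc c' = lc (\<lambda>j. c j \<oplus> c' j)"
proof -
  have "lc (\<lambda>j. c j \<oplus> c' j) = (\<Oplus>\<^bsub>M\<^esub>j\<in>J. c j \<odot>\<^bsub>M\<^esub> v j \<oplus>\<^bsub>M\<^esub> c' j \<odot>\<^bsub>M\<^esub> v j)"
    unfolding lincomb_def using assms basis_closed by (intro M.finsum_cong') (auto simp: smult_l_distr)
  also have "\<dots> = lc c \<oplus>\<^bsub>M\<^esub> lc c'"
    unfolding lincomb_def using assms basis_closed by (intro M.finsum_addf) auto
  finally show ?thesis by simp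
qed

lemma lincomb_smult:
  assumes "\<And>j. j \<in> J \<Longrightarrow> c j \<in> carrier R" "a \<in> carrier R"
  shows "a \<odot>\<^bsub>M\<^esub> lc c = lc (\<lambda>j. a \<otimes> c j)"
proof -
  have "a \<odot>\<^bsub>M\<^esub> lc c = (\<Oplus>\<^bsub>M\<^esub>j\<in>J. a \<odot>\<^bsub>M\<^esub> (c j \<odot>\<^bsub>M\<^esub> v j))"
    unfolding lincomb_def using assms basis_closed basis_finite by (intro finsum_smult_ldistr) auto
  also have "\<dots> = lc (\<lambda>j. a \<otimes> c j)"
    unfolding lincomb_def using assms basis_closed by (intro M.finsum_cong') (auto simp: smult_assoc1)
  finally show ?thesis .
qed

lemma lincomb_zero: "lc (\<lambda>j. \<zero>) = \<zero>\<^bsub>M\<^esub>"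
proof -
  have "lc (\<lambda>j. \<zero>) = (\<Oplus>\<^bsub>M\<^esub>j\<in>J. \<zero>\<^bsub>M\<^esub>)"
    unfolding lincomb_def using basis_closed by (intro M.finsum_cong') auto
  then show ?thesis by simp
qed

lemma lincomb_finsum:
  assumes "finite P" "\<And>p j. p \<in> P \<Longrightarrow> j \<in> J \<Longrightarrow> a p j \<in> carrier R"
  shows "(\<Oplus>\<^bsub>M\<^esub>p\<in>P. lc (a p)) = lc (\<lambda>j. \<Oplus>p\<in>P. a p j)"
  using assms
proof (induction P rule: finite_induct)
  case empty
  then show ?case by (simp add: lincomb_zero)
next
  case (insert p P)
  have "(\<Oplus>\<^bsub>M\<^esub>p\<in>insert p P. lc (a p)) = lc (a p) \<oplus>\<^bsub>M\<^esub> lc (\<lambda>j. \<Oplus>p\<in>P. a p j)"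
    using insert by (subst M.finsum_insert) (auto intro!: lincomb_closed)
  also have "\<dots> = lc (\<lambda>j. a p j \<oplus> (\<Oplus>p\<in>P. a p j))"
    using insert by (intro lincomb_add) (auto intro!: R.finsum_closed)
  also have "\<dots> = lc (\<lambda>j. \<Oplus>p\<in>insert p P. a p j)"
    using insert by (intro lincomb_cong) (auto intro!: R.finsum_closed)
  finally show ?case .
qed

end

section \<open>The homology of the Koszul complex modulo an ideal\<close>

context series_ring
begin

lemma koszul_d_ideal:
  assumes "ideal I S" "\<And>A. u A \<in> I"
  shows "koszul_d n u B \<in> I"
proof -
  interpret I: ideal I S by fact
  have terms: "scale (koszul_sign r B) (shift r (u (insert r B))) \<in> I" if "r \<in> {1..n} - B" for r
    unfolding const_mult[symmetric] indet_mult[symmetric]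
    using that assms(2) by (intro I.I_l_closed) auto
  have sums: "sum g Q \<in> I" if "\<And>r. r \<in> Q \<Longrightarrow> g r \<in> I" for g :: "nat \<Rightarrow> nat multiset \<Rightarrow> 'k" and Q
    using that
  proof (induction Q rule: infinite_finite_induct)
    case (insert r Q)
    then show ?case
      using I.a_closed[of "g r" "sum g Q"] by (simp only: sum.insert insert_iff simp_thms add_eq)
  qed (use I.zero_closed in \<open>simp_all add: zero_eq\<close>)
  show ?thesis
    unfolding koszul_d_def by (rule sums) (rule terms)
qed

lemma koszul_diff_closed:
  "w \<in> carrier (koszul S n (Suc k)) \<Longrightarrow> koszul_diff S indet n (Suc k) w \<in> carrier (koszul S n k)"
  by (simp add: koszul_diff_eq) (auto simp: koszul_carrier koszul_d_closed)

lemma koszul_diff_hom: "koszul_diff S indet n (Suc k) \<in> mod_hom S (koszul S n (Suc k)) (koszul S n k)"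
proof -
  have add: "v + w \<in> carrier (koszul S n (Suc k))"
    if "v \<in> carrier (koszul S n (Suc k))" "w \<in> carrier (koszul S n (Suc k))" for v w
    using that by (auto simp: koszul_carrier)
  have smult: "(\<lambda>A. a \<otimes> w A) \<in> carrier (koszul S n (Suc k))"
    if "a \<in> carrier S" "w \<in> carrier (koszul S n (Suc k))" for a w
    using that by (auto simp: koszul_carrier)
  show ?thesis
    unfolding mod_hom_def koszul_add koszul_smult
  proof (intro CollectI conjI ballI funcsetI koszul_diff_closed)
    fix v w assume vw: "v \<in> carrier (koszul S n (Suc k))" "w \<in> carrier (koszul S n (Suc k))"
    show "koszul_diff S indet n (Suc k) (v + w) = koszul_diff S indet n (Suc k) v + koszul_diff S indet n (Suc k) w"
      unfolding koszul_diff_eq[OF vw(1)] koszul_diff_eq[OF vw(2)] koszul_diff_eq[OF add[OF vw]]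
      using koszul_d_add[of n v w] by (auto simp: fun_eq_iff plus_fun_def)
  next
    fix a w assume aw: "a \<in> carrier S" "w \<in> carrier (koszul S n (Suc k))"
    show "koszul_diff S indet n (Suc k) (\<lambda>A. a \<otimes> w A) = (\<lambda>A. a \<otimes> koszul_diff S indet n (Suc k) w A)"
      unfolding koszul_diff_eq[OF aw(2)] koszul_diff_eq[OF smult[OF aw]]
      using aw koszul_d_mult[of a w] by (auto simp: koszul_carrier)
  qed
qed

lemma koszul_diff_koszul_diff:
  assumes "w \<in> carrier (koszul S n (Suc (Suc k)))"
  shows "koszul_diff S indet n (Suc k) (koszul_diff S indet n (Suc (Suc k)) w) = 0"
  unfolding koszul_diff_eq[OF koszul_diff_closed[OF assms]]
proof
  fix B
  have "koszul_d n (koszul_diff S indet n (Suc (Suc k)) w) B = 0" if B: "B \<in> subsets_of_size n k"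
  proof -
    have "koszul_d n (koszul_diff S indet n (Suc (Suc k)) w) B = koszul_d n (koszul_d n w) B"
      by (rule koszul_d_cong[OF B]) (simp add: koszul_diff_eq[OF assms])
    then show ?thesis using koszul_d_koszul_d finite_if_subsets_of_size[OF B] by metis
  qed
  then show "(if B \<in> subsets_of_size n k then koszul_d n (koszul_diff S indet n (Suc (Suc k)) w) B else 0) = 0 B"
    by simp
qed

lemma koszul_mod_facts:
  assumes I: "ideal I S"
  shows "module S (koszul_mod S I n k)"
    and "carrier (koszul_mod S I n k) = koszul_mod_proj S I n k ` carrier (koszul S n k)"
    and "\<zero>\<^bsub>koszul_mod S I n k\<^esub> = koszul_mod_proj S I n k 0"
    and "\<And>v w. \<lbrakk>v \<in> carrier (koszul S n k); w \<in> carrier (koszul S n k)\<rbrakk> \<Longrightarrow>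
      koszul_mod_proj S I n k v \<oplus>\<^bsub>koszul_mod S I n k\<^esub> koszul_mod_proj S I n k w = koszul_mod_proj S I n k (v + w)"
    and "\<And>a w. \<lbrakk>a \<in> carrier S; w \<in> carrier (koszul S n k)\<rbrakk> \<Longrightarrow>
      a \<odot>\<^bsub>koszul_mod S I n k\<^esub> koszul_mod_proj S I n k w = koszul_mod_proj S I n k (\<lambda>A. a \<otimes> w A)"
    and "\<And>v w. \<lbrakk>v \<in> carrier (koszul S n k); w \<in> carrier (koszul S n k)\<rbrakk> \<Longrightarrow>
      koszul_mod_proj S I n k v = koszul_mod_proj S I n k w \<longleftrightarrow> (\<forall>A. v A - w A \<in> I)"
proof -
  interpret I: ideal I S by fact
  interpret K: module S "koszul S n k" by (rule module_koszul)
  note sub = submodule_ideal_smult(1)[OF module_koszul[of k] I.a_subset]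
  note qm = quotient_module_module[OF module_koszul sub]
  note qf = quotient_module_facts[OF module_koszul sub]
  show "module S (koszul_mod S I n k)"
    using qm(1) by (simp add: koszul_mod_def)
  show "carrier (koszul_mod S I n k) = koszul_mod_proj S I n k ` carrier (koszul S n k)"
    using qf(1) by (simp add: koszul_mod_def koszul_mod_proj_def)
  show "\<zero>\<^bsub>koszul_mod S I n k\<^esub> = koszul_mod_proj S I n k 0"
    using qf(2) by (simp add: koszul_mod_def koszul_mod_proj_def koszul_zero)
  show "a \<odot>\<^bsub>koszul_mod S I n k\<^esub> koszul_mod_proj S I n k w = koszul_mod_proj S I n k (\<lambda>A. a \<otimes> w A)"
    if "a \<in> carrier S" "w \<in> carrier (koszul S n k)" for a w
    using qm(2)[OF that] by (simp add: koszul_mod_def koszul_mod_proj_def koszul_smult)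
  fix v w assume vw: "v \<in> carrier (koszul S n k)" "w \<in> carrier (koszul S n k)"
  show "koszul_mod_proj S I n k v \<oplus>\<^bsub>koszul_mod S I n k\<^esub> koszul_mod_proj S I n k w = koszul_mod_proj S I n k (v + w)"
    using qf(3)[OF vw] by (simp add: koszul_mod_def koszul_mod_proj_def koszul_add)
  have "\<ominus>\<^bsub>koszul S n k\<^esub> w = - w"
    using vw(2) by (intro K.minus_equality) (auto simp: koszul_carrier koszul_add koszul_zero)
  then have "v \<ominus>\<^bsub>koszul S n k\<^esub> w = v - w"
    by (simp add: a_minus_def koszul_add)
  moreover have "v - w \<in> carrier (koszul S n k)"
    using vw by (auto simp: koszul_carrier)
  ultimately show "koszul_mod_proj S I n k v = koszul_mod_proj S I n k w \<longleftrightarrow> (\<forall>A. v A - w A \<in> I)"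
    using qf(4)[OF vw] by (simp add: koszul_mod_proj_def ideal_smult_koszul[OF I])
qed

text \<open>\<open>induced_map\<close> takes a union over a whole coset; the result is a single
  coset because \<partial> is S-linear and so maps I\<Omega> into itself.\<close>

lemma koszul_mod_diff_proj:
  assumes I: "ideal I S" and w: "w \<in> carrier (koszul S n (Suc k))"
  shows "koszul_mod_diff S I n (Suc k) (koszul_mod_proj S I n (Suc k) w) =
    koszul_mod_proj S I n k (koszul_diff S indet n (Suc k) w)"
proof -
  interpret I: ideal I S by fact
  interpret N: submodule "ideal_smult S I (koszul S n (Suc k))" S "koszul S n (Suc k)"
    by (rule submodule_ideal_smult(1)[OF module_koszul I.a_subset])
  note hom = mod_homD[OF module_koszul module_koszul koszul_diff_hom[of k]]
  have const: "koszul_mod_proj S I n k (koszul_diff S indet n (Suc k) x) =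
      koszul_mod_proj S I n k (koszul_diff S indet n (Suc k) w)"
    if x: "x \<in> koszul_mod_proj S I n (Suc k) w" for x
  proof -
    obtain h where h: "h \<in> ideal_smult S I (koszul S n (Suc k))" "x = h + w"
      using x by (auto simp: koszul_mod_proj_def a_r_coset_def' koszul_add)
    then have hK: "h \<in> carrier (koszul S n (Suc k))" "\<And>A. h A \<in> I"
      by (auto simp: ideal_smult_koszul[OF I])
    have diff_x: "koszul_diff S indet n (Suc k) x = koszul_diff S indet n (Suc k) h + koszul_diff S indet n (Suc k) w"
      using hom(2)[OF hK(1) w] by (simp add: h koszul_add)
    have hI: "koszul_diff S indet n (Suc k) h A \<in> I" for A
      unfolding koszul_diff_eq[OF hK(1)]
      using koszul_d_ideal[OF I hK(2)] I.zero_closed by (simp add: zero_eq)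
    have "koszul_diff S indet n (Suc k) h + koszul_diff S indet n (Suc k) w \<in> carrier (koszul S n k)"
      using hom(1)[OF hK(1)] hom(1)[OF w] by (auto simp: koszul_carrier)
    then show ?thesis
      unfolding diff_x using koszul_mod_facts(6)[OF I _ hom(1)[OF w]] hI by simp
  qed
  have self: "w \<in> koszul_mod_proj S I n (Suc k) w"
  proof -
    have "0 + w \<in> koszul_mod_proj S I n (Suc k) w"
      using N.one_closed unfolding koszul_mod_proj_def a_r_coset_def' koszul_add
      by (auto simp: koszul_zero)
    then show ?thesis by simp
  qed
  have "koszul_mod_diff S I n (Suc k) (koszul_mod_proj S I n (Suc k) w) =
      (\<Union>x\<in>koszul_mod_proj S I n (Suc k) w. koszul_mod_proj S I n k (koszul_diff S indet n (Suc k) x))"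
    by (simp add: koszul_mod_diff_def induced_map_def koszul_mod_proj_def)
  also have "\<dots> = koszul_mod_proj S I n k (koszul_diff S indet n (Suc k) w)"
    by (rule UN_constant_eq[OF self], rule ballI, rule const)
  finally show ?thesis .
qed

lemma koszul_mod_diff_hom:
  assumes I: "ideal I S"
  shows "koszul_mod_diff S I n (Suc k) \<in> mod_hom S (koszul_mod S I n (Suc k)) (koszul_mod S I n k)"
proof -
  note f = koszul_mod_facts[OF I]
  note hom = mod_homD[OF module_koszul module_koszul koszul_diff_hom[of k], unfolded koszul_add koszul_smult]
  have add: "v + w \<in> carrier (koszul S n (Suc k))"
    if "v \<in> carrier (koszul S n (Suc k))" "w \<in> carrier (koszul S n (Suc k))" for v w
    using that by (auto simp: koszul_carrier)
  have smult: "(\<lambda>A. a \<otimes> w A) \<in> carrier (koszul S n (Suc k))"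
    if "a \<in> carrier S" "w \<in> carrier (koszul S n (Suc k))" for a w
    using that by (auto simp: koszul_carrier)
  show ?thesis
    unfolding mod_hom_def f(2)
    by (auto simp: f(4,5) koszul_mod_diff_proj[OF I] add smult hom)
qed

end

section \<open>The Koszul cycles form a basis\<close>

text \<open>\<open>ideal_image\<close> is exactness at F_0 in coordinates: F_0 has rank 1, so
  \<delta>_1 is a row vector, and its image is I. The chase above works at every l; the ideal enters
  only here, at l = 0.\<close>

locale minimal_ideal_resolution = minimal_resolution S n b \<alpha>
  for S :: "(nat multiset \<Rightarrow> 'k::field) ring" (structure) and n b \<alpha> +
  fixes I :: "(nat multiset \<Rightarrow> 'k) set"
  assumes I: "ideal I S" and b0: "b 0 = 1"
    and ideal_image: "\<And>f. f \<in> I \<longleftrightarrow>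
      (\<exists>v. (\<forall>p. v p \<in> carrier S) \<and> f = (\<Sum>p\<in>{1..b (Suc 0)}. \<alpha> (Suc 0) 1 p \<otimes> v p))"
begin

lemma ideal_image': "f \<in> I \<longleftrightarrow> (\<exists>v. (\<forall>p. v p \<in> carrier S) \<and> f = diff_mat (Suc 0) v 1)"
  by (simp add: ideal_image diff_mat_def)

lemma one_in: "1 \<in> {1..b 0}"
  by (simp add: b0)

text \<open>Identifies the explicit z_{ij} with the last term of the zigzag that starts at e_{ij}.
  It lies in \<Omega>_i \<otimes> F_0, and F_0 has the single basis index 1.\<close>

lemma koszul_cycle_eq:
  assumes "1 \<le> i" "j \<in> {1..b i}"
  shows "koszul_cycle S n b \<alpha> i j = (\<lambda>A. if A \<in> subsets_of_size n i then lifted_cycle i 0 j A 1 else 0)"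
proof -
  let ?P = "\<lambda>A J. \<Otimes>\<^bsub>S\<^esub>l\<in>{1..i}. diff_quot (elem A l) (\<alpha> l (J (l - 1)) (J l))"
  have P: "?P A J \<in> carrier S" if J: "J \<in> index_paths b i j" for A J
  proof (intro finprod_closed funcsetI diff_quot_closed \<alpha>_closed')
    have J_in: "J l \<in> {1..b l}" if "l \<le> i" for l
    proof -
      have "J l \<in> (if l = 0 then {1} else if l = i then {j} else {1..b l})"
        by (rule PiE_mem[OF J[unfolded index_paths_def]]) (use that in simp)
      then show ?thesis using one_in assms by (auto split: if_splits)
    qed
    fix l assume "l \<in> {1..i}"
    then show "1 \<le> l" "J (l - 1) \<in> {1..b (l - 1)}" "J l \<in> {1..b l}"
      using J_in by auto
  qed
  have c: "(\<Oplus>\<^bsub>S\<^esub>J\<in>index_paths b i j. ?P A J) = lifted_cycle i 0 j A 1" if A: "A \<in> subsets_of_size n i" for A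
  proof -
    have fin: "finite A" "card A = i"
      using A finite_if_subsets_of_size[OF A] by (auto simp: subsets_of_size_def)
    have "(\<Oplus>\<^bsub>S\<^esub>J\<in>index_paths b i j. ?P A J) = (\<Sum>J\<in>index_paths b i j. ?P A J)"
      by (rule finsum_eq) (use P in auto)
    also have "\<dots> = path_sum A j 0 1"
      by (rule path_sum_index_paths) (use assms fin in auto)
    also have "\<dots> = lifted_cycle i 0 j (elem A ` {0<..card A}) 1"
      by (rule lifted_cycle_eq_path_sum[symmetric]) (use assms fin one_in in auto)
    also have "elem A ` {0<..card A} = A"
    proof -
      have "{0<..card A} = {1..card A}" by auto
      then show ?thesis using bij_betw_imp_surj_on[OF elem_bij_betw[OF fin(1)]] by simp
    qed
    finally show ?thesis .
  qed
  have "koszul_cycle S n b \<alpha> i j = (\<lambda>A. if A \<in> subsets_of_size n i then (\<Oplus>\<^bsub>S\<^esub>J\<in>index_paths b i j. ?P A J) else 0)"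
    unfolding koszul_cycle_def by (rule finsum_unit_vec) (use P in \<open>auto intro!: finsum_closed\<close>)
  then show ?thesis using c by (simp add: fun_eq_iff)
qed

lemma koszul_cycle_closed:
  "1 \<le> i \<Longrightarrow> j \<in> {1..b i} \<Longrightarrow> koszul_cycle S n b \<alpha> i j \<in> carrier (koszul S n i)"
  by (simp add: koszul_cycle_eq koszul_carrier lifted_cycle_closed)

text \<open>The last zigzag relation writes \<partial>z_{ij} as \<delta>_1 of the preceding
  component, and the image of \<delta>_1 is I.\<close>

lemma koszul_cycle_boundary:
  assumes "j \<in> {1..b (Suc k)}"
  shows "koszul_diff S indet n (Suc k) (koszul_cycle S n b \<alpha> (Suc k) j) B \<in> I"
proof (cases "B \<in> subsets_of_size n k")
  case True
  have "koszul_d n (koszul_cycle S n b \<alpha> (Suc k) j) B = koszul_d n (\<lambda>A. lifted_cycle (Suc k) 0 j A 1) B"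
    by (rule koszul_d_cong[OF True]) (use assms in \<open>simp add: koszul_cycle_eq\<close>)
  also have "\<dots> = diff_mat (Suc 0) (lifted_cycle k (Suc 0) j B) 1"
    by (rule koszul_d_lifted_cycle) (use True assms one_in in auto)
  also have "\<dots> \<in> I"
    unfolding ideal_image' using lifted_cycle_closed by blast
  finally show ?thesis
    using True assms by (simp add: koszul_diff_eq koszul_cycle_closed)
next
  case False
  interpret I: ideal I S by (rule I)
  show ?thesis
    using False assms I.zero_closed by (simp add: koszul_diff_eq koszul_cycle_closed zero_eq)
qed

section \<open>Spanning and independence modulo the ideal\<close>

definition cycle_sum :: "nat \<Rightarrow> (nat \<Rightarrow> 'k) \<Rightarrow> nat set \<Rightarrow> nat multiset \<Rightarrow> 'k" where
  "cycle_sum i c = (\<Sum>j\<in>{1..b i}. (\<lambda>A. scale (c j) (koszul_cycle S n b \<alpha> i j A)))"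

lemma cycle_sum_eq:
  assumes "1 \<le> i" "A \<in> subsets_of_size n i"
  shows "cycle_sum i c A = (\<Sum>j\<in>{1..b i}. scale (c j) (lifted_cycle i 0 j A 1))"
  unfolding cycle_sum_def sum_fun_apply[where x=A]
  by (rule sum.cong) (use assms in \<open>auto simp: koszul_cycle_eq\<close>)

lemma cycle_sum_closed:
  assumes "1 \<le> i"
  shows "cycle_sum i c \<in> carrier (koszul S n i)"
  unfolding koszul_carrier
proof (intro conjI allI impI)
  fix A
  show "cycle_sum i c A \<in> carrier S"
    unfolding cycle_sum_def sum_fun_apply[where x=A]
    using koszul_cycle_closed[OF assms] by (intro sum_closed scale_closed) (simp add: koszul_carrier)
  assume "A \<notin> subsets_of_size n i"
  then have "koszul_cycle S n b \<alpha> i j A = 0" if "j \<in> {1..b i}" for j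
    using koszul_cycle_closed[OF assms that] by (simp add: koszul_carrier)
  then show "cycle_sum i c A = 0"
    unfolding cycle_sum_def sum_fun_apply[where x=A] by (intro sum.neutral) simp
qed

text \<open>The chase at l = 0: that \<partial>w has coefficients in I means that it is a
  \<delta>_1-image, as the chase requires, and the \<delta>_1-part of the resulting decomposition
  vanishes modulo I.\<close>

lemma koszul_cycle_spanning:
  assumes w: "w \<in> carrier (koszul S n (Suc k))"
    and cyc: "\<And>B. koszul_diff S indet n (Suc k) w B \<in> I"
  obtains u c where "u \<in> carrier (koszul S n (Suc (Suc k)))"
    "\<And>A. w A - (koszul_diff S indet n (Suc (Suc k)) u A + cycle_sum (Suc k) c A) \<in> I"
proof -
  interpret I: ideal I S by (rule I)
  have wS: "w A \<in> carrier S" for A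
    using w by (simp add: koszul_carrier)
  have hyp: "\<exists>v. (\<forall>p. v p \<in> carrier S) \<and> (\<forall>m\<in>{1..b 0}. koszul_d n w B = diff_mat (Suc 0) v m)"
    if "Suc k = Suc i" and "B \<in> subsets_of_size n i" for i B
  proof -
    have "B \<in> subsets_of_size n k" using that by simp
    then have "koszul_d n w B \<in> I"
      using cyc[of B] by (simp add: koszul_diff_eq[OF w])
    then show ?thesis by (simp add: ideal_image' b0)
  qed
  have "\<exists>c u v. (\<forall>A m. u A m \<in> carrier S) \<and> (\<forall>A p. v A p \<in> carrier S) \<and>
    (\<forall>A\<in>subsets_of_size n (Suc k). \<forall>m\<in>{1..b 0}. w A =
      (\<Sum>j\<in>{1..b (0 + Suc k)}. scale (c j) (lifted_cycle (Suc k) 0 j A m)) +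
      koszul_d n (\<lambda>A. u A m) A + diff_mat (Suc 0) (v A) m)"
    by (rule lifted_cycle_spanning[of "\<lambda>A m. w A", OF wS hyp])
  then obtain c u v where u: "\<And>A m. u A m \<in> carrier S" and v: "\<And>A p. v A p \<in> carrier S"
    and eq: "\<And>A m. A \<in> subsets_of_size n (Suc k) \<Longrightarrow> m \<in> {1..b 0} \<Longrightarrow> w A =
      (\<Sum>j\<in>{1..b (0 + Suc k)}. scale (c j) (lifted_cycle (Suc k) 0 j A m)) +
      koszul_d n (\<lambda>A. u A m) A + diff_mat (Suc 0) (v A) m"
    by (elim exE conjE) (rule that, auto simp only:)
  \<comment> \<open>Cutting off the values at sets of other sizes gives an element of \<Omega> and
    does not change the boundary in the degree considered.\<close>
  define u' where "u' A = (if A \<in> subsets_of_size n (Suc (Suc k)) then u A 1 else 0)" for A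
  have u': "u' \<in> carrier (koszul S n (Suc (Suc k)))"
    using u by (auto simp: koszul_carrier u'_def)
  show thesis
  proof (rule that[OF u'])
    fix A
    show "w A - (koszul_diff S indet n (Suc (Suc k)) u' A + cycle_sum (Suc k) c A) \<in> I"
    proof (cases "A \<in> subsets_of_size n (Suc k)")
      case True
      have "koszul_d n u' A = koszul_d n (\<lambda>A. u A 1) A"
        by (rule koszul_d_cong[OF True]) (simp add: u'_def)
      then have "w A - (koszul_diff S indet n (Suc (Suc k)) u' A + cycle_sum (Suc k) c A) =
          diff_mat (Suc 0) (v A) 1"
        using eq[OF True one_in] True by (simp add: koszul_diff_eq[OF u'] cycle_sum_eq del: lifted_cycle.simps)
      then show ?thesis using ideal_image' v by auto
    next
      case False
      then have "w A = 0" "cycle_sum (Suc k) c A = 0"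
        using w cycle_sum_closed[of "Suc k" c] by (simp_all add: koszul_carrier)
      then show ?thesis
        using False I.zero_closed by (simp add: koszul_diff_eq[OF u'] zero_eq)
    qed
  qed
qed

text \<open>An element of I is a value of \<delta>_1; choosing preimages for all A turns the
  congruence into the equation treated by the chase at l = 0.\<close>

lemma koszul_cycle_independent:
  assumes u: "u \<in> carrier (koszul S n (Suc (Suc k)))"
    and eq: "\<And>A. cycle_sum (Suc k) c A - koszul_diff S indet n (Suc (Suc k)) u A \<in> I"
    and j: "j \<in> {1..b (Suc k)}"
  shows "c j = 0"
proof -
  have "\<forall>A. \<exists>v. (\<forall>p. v p \<in> carrier S) \<and>
      cycle_sum (Suc k) c A - koszul_diff S indet n (Suc (Suc k)) u A = diff_mat (Suc 0) v 1"
    using eq unfolding ideal_image' by blast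
  then obtain v where v: "\<And>A p. v A p \<in> carrier S"
    "\<And>A. cycle_sum (Suc k) c A - koszul_diff S indet n (Suc (Suc k)) u A = diff_mat (Suc 0) (v A) 1"
    by metis
  show ?thesis
  proof (rule lifted_cycle_independent[of "\<lambda>A m. u A" v "Suc k" 0 c])
    show "u A \<in> carrier S" for A using u by (simp add: koszul_carrier)
    show "v A p \<in> carrier S" for A p by (rule v)
    show "j \<in> {1..b (0 + Suc k)}" using j by simp
    fix A m assume A: "A \<in> subsets_of_size n (Suc k)" and "m \<in> {1..b 0}"
    then have m: "m = 1" using b0 by simp
    have "(\<Sum>j\<in>{1..b (Suc k)}. scale (c j) (lifted_cycle (Suc k) 0 j A 1)) = cycle_sum (Suc k) c A"
      by (rule cycle_sum_eq[symmetric]) (use A in auto)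
    also have "\<dots> = koszul_diff S indet n (Suc (Suc k)) u A + diff_mat (Suc 0) (v A) 1"
      using v(2)[of A] by (simp only: algebra_simps)
    also have "koszul_diff S indet n (Suc (Suc k)) u A = koszul_d n u A"
      using A by (simp add: koszul_diff_eq[OF u])
    finally show "(\<Sum>j\<in>{1..b (0 + Suc k)}. scale (c j) (lifted_cycle (Suc k) 0 j A m)) =
        koszul_d n u A + diff_mat (Suc 0) (v A) m"
      by (simp only: m add_0)
  qed
qed

text \<open>Every class is represented by an element of \<Omega> whose boundary has coefficients in
  I, and equality of classes becomes a congruence modulo I in \<Omega>. Existence of coefficients is
  then the spanning statement, and uniqueness is independence applied to a difference.\<close>

theorem koszul_cycles_basis:
  fixes k :: nat
  defines "M \<equiv> koszul_mod S I n" and "D \<equiv> koszul_mod_diff S I n" and "i \<equiv> Suc k"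
  defines "z \<equiv> \<lambda>j. koszul_mod_proj S I n i (koszul_cycle S n b \<alpha> i j)"
  shows "\<forall>j\<in>{1..b i}. z j \<in> cycles M D i"
    and "is_basis (ring_of_type_algebra :: 'k ring) (restrict_scalars const (homology M D i)) {1..b i}
      (\<lambda>j. homology_class M D i (z j))"
proof -
  interpret I: ideal I S by (rule I)
  let ?K = "\<lambda>k. carrier (koszul S n k)" and ?p = "koszul_mod_proj S I n"
  let ?d = "\<lambda>k. koszul_diff S indet n k" and ?J = "{1..b i}"
  let ?H = "homology M D i" and ?c = "homology_class M D i"
  let ?H' = "restrict_scalars const ?H"
  note f = koszul_mod_facts[OF I, folded M_def]
  note dp = koszul_mod_diff_proj[OF I, folded D_def]
  have dd: "\<forall>x\<in>carrier (M (Suc (Suc k))). D (Suc k) (D (Suc (Suc k)) x) = \<zero>\<^bsub>M k\<^esub>"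
  proof
    fix x assume x: "x \<in> carrier (M (Suc (Suc k)))"
    obtain w where w: "w \<in> ?K (Suc (Suc k))" "x = ?p (Suc (Suc k)) w"
      using x by (auto simp: f(2))
    then show "D (Suc k) (D (Suc (Suc k)) x) = \<zero>\<^bsub>M k\<^esub>"
      by (simp add: dp koszul_diff_closed koszul_diff_koszul_diff f(3))
  qed
  note h = homology_facts[of S M D k, OF f(1) koszul_mod_diff_hom[OF I, folded M_def D_def] dd, folded i_def]
  interpret H: module S ?H by (rule h(1))
  note hom = mod_homD[OF module_koszul module_koszul koszul_diff_hom[of k], unfolded koszul_add koszul_smult]
  have cyc_iff: "?p i w \<in> cycles M D i \<longleftrightarrow> (\<forall>B. ?d i w B \<in> I)" if w: "w \<in> ?K i" for w
  proof -
    have "?p i w \<in> cycles M D i \<longleftrightarrow> ?p k (?d i w) = ?p k 0"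
      using w dp[of w k] by (auto simp: cycles_def a_kernel_def' i_def f(2,3))
    also have "\<dots> \<longleftrightarrow> (\<forall>B. ?d i w B - 0 B \<in> I)"
    proof (rule f(6))
      show "?d i w \<in> ?K k" using w unfolding i_def by (rule koszul_diff_closed)
    qed (simp add: koszul_carrier)
    finally show ?thesis by simp
  qed
  have zK: "koszul_cycle S n b \<alpha> i j \<in> ?K i" if "j \<in> ?J" for j
    using that by (intro koszul_cycle_closed) (auto simp: i_def)
  have z_cyc: "z j \<in> cycles M D i" if "j \<in> ?J" for j
    unfolding z_def cyc_iff[OF zK[OF that]] using koszul_cycle_boundary that by (auto simp: i_def)
  then show "\<forall>j\<in>?J. z j \<in> cycles M D i" by blast
  \<comment> \<open>Boundaries in the quotient also come from elements u of \<Omega>, so homologous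
    means equal up to \<partial>u modulo I, coefficientwise.\<close>
  have class_eq: "?c (?p i v) = ?c (?p i w) \<longleftrightarrow> (\<exists>u\<in>?K (Suc i). \<forall>A. v A - (?d (Suc i) u A + w A) \<in> I)"
    if v: "v \<in> ?K i" "?p i v \<in> cycles M D i" and w: "w \<in> ?K i" "?p i w \<in> cycles M D i" for v w
  proof -
    have "?p i v = D (Suc i) (?p (Suc i) u) \<oplus>\<^bsub>M i\<^esub> ?p i w \<longleftrightarrow> (\<forall>A. v A - (?d (Suc i) u A + w A) \<in> I)"
      if u: "u \<in> ?K (Suc i)" for u
    proof -
      have du: "?d (Suc i) u \<in> ?K i" by (rule koszul_diff_closed[OF u])
      have "?d (Suc i) u + w \<in> ?K i"
        using du w by (auto simp: koszul_carrier)
      then show ?thesis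
        using f(6)[OF v(1)] f(4)[OF du w(1)] by (simp add: dp[OF u])
    qed
    then show ?thesis
      using h(6)[OF v(2) w(2)] by (auto simp: i_def f(2))
  qed
  have carr: "carrier ?H' = carrier ?H" "\<zero>\<^bsub>?H'\<^esub> = \<zero>\<^bsub>?H\<^esub>" "add ?H' = add ?H"
    by (auto simp: restrict_scalars_def)
  \<comment> \<open>A finite sum uses only carrier, zero and addition, which
    \<open>restrict_scalars\<close> leaves alone, so it can be computed in the S-module
    \<open>?H\<close>.\<close>
  have finsum_H': "finsum ?H' g Q = finsum ?H g Q" for g and Q :: "nat set"
    by (simp add: finsum_def restrict_scalars_def finprod_def)
  have cyc_0: "0 \<in> ?K i" "?p i 0 \<in> cycles M D i"
  proof -
    show 0: "0 \<in> ?K i" by (simp add: koszul_carrier)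
    show "?p i 0 \<in> cycles M D i"
      unfolding cyc_iff[OF 0] using koszul_diff_eq[OF 0[unfolded i_def]] koszul_d_0 I.zero_closed
      by (auto simp: i_def zero_eq)
  qed
  have cyc_add: "v + w \<in> ?K i" "?p i (v + w) \<in> cycles M D i"
    if v: "v \<in> ?K i" "?p i v \<in> cycles M D i" and w: "w \<in> ?K i" "?p i w \<in> cycles M D i" for v w
  proof -
    show vw: "v + w \<in> ?K i" using v w by (auto simp: koszul_carrier)
    have "?d i (v + w) = ?d i v + ?d i w"
      using hom(2)[of v w] v w by (simp add: i_def)
    then show "?p i (v + w) \<in> cycles M D i"
      using v w I.a_closed[unfolded add_eq] by (simp add: cyc_iff vw)
  qed
  have cyc_scale: "(\<lambda>A. scale a (w A)) \<in> ?K i" "?p i (\<lambda>A. scale a (w A)) \<in> cycles M D i"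
    if w: "w \<in> ?K i" "?p i w \<in> cycles M D i" for a w
  proof -
    show aw: "(\<lambda>A. scale a (w A)) \<in> ?K i" using w by (auto simp: koszul_carrier)
    have "?d i (\<lambda>A. scale a (w A)) = (\<lambda>A. const a \<otimes> ?d i w A)"
      using hom(3)[of "const a" w] w by (simp add: i_def const_mult)
    then show "?p i (\<lambda>A. scale a (w A)) \<in> cycles M D i"
      using w I.I_l_closed by (simp add: cyc_iff aw)
  qed
  define s where "s c j = (\<lambda>A. scale (c j) (koszul_cycle S n b \<alpha> i j A))" for c j
  have s_cyc: "s c j \<in> ?K i" "?p i (s c j) \<in> cycles M D i" if "j \<in> ?J" for c j
    using cyc_scale[OF zK[OF that]] z_cyc[OF that] by (simp_all add: s_def z_def)
  have s_class: "c j \<odot>\<^bsub>?H'\<^esub> ?c (z j) = ?c (?p i (s c j))" if "j \<in> ?J" for c j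
  proof -
    have "c j \<odot>\<^bsub>?H'\<^esub> ?c (z j) = const (c j) \<odot>\<^bsub>?H\<^esub> ?c (z j)"
      by (simp add: restrict_scalars_def)
    also have "\<dots> = ?c (const (c j) \<odot>\<^bsub>M i\<^esub> z j)"
      by (rule h(5)) (use z_cyc[OF that] in auto)
    also have "const (c j) \<odot>\<^bsub>M i\<^esub> z j = ?p i (s c j)"
      unfolding z_def by (subst f(5)) (use zK[OF that] in \<open>auto simp: s_def const_mult\<close>)
    finally show ?thesis .
  qed
  have comb: "(\<Oplus>\<^bsub>?H\<^esub>j\<in>Q. ?c (?p i (s c j))) = ?c (?p i (sum (s c) Q)) \<and>
      sum (s c) Q \<in> ?K i \<and> ?p i (sum (s c) Q) \<in> cycles M D i"
    if "finite Q" "Q \<subseteq> ?J" for c Q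
    using that
  proof (induction Q rule: finite_induct)
    case empty
    then show ?case
      using cyc_0 by (simp add: h(3) f(3) zero_fun_def)
  next
    case (insert j Q)
    then have j: "j \<in> ?J" and Q: "Q \<subseteq> ?J" by auto
    note IH = insert.IH[OF Q]
    have "(\<Oplus>\<^bsub>?H\<^esub>j\<in>insert j Q. ?c (?p i (s c j))) = ?c (?p i (s c j)) \<oplus>\<^bsub>?H\<^esub> (\<Oplus>\<^bsub>?H\<^esub>j\<in>Q. ?c (?p i (s c j)))"
      by (rule H.finsum_insert) (use insert.hyps j Q s_cyc in \<open>auto simp: h(2)\<close>)
    also have "\<dots> = ?c (?p i (s c j) \<oplus>\<^bsub>M i\<^esub> ?p i (sum (s c) Q))"
      using IH s_cyc[OF j] h(4) by simp
    also have "?p i (s c j) \<oplus>\<^bsub>M i\<^esub> ?p i (sum (s c) Q) = ?p i (s c j + sum (s c) Q)"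
      by (rule f(4)) (use IH s_cyc[OF j] in auto)
    finally show ?case
      unfolding sum.insert[OF insert.hyps] using cyc_add[OF s_cyc[OF j]] IH by blast
  qed
  have cycle_sum: "cycle_sum i c = sum (s c) ?J" for c
    by (simp add: cycle_sum_def s_def)
  have lc: "(\<Oplus>\<^bsub>?H'\<^esub>j\<in>?J. c j \<odot>\<^bsub>?H'\<^esub> ?c (z j)) = ?c (?p i (cycle_sum i c))" for c
  proof -
    have "(\<Oplus>\<^bsub>?H\<^esub>j\<in>?J. c j \<odot>\<^bsub>?H'\<^esub> ?c (z j)) = (\<Oplus>\<^bsub>?H\<^esub>j\<in>?J. ?c (?p i (s c j)))"
      by (rule H.finsum_cong') (use s_class s_cyc in \<open>auto simp: h(2)\<close>)
    also have "\<dots> = ?c (?p i (cycle_sum i c))"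
      unfolding cycle_sum using comb[of ?J c] by simp
    finally show ?thesis by (simp only: finsum_H')
  qed
  have cs: "cycle_sum i c \<in> ?K i" "?p i (cycle_sum i c) \<in> cycles M D i" for c
    unfolding cycle_sum using comb[of ?J c] by auto
  show "is_basis (ring_of_type_algebra :: 'k ring) ?H' ?J (\<lambda>j. ?c (z j))"
    unfolding is_basis_def lc
  proof (intro conjI ballI)
    show "finite ?J" by simp
    show "(\<lambda>j. ?c (z j)) \<in> ?J \<rightarrow> carrier ?H'"
      using z_cyc by (auto simp: carr h(2))
    fix x assume "x \<in> carrier ?H'"
    then obtain y where y: "y \<in> cycles M D i" "x = ?c y"
      by (auto simp: carr h(2))
    then have "y \<in> carrier (M i)"
      by (simp add: cycles_def a_kernel_def')
    then obtain w where w: "w \<in> ?K i" "y = ?p i w"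
      by (auto simp: f(2))
    have wI: "?d i w B \<in> I" for B
      using cyc_iff[OF w(1)] y(1) by (simp add: w(2))
    obtain u c where u: "u \<in> ?K (Suc i)" "\<And>A. w A - (?d (Suc i) u A + cycle_sum i c A) \<in> I"
      by (rule koszul_cycle_spanning[of w k, folded i_def, OF w(1) wI]) (rule that, auto simp only:)
    have "x = ?c (?p i (cycle_sum i c))"
      using class_eq[OF w(1) _ cs] y u by (auto simp: w(2))
    \<comment> \<open>\<open>is_basis\<close> asks for a unique coefficient function that is
      extensional on the index set.\<close>
    also have "cycle_sum i c = cycle_sum i (restrict c ?J)"
      unfolding cycle_sum_def by (rule sum.cong) auto
    finally have ex: "x = ?c (?p i (cycle_sum i (restrict c ?J)))" .
    show "\<exists>!c. c \<in> ?J \<rightarrow>\<^sub>E carrier (ring_of_type_algebra :: 'k ring) \<and> x = ?c (?p i (cycle_sum i c))"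
    proof (rule ex1I[of _ "restrict c ?J"], intro conjI ex)
      show "restrict c ?J \<in> ?J \<rightarrow>\<^sub>E carrier (ring_of_type_algebra :: 'k ring)"
        by (auto simp: ring_of_type_algebra_def)
    next
      fix c' assume c': "c' \<in> ?J \<rightarrow>\<^sub>E carrier (ring_of_type_algebra :: 'k ring) \<and> x = ?c (?p i (cycle_sum i c'))"
      let ?r = "restrict c ?J"
      obtain u where u: "u \<in> ?K (Suc i)" "\<And>A. cycle_sum i c' A - (?d (Suc i) u A + cycle_sum i ?r A) \<in> I"
        using class_eq[OF cs cs, of c' ?r] c' ex by auto
      have diff: "cycle_sum i (\<lambda>j. c' j - ?r j) A = cycle_sum i c' A - cycle_sum i ?r A" for A
        unfolding cycle_sum_def sum_fun_apply[where x=A] by (simp only: scale_distribs sum_subtractf)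
      have "c' j - ?r j = 0" if "j \<in> ?J" for j
      proof (rule koszul_cycle_independent[of u k "\<lambda>j. c' j - ?r j"])
        show "u \<in> carrier (koszul S n (Suc (Suc k)))" using u by (simp add: i_def)
        show "j \<in> {1..b (Suc k)}" using that by (simp add: i_def)
        show "cycle_sum (Suc k) (\<lambda>j. c' j - ?r j) A - ?d (Suc (Suc k)) u A \<in> I" for A
        proof -
          have "cycle_sum i (\<lambda>j. c' j - ?r j) A - ?d (Suc i) u A =
              cycle_sum i c' A - (?d (Suc i) u A + cycle_sum i ?r A)"
            unfolding diff by (simp only: algebra_simps)
          then show ?thesis using u(2)[of A] by (simp only: i_def)
        qed
      qed
      then show "c' = ?r"
        using c' by (intro extensionalityI[of _ ?J]) (auto simp: PiE_def)
    qed
  qed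
qed

end

section \<open>Resolutions in coordinates\<close>

text \<open>The chosen bases identify F_i with S^{b_i} through \<open>L i\<close>, under which
  \<delta> becomes multiplication by the matrices \<alpha>. Injectivity of \<open>L i\<close> turns
  equations in F_i into equations of coordinates.\<close>

lemma resolution_coordinates:
  fixes S :: "(nat multiset \<Rightarrow> 'k::field) ring" (structure)
    and F :: "nat \<Rightarrow> (nat multiset \<Rightarrow> 'k, 'b) module"
  assumes S: "S = power_series_ring n \<or> S = polynomial_ring n"
    and I: "ideal I S"
    and res: "free_resolution S (quotient_module (ring_module S) I) F \<delta> \<epsilon> b e"
    and minimal: "minimal_complex S n F \<delta>"
    and b0: "b 0 = 1"
    and \<alpha>: "\<And>i k j. \<lbrakk>1 \<le> i; k \<in> {1..b (i - 1)}; j \<in> {1..b i}\<rbrakk> \<Longrightarrow> \<alpha> i k j \<in> carrier S"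
    and \<delta>: "\<And>i j. \<lbrakk>1 \<le> i; j \<in> {1..b i}\<rbrakk> \<Longrightarrow>
      \<delta> i (e i j) = (\<Oplus>\<^bsub>F (i - 1)\<^esub>k\<in>{1..b (i - 1)}. \<alpha> i k j \<odot>\<^bsub>F (i - 1)\<^esub> e (i - 1) k)"
  shows "minimal_ideal_resolution S n b \<alpha> I"
proof -
  have mods: "module S (F i)" and bases: "is_basis S (F i) {1..b i} (e i)"
    and \<delta>_hom: "\<delta> (Suc i) \<in> mod_hom S (F (Suc i)) (F i)" for i
    using res by (auto simp: free_resolution_def)
  have \<epsilon>_hom: "\<epsilon> \<in> mod_hom S (F 0) (quotient_module (ring_module S) I)"
    and \<epsilon>_surj: "\<epsilon> ` carrier (F 0) = carrier (quotient_module (ring_module S) I)"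
    and exact0: "\<delta> (Suc 0) ` carrier (F (Suc 0)) = a_kernel (F 0) (quotient_module (ring_module S) I) \<epsilon>"
    and exactS: "\<delta> (Suc (Suc i)) ` carrier (F (Suc (Suc i))) = a_kernel (F (Suc i)) (F i) (\<delta> (Suc i))" for i
    using res by (auto simp: free_resolution_def)
  have cring: "cring S"
    using mods[of 0] by (rule module.axioms)
  interpret series_ring S n
    by (rule series_ring.intro[OF cring series_ring_axioms.intro[OF S]])
  interpret I: ideal I S by (rule I)
  interpret F: module_basis S "F i" "{1..b i}" "e i" for i
    by (rule module_basis.intro[OF mods module_basis_axioms.intro[OF bases]])
  define L where "L i = lincomb S (F i) {1..b i} (e i)" for i
  note L_closed = F.lincomb_closed[folded L_def] and L_inject = F.lincomb_inject[folded L_def]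
    and L_cong = F.lincomb_cong[folded L_def] and L_smult = F.lincomb_smult[folded L_def]
    and L_expand = F.lincomb_expand[folded L_def] and L_add = F.lincomb_add[folded L_def]
    and L_zero = F.lincomb_zero[folded L_def] and L_finsum = F.lincomb_finsum[folded L_def]
  note dh = mod_homD[OF mods mods \<delta>_hom]
  have \<alpha>_cl: "\<alpha> (Suc i) m p \<in> carrier S" if "m \<in> {1..b i}" "p \<in> {1..b (Suc i)}" for i m p
    using \<alpha>[of "Suc i" m p] that by simp
  have \<delta>_e: "\<delta> (Suc i) (e (Suc i) p) = L i (\<lambda>m. \<alpha> (Suc i) m p)" if "p \<in> {1..b (Suc i)}" for i p
    using \<delta>[of "Suc i" p] that by (simp add: L_def lincomb_def)
  have mat_closed: "(\<Sum>p\<in>{1..b (Suc i)}. \<alpha> (Suc i) m p \<otimes> c p) \<in> carrier S"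
    if "\<And>p. p \<in> {1..b (Suc i)} \<Longrightarrow> c p \<in> carrier S" "m \<in> {1..b i}" for i c m
    by (intro sum_closed m_closed \<alpha>_cl that)
  have \<delta>_L: "\<delta> (Suc i) (L (Suc i) c) = L i (\<lambda>m. \<Sum>p\<in>{1..b (Suc i)}. \<alpha> (Suc i) m p \<otimes> c p)"
    if c: "\<And>p. p \<in> {1..b (Suc i)} \<Longrightarrow> c p \<in> carrier S" for i c
  proof -
    have "\<delta> (Suc i) (L (Suc i) c) = (\<Oplus>\<^bsub>F i\<^esub>p\<in>{1..b (Suc i)}. \<delta> (Suc i) (c p \<odot>\<^bsub>F (Suc i)\<^esub> e (Suc i) p))"
      unfolding L_def lincomb_def by (rule dh(5)) (use c F.basis_closed in auto)
    also have "\<dots> = (\<Oplus>\<^bsub>F i\<^esub>p\<in>{1..b (Suc i)}. L i (\<lambda>m. c p \<otimes> \<alpha> (Suc i) m p))"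
    proof (rule F.M.finsum_cong')
      show "(\<lambda>p. L i (\<lambda>m. c p \<otimes> \<alpha> (Suc i) m p)) \<in> {1..b (Suc i)} \<rightarrow> carrier (F i)"
        by (intro funcsetI L_closed m_closed c \<alpha>_cl)
      fix p assume p: "p \<in> {1..b (Suc i)}"
      have "\<delta> (Suc i) (c p \<odot>\<^bsub>F (Suc i)\<^esub> e (Suc i) p) = c p \<odot>\<^bsub>F i\<^esub> L i (\<lambda>m. \<alpha> (Suc i) m p)"
        using dh(3)[OF c[OF p] F.basis_closed[OF p]] by (simp only: \<delta>_e[OF p])
      also have "\<dots> = L i (\<lambda>m. c p \<otimes> \<alpha> (Suc i) m p)"
        by (intro L_smult c \<alpha>_cl p)
      finally show "\<delta> (Suc i) (c p \<odot>\<^bsub>F (Suc i)\<^esub> e (Suc i) p) = L i (\<lambda>m. c p \<otimes> \<alpha> (Suc i) m p)" .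
    qed simp
    also have "\<dots> = L i (\<lambda>m. \<Oplus>p\<in>{1..b (Suc i)}. c p \<otimes> \<alpha> (Suc i) m p)"
      by (rule L_finsum) (auto intro!: m_closed c \<alpha>_cl)
    also have "\<dots> = L i (\<lambda>m. \<Sum>p\<in>{1..b (Suc i)}. \<alpha> (Suc i) m p \<otimes> c p)"
    proof (rule L_cong)
      fix m assume m: "m \<in> {1..b i}"
      have "(\<Oplus>p\<in>{1..b (Suc i)}. c p \<otimes> \<alpha> (Suc i) m p) = (\<Sum>p\<in>{1..b (Suc i)}. c p \<otimes> \<alpha> (Suc i) m p)"
        by (intro finsum_eq funcsetI m_closed c \<alpha>_cl m)
      also have "\<dots> = (\<Sum>p\<in>{1..b (Suc i)}. \<alpha> (Suc i) m p \<otimes> c p)"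
        by (intro sum.cong refl m_comm c \<alpha>_cl m)
      finally show eq: "(\<Oplus>p\<in>{1..b (Suc i)}. c p \<otimes> \<alpha> (Suc i) m p) = (\<Sum>p\<in>{1..b (Suc i)}. \<alpha> (Suc i) m p \<otimes> c p)" .
      show "(\<Oplus>p\<in>{1..b (Suc i)}. c p \<otimes> \<alpha> (Suc i) m p) \<in> carrier S"
        unfolding eq by (rule mat_closed[OF c m])
    qed
    finally show ?thesis .
  qed
  have kernel: "\<delta> (Suc i) x = \<zero>\<^bsub>F i\<^esub> \<longleftrightarrow> (\<exists>y\<in>carrier (F (Suc (Suc i))). x = \<delta> (Suc (Suc i)) y)"
    if "x \<in> carrier (F (Suc i))" for i x
    using that exactS[of i] by (auto simp: a_kernel_def')
  have complex: "(\<Sum>p\<in>{1..b (Suc l)}. \<alpha> (Suc l) m p \<otimes> (\<Sum>q\<in>{1..b (Suc (Suc l))}. \<alpha> (Suc (Suc l)) p q \<otimes> v q)) = 0"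
    if m: "m \<in> {1..b l}" and v: "\<And>q. v q \<in> carrier S" for l m v
  proof -
    let ?w = "\<lambda>p. \<Sum>q\<in>{1..b (Suc (Suc l))}. \<alpha> (Suc (Suc l)) p q \<otimes> v q"
    have w: "?w p \<in> carrier S" if "p \<in> {1..b (Suc l)}" for p
      using v that by (rule mat_closed)
    have "L l (\<lambda>m. \<Sum>p\<in>{1..b (Suc l)}. \<alpha> (Suc l) m p \<otimes> ?w p) = \<delta> (Suc l) (L (Suc l) ?w)"
      using w by (rule \<delta>_L[symmetric])
    also have "L (Suc l) ?w = \<delta> (Suc (Suc l)) (L (Suc (Suc l)) v)"
      using v by (rule \<delta>_L[symmetric])
    also have "\<delta> (Suc l) \<dots> = \<zero>\<^bsub>F l\<^esub>"
      using kernel[OF dh(1)[OF L_closed[of "Suc (Suc l)" v, OF v]]] L_closed[of "Suc (Suc l)" v, OF v] by blast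
    finally have "L l (\<lambda>m. \<Sum>p\<in>{1..b (Suc l)}. \<alpha> (Suc l) m p \<otimes> ?w p) = L l (\<lambda>m. 0)"
      using L_zero[of l] by (simp add: zero_eq)
    then show ?thesis
      by (rule L_inject[rotated 2, OF _ m]) (use mat_closed w in auto)
  qed
  have exact: "\<exists>w. (\<forall>q. w q \<in> carrier S) \<and> (\<forall>p\<in>{1..b (Suc l)}. v p =
        (\<Sum>q\<in>{1..b (Suc (Suc l))}. \<alpha> (Suc (Suc l)) p q \<otimes> w q))"
    if v: "\<And>p. v p \<in> carrier S" and v0: "\<And>m. m \<in> {1..b l} \<Longrightarrow> (\<Sum>p\<in>{1..b (Suc l)}. \<alpha> (Suc l) m p \<otimes> v p) = 0" for l v
  proof -
    have vc: "L (Suc l) v \<in> carrier (F (Suc l))" by (rule L_closed[OF v])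
    have "\<delta> (Suc l) (L (Suc l) v) = L l (\<lambda>m. \<Sum>p\<in>{1..b (Suc l)}. \<alpha> (Suc l) m p \<otimes> v p)"
      using v by (rule \<delta>_L)
    also have "\<dots> = L l (\<lambda>m. 0)"
      by (rule L_cong) (use v0 in \<open>simp_all del: atLeastAtMost_iff\<close>)
    also have "\<dots> = \<zero>\<^bsub>F l\<^esub>"
      using L_zero[of l] by (simp add: zero_eq)
    finally obtain y where y: "y \<in> carrier (F (Suc (Suc l)))" "L (Suc l) v = \<delta> (Suc (Suc l)) y"
      using kernel[OF vc] by blast
    obtain w where w: "\<And>q. w q \<in> carrier S" "y = L (Suc (Suc l)) w"
      using L_expand[OF y(1)] by blast
    have eq: "L (Suc l) v = L (Suc l) (\<lambda>p. \<Sum>q\<in>{1..b (Suc (Suc l))}. \<alpha> (Suc (Suc l)) p q \<otimes> w q)"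
      unfolding y(2) w(2) using w(1) by (rule \<delta>_L)
    have "v p = (\<Sum>q\<in>{1..b (Suc (Suc l))}. \<alpha> (Suc (Suc l)) p q \<otimes> w q)" if p: "p \<in> {1..b (Suc l)}" for p
      using eq by (rule L_inject[rotated 2, OF _ p]) (use v mat_closed w in auto)
    with w(1) show ?thesis by blast
  qed
  have min: "\<alpha> (Suc l) m p {#} = 0" if m: "m \<in> {1..b l}" and p: "p \<in> {1..b (Suc l)}" for l m p
  proof -
    \<comment> \<open>The series without constant term form an ideal containing all x_r. The
      inclusion of \<open>indet_ideal S n\<close> in it is all that minimality of the matrices
      requires.\<close>
    let ?J = "{f \<in> carrier S. f {#} = 0}"
    have J: "ideal ?J S"
    proof (rule idealI)
      show "ring S" by (rule ring_axioms)
      show "subgroup ?J (add_monoid S)"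
        by (rule add.subgroupI) (auto simp: add_eq a_inv_eq zero_eq intro!: exI[of _ 0])
    qed (auto simp: mult_empty)
    have "indet_ideal S n \<subseteq> ?J"
      unfolding indet_ideal_def
    proof (rule genideal_minimal[OF J])
      have "indet r {#} = (0 :: 'k)" for r by (simp add: indet_def)
      then show "indet ` {1..n} \<subseteq> ?J" by auto
    qed
    then have nJ: "f \<in> carrier S" "f {#} = 0" if "f \<in> indet_ideal S n" for f
      using that by auto
    \<comment> \<open>Elements with all coordinates in \<open>?J\<close> form a submodule containing
      the products that generate the submodule in the minimality condition; uniqueness of
      coordinates then gives the claim for \<alpha>.\<close>
    let ?N = "{L l c |c. \<forall>m. c m \<in> ?J}"
    have NI: "L l c \<in> ?N" if "\<forall>m. c m \<in> ?J" for c
      using that by (intro CollectI exI[of _ c] conjI refl)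
    have "ideal_smult S (indet_ideal S n) (F l) \<subseteq> ?N"
    proof (rule submodule_ideal_smult(3)[OF mods])
      show "indet_ideal S n \<subseteq> carrier S" using nJ by auto
      show "submodule ?N S (F l)"
      proof (rule F.submoduleI)
        show "?N \<subseteq> carrier (F l)" by (auto intro!: L_closed)
        show "\<zero>\<^bsub>F l\<^esub> \<in> ?N"
          using NI[of "\<lambda>m. 0"] L_zero[of l] by (simp add: zero_eq)
        show smult: "a \<odot>\<^bsub>F l\<^esub> x \<in> ?N" if a: "a \<in> carrier S" and x: "x \<in> ?N" for a x
        proof -
          obtain c where c: "x = L l c" "\<forall>m. c m \<in> ?J"
            using x by (elim CollectE exE conjE)
          have "a \<odot>\<^bsub>F l\<^esub> x = L l (\<lambda>m. a \<otimes> c m)"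
            unfolding c(1) by (rule L_smult) (use c(2) a in simp_all)
          moreover have "\<forall>m. a \<otimes> c m \<in> ?J"
            using c(2) a by (simp add: mult_empty)
          ultimately show ?thesis 
            using NI[of "\<lambda>m. a \<otimes> c m"] by (simp only: simp_thms)
        qed
        show "\<ominus>\<^bsub>F l\<^esub> x \<in> ?N" if x: "x \<in> ?N" for x
        proof -
          have "x \<in> carrier (F l)" using x by (auto intro!: L_closed)
          then have "\<ominus>\<^bsub>F l\<^esub> x = (\<ominus> \<one>) \<odot>\<^bsub>F l\<^esub> x"
            using F.smult_l_minus[OF one_closed] F.smult_one by simp
          then show ?thesis using smult[OF _ x, of "\<ominus> \<one>"] by simp
        qed
        show "x \<oplus>\<^bsub>F l\<^esub> y \<in> ?N" if xy: "x \<in> ?N" "y \<in> ?N" for x y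
        proof -
          obtain c c' where c: "\<forall>m. c m \<in> ?J" "x = L l c" "\<forall>m. c' m \<in> ?J" "y = L l c'"
            using xy by (elim CollectE exE conjE)
          have "x \<oplus>\<^bsub>F l\<^esub> y = L l (\<lambda>m. c m \<oplus> c' m)"
            unfolding c(2,4) by (rule L_add) (use c in simp_all)
          moreover have "\<forall>m. c m \<oplus> c' m \<in> ?J"
            using c(1,3) by (simp add: add_eq)
          ultimately show ?thesis 
            using NI[of "\<lambda>m. c m \<oplus> c' m"] by (simp only: simp_thms)
        qed
      qed
      fix f x assume f: "f \<in> indet_ideal S n" and x: "x \<in> carrier (F l)"
      obtain c where c: "\<And>m. c m \<in> carrier S" "x = L l c"
        using L_expand[OF x] by blast
      have "f \<odot>\<^bsub>F l\<^esub> x = L l (\<lambda>m. f \<otimes> c m)"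
        unfolding c(2) by (rule L_smult) (use c nJ[OF f] in auto)
      moreover have "\<forall>m. f \<otimes> c m \<in> ?J"
        using c(1) nJ[OF f] by (simp add: mult_empty)
      ultimately show "f \<odot>\<^bsub>F l\<^esub> x \<in> ?N" 
            using NI[of "\<lambda>m. f \<otimes> c m"] by (simp only: simp_thms)
    qed
    moreover have "\<delta> (Suc l) (e (Suc l) p) \<in> ideal_smult S (indet_ideal S n) (F l)"
      using minimal F.basis_closed[OF p] by (auto simp: minimal_complex_def)
    ultimately have "L l (\<lambda>m. \<alpha> (Suc l) m p) \<in> ?N"
      unfolding \<delta>_e[OF p] by (rule subsetD)
    then obtain c where c: "L l (\<lambda>m. \<alpha> (Suc l) m p) = L l c" "\<forall>m. c m \<in> ?J"
      by (elim CollectE exE conjE)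
    have "\<alpha> (Suc l) m p = c m"
      using c(1) by (rule L_inject[rotated 2, OF _ m]) (use c(2) \<alpha>_cl p in auto)
    then show ?thesis using c(2) by simp
  qed
  have ideal_image: "f \<in> I \<longleftrightarrow> (\<exists>v. (\<forall>p. v p \<in> carrier S) \<and> f = (\<Sum>p\<in>{1..b (Suc 0)}. \<alpha> (Suc 0) 1 p \<otimes> v p))" for f
  proof -
    let ?Q = "quotient_module (ring_module S) I"
    note RM = module_ring_module[OF cring]
    note q = quotient_module_module[OF RM(1) RM(2)[OF I]]
    note qf = quotient_module_facts[OF RM(1) RM(2)[OF I]]
    have rm: "carrier (ring_module S) = carrier S" "(\<odot>\<^bsub>ring_module S\<^esub>) = (\<otimes>)"
      "\<zero>\<^bsub>ring_module S\<^esub> = \<zero>" "\<And>x. I +>\<^bsub>ring_module S\<^esub> x = I +> x"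
      "\<And>x y. x \<ominus>\<^bsub>ring_module S\<^esub> y = x \<ominus> y"
      by (auto simp: ring_module_def a_r_coset_def' a_minus_def a_inv_def m_inv_def)
    note eh = mod_homD[OF mods q(1) \<epsilon>_hom]
    have L0: "L 0 c = c 1 \<odot>\<^bsub>F 0\<^esub> e 0 1" if "c 1 \<in> carrier S" for c
      using that F.basis_closed[of 1 0] by (simp add: L_def lincomb_def b0)
    have one_in: "1 \<in> {1..b 0}" by (simp add: b0)
    have e01: "e 0 1 \<in> carrier (F 0)" by (rule F.basis_closed[OF one_in])
    \<comment> \<open>The generator of F_0 need not map to the class of 1; its image is represented
      by some u, which surjectivity of \<epsilon> shows to be invertible modulo I.\<close>
    obtain u where u: "u \<in> carrier S" "\<epsilon> (e 0 1) = I +> u"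
      using eh(1)[OF e01] by (auto simp: qf(1) rm)
    have \<epsilon>: "\<epsilon> (g \<odot>\<^bsub>F 0\<^esub> e 0 1) = I +> (g \<otimes> u)" if "g \<in> carrier S" for g
      using eh(3)[OF that e01] q(2)[of g u] that u by (simp add: rm)
    have coset: "I +> x = I +> y \<longleftrightarrow> x \<ominus> y \<in> I" if "x \<in> carrier S" "y \<in> carrier S" for x y
      using qf(4)[of x y] that by (simp add: rm)
    have "I +> \<one> \<in> \<epsilon> ` carrier (F 0)"
      unfolding \<epsilon>_surj by (auto simp: qf(1) rm)
    then obtain x where x: "x \<in> carrier (F 0)" "\<epsilon> x = I +> \<one>" by auto
    obtain c where c: "\<And>j. c j \<in> carrier S" "x = L 0 c"
      using L_expand[OF x(1)] by blast
    have "I +> (c 1 \<otimes> u) = I +> \<one>"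
      using x(2) \<epsilon>[OF c(1)] L0[OF c(1)] c(2) by simp
    then have unit: "c 1 \<otimes> u \<ominus> \<one> \<in> I"
      using coset[of "c 1 \<otimes> u" \<one>] c(1) u by simp
    \<comment> \<open>Since u is a unit modulo I, the kernel of \<epsilon> is I times the generator,
      just as if u were 1.\<close>
    have I_iff: "f \<in> I \<longleftrightarrow> \<epsilon> (f \<odot>\<^bsub>F 0\<^esub> e 0 1) = \<zero>\<^bsub>?Q\<^esub>" if f: "f \<in> carrier S"
    proof -
      have "f \<in> I \<longleftrightarrow> f \<otimes> u \<in> I"
      proof
        show "f \<otimes> u \<in> I" if "f \<in> I" using that u(1) by (rule I.I_r_closed)
        assume fu: "f \<otimes> u \<in> I"
        \<comment> \<open>Here \<open>c 1\<close> is an inverse of u modulo I; the second summand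
          corrects the error by a multiple of an element of I.\<close>
        have "f = (f \<otimes> u) \<otimes> c 1 \<oplus> \<ominus> (f \<otimes> (c 1 \<otimes> u \<ominus> \<one>))"
        proof -
          have "f \<otimes> (c 1 \<otimes> u \<ominus> \<one>) = (f \<otimes> u) \<otimes> c 1 \<oplus> \<ominus> f"
            using f c(1)[of 1] u(1) by (simp add: a_minus_def r_distr r_minus m_ac)
          then show ?thesis
            using f c(1)[of 1] u(1) by (simp add: minus_add a_assoc[symmetric] r_neg)
        qed
        moreover have "(f \<otimes> u) \<otimes> c 1 \<oplus> \<ominus> (f \<otimes> (c 1 \<otimes> u \<ominus> \<one>)) \<in> I"
          by (intro I.a_closed I.a_inv_closed I.I_r_closed[OF fu c(1)] I.I_l_closed[OF unit f])
        ultimately show "f \<in> I" by simp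
      qed
      also have "\<dots> \<longleftrightarrow> I +> (f \<otimes> u) = I +> \<zero>"
        using coset[of "f \<otimes> u" \<zero>] f u by (simp add: a_minus_def)
      finally show ?thesis
        by (simp only: \<epsilon>[OF f] qf(2) rm)
    qed
    have mat1: "(\<Sum>p\<in>{1..b (Suc 0)}. \<alpha> (Suc 0) m p \<otimes> v p) \<in> carrier S"
      if "\<And>p. v p \<in> carrier S" "m \<in> {1..b 0}" for v m
      using that by (intro mat_closed)
    show ?thesis
    proof
      assume fI: "f \<in> I"
      then have f: "f \<in> carrier S" by (rule I.a_Hcarr)
      have "f \<odot>\<^bsub>F 0\<^esub> e 0 1 \<in> \<delta> (Suc 0) ` carrier (F (Suc 0))"
        unfolding exact0 using I_iff[OF f] fI f e01 by (simp add: a_kernel_def')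
      then obtain y where y: "y \<in> carrier (F (Suc 0))" "f \<odot>\<^bsub>F 0\<^esub> e 0 1 = \<delta> (Suc 0) y" by auto
      obtain v where v: "\<And>q. v q \<in> carrier S" "y = L (Suc 0) v"
        using L_expand[OF y(1)] by blast
      have "L 0 (\<lambda>m. f) = L 0 (\<lambda>m. \<Sum>p\<in>{1..b (Suc 0)}. \<alpha> (Suc 0) m p \<otimes> v p)"
        using y(2) L0[of "\<lambda>m. f"] f \<delta>_L[of 0 v] v by simp
      then have "f = (\<Sum>p\<in>{1..b (Suc 0)}. \<alpha> (Suc 0) 1 p \<otimes> v p)"
        by (rule L_inject[rotated 2, OF _ one_in]) (use f mat1 v in auto)
      with v(1) show "\<exists>v. (\<forall>p. v p \<in> carrier S) \<and> f = (\<Sum>p\<in>{1..b (Suc 0)}. \<alpha> (Suc 0) 1 p \<otimes> v p)"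
        by blast
    next
      assume "\<exists>v. (\<forall>p. v p \<in> carrier S) \<and> f = (\<Sum>p\<in>{1..b (Suc 0)}. \<alpha> (Suc 0) 1 p \<otimes> v p)"
      then obtain v where v: "\<And>p. v p \<in> carrier S" and fv: "f = (\<Sum>p\<in>{1..b (Suc 0)}. \<alpha> (Suc 0) 1 p \<otimes> v p)"
        by blast
      have f: "f \<in> carrier S" unfolding fv by (rule mat1[OF v one_in])
      have "f \<odot>\<^bsub>F 0\<^esub> e 0 1 = L 0 (\<lambda>m. \<Sum>p\<in>{1..b (Suc 0)}. \<alpha> (Suc 0) m p \<otimes> v p)"
        using L0[of "\<lambda>m. \<Sum>p\<in>{1..b (Suc 0)}. \<alpha> (Suc 0) m p \<otimes> v p"] f by (simp add: fv)
      also have "\<dots> = \<delta> (Suc 0) (L (Suc 0) v)"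
        using v by (rule \<delta>_L[symmetric])
      finally have "f \<odot>\<^bsub>F 0\<^esub> e 0 1 \<in> \<delta> (Suc 0) ` carrier (F (Suc 0))"
        using L_closed[of "Suc 0" v, OF v] by blast
      then show "f \<in> I"
        unfolding exact0 I_iff[OF f] by (simp add: a_kernel_def')
    qed
  qed
  show ?thesis
    by unfold_locales (fact \<alpha>_cl min complex exact I b0 ideal_image)+
qed

theorem theorem1p3:
  fixes S :: "(nat multiset \<Rightarrow> 'k::field) ring"
    and n :: nat
    and I :: "(nat multiset \<Rightarrow> 'k) set"
    and F :: "nat \<Rightarrow> (nat multiset \<Rightarrow> 'k, 'b) module"
    and \<delta> :: "nat \<Rightarrow> 'b \<Rightarrow> 'b"
    and \<epsilon> :: "'b \<Rightarrow> (nat multiset \<Rightarrow> 'k) set"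
    and b :: "nat \<Rightarrow> nat"
    and e :: "nat \<Rightarrow> nat \<Rightarrow> 'b"
    and G :: "nat \<Rightarrow> int \<Rightarrow> 'b set"
    and \<alpha> :: "nat \<Rightarrow> nat \<Rightarrow> nat \<Rightarrow> nat multiset \<Rightarrow> 'k"
  assumes "S = power_series_ring n \<or>
      S = polynomial_ring n \<and> graded_ideal I \<and> resolution_grading n I F \<delta> \<epsilon> b e G"
    and "ideal I S" and "I \<noteq> carrier S"
    and "free_resolution S (quotient_module (ring_module S) I) F \<delta> \<epsilon> b e"
    and "minimal_complex S n F \<delta>"
    and "b 0 = 1"
    and "\<And>i k j. \<lbrakk>1 \<le> i; k \<in> {1..b (i - 1)}; j \<in> {1..b i}\<rbrakk> \<Longrightarrow> \<alpha> i k j \<in> carrier S"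
    and "\<And>i j. \<lbrakk>1 \<le> i; j \<in> {1..b i}\<rbrakk> \<Longrightarrow>
      \<delta> i (e i j) = (\<Oplus>\<^bsub>F (i - 1)\<^esub>k\<in>{1..b (i - 1)}. \<alpha> i k j \<odot>\<^bsub>F (i - 1)\<^esub> e (i - 1) k)"
  shows "\<forall>i\<in>{1..n}.
      (\<forall>j\<in>{1..b i}. koszul_mod_proj S I n i (koszul_cycle S n b \<alpha> i j)
          \<in> cycles (koszul_mod S I n) (koszul_mod_diff S I n) i) \<and>
      is_basis (ring_of_type_algebra :: 'k ring)
        (restrict_scalars const (homology (koszul_mod S I n) (koszul_mod_diff S I n) i))
        {1..b i}
        (\<lambda>j. homology_class (koszul_mod S I n) (koszul_mod_diff S I n) i
           (koszul_mod_proj S I n i (koszul_cycle S n b \<alpha> i j)))"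
  proof
  fix i assume i: "i \<in> {1..n}"
  have "S = power_series_ring n \<or> S = polynomial_ring n" using assms(1) by blast
  then interpret minimal_ideal_resolution S n b \<alpha> I
    by (rule resolution_coordinates[OF _ assms(2) assms(4-8)])
  obtain k where "i = Suc k" using i by (cases i) auto
  then show "(\<forall>j\<in>{1..b i}. koszul_mod_proj S I n i (koszul_cycle S n b \<alpha> i j)
          \<in> cycles (koszul_mod S I n) (koszul_mod_diff S I n) i) \<and>
      is_basis (ring_of_type_algebra :: 'k ring)
        (restrict_scalars const (homology (koszul_mod S I n) (koszul_mod_diff S I n) i))
        {1..b i}
        (\<lambda>j. homology_class (koszul_mod S I n) (koszul_mod_diff S I n) i
           (koszul_mod_proj S I n i (koszul_cycle S n b \<alpha> i j)))"
    using koszul_cycles_basis[of k] by simp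
qed

end
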